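(* For every $a>0$ with $a\neq1$, the (full) isometry group of $(\mathbb{C}P^3,g_a)$ is $$\mathrm{Iso}(\mathbb{C}P^3,g_a)=\{\varphi \mid \pi\circ A=\varphi\circ\pi \text{ for some } A\in \mathrm{Sp}(2)\cong \mathrm{SU}(4)\cap\mathrm{Sp}(4,\mathbb{C})\}\rtimes\mathbb{Z}_2,$$ where the $\mathbb{Z}_2$ factor is generated by the map of $\mathbb{C}P^3$ induced by complex conjugation $p\mapsto\overline{p}$ on $\mathbb{C}^4$.
   Context: Identify $\mathbb{R}^8\cong\mathbb{C}^4\cong\mathbb{H}^2$ via $(z_1,z_2,z_3,z_4)\leftrightarrow(z_1+z_2j,\,z_3+z_4j)$ and let $i,j,k$ act by left multiplication; thus $jq=(-\bar z_2,\bar z_1,-\bar z_4,\bar z_3)$ and $kq=i(jq)$. Let $\pi:\mathbb{S}^7\subset\mathbb{C}^4\to\mathbb{C}P^3$ be the Hopf fibration (vertical space at $q$ spanned by $iq$), $g_1$ the Fubini–Study metric for which $\pi$ is a Riemannian submersion from the round sphere of constant curvature $1$. Define $\mathcal{D}_1^2(\pi(q))=d\pi_q(\mathrm{span}\{jq,kq\})$ and $\mathcal{D}_2^4(\pi(q))=d\pi_q(\mathrm{span}\{iq,jq,kq\}^\perp)$ (orthogonal complement in $T_q\mathbb{S}^7$); these are well defined and $T\mathbb{C}P^3=\mathcal{D}_1^2\oplus\mathcal{D}_2^4$ is $g_1$-orthogonal. For $a>0$ let $g_a$ be the metric equal to $g_1$ on $\mathcal{D}_1^2\times\mathcal{D}_1^2$,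 $a\,g_1$ on $\mathcal{D}_2^4\times\mathcal{D}_2^4$, and $0$ on $\mathcal{D}_1^2\times\mathcal{D}_2^4$. Here $\mathrm{Sp}(2)$ is the group of matrices in $\mathrm{SU}(4)$ whose action on $\mathbb{C}^4$ commutes with the map $q\mapsto jq$. For $\epsilon\in\mathbb{Z}_2$ put $\epsilon(p)=p$ if $\epsilon=0$ and $\epsilon(p)=\overline{p}$ if $\epsilon=1$; pairs $(A,\epsilon)$ act on $\mathbb{C}^4$ by $(A,\epsilon)\cdot p=A\,\epsilon(p)$, with product $(A,\epsilon)\circ(B,\nu)=(A\,\epsilon(B),\epsilon+\nu)$, where $\epsilon(B)$ is $B$ or its complex conjugate matrix $\overline{B}$; this induces the action on $\mathbb{C}P^3$. An isometry is a smooth metric-preserving map. *)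

theory Defs
  imports "HOL-Analysis.Analysis" "HOL-Algebra.Elementary_Groups"
begin

section \<open>Smooth maps between open subsets of normed spaces\<close>

text \<open>Meaningful for open \<open>S\<close> and finite-dimensional domains: all iterated directional derivatives
  up to order \<open>k\<close> exist on \<open>S\<close>, the ones below the top order are differentiable, and those of
  order \<open>k\<close> are continuous.\<close>

primrec C_k_on :: "nat \<Rightarrow> 'a set \<Rightarrow> ('a::real_normed_vector \<Rightarrow> 'b::real_normed_vector) \<Rightarrow> bool" where
  "C_k_on 0 S f \<longleftrightarrow> continuous_on S f"
| "C_k_on (Suc k) S f \<longleftrightarrow>
     (\<forall>x\<in>S. f differentiable (at x)) \<and> (\<forall>v. C_k_on k S (\<lambda>x. frechet_derivative f (at x) v))"

definition smooth_on :: "'a set \<Rightarrow> ('a::real_normed_vector \<Rightarrow> 'b::real_normed_vector) \<Rightarrow> bool" where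
  "smooth_on S f \<longleftrightarrow> (\<forall>k. C_k_on k S f)"


section \<open>Quaternionic structure on \<open>\<complex>\<^sup>4\<close>\<close>

text \<open>The inner product \<open>\<bullet>\<close> on \<^typ>\<open>complex^4\<close> is the real Euclidean one of \<open>\<real>\<^sup>8\<close>.\<close>

definition iq :: "complex^4 \<Rightarrow> complex^4" where
  "iq q = \<i> *s q"

definition jq :: "complex^4 \<Rightarrow> complex^4" where
  "jq q = vector [- cnj (q$2), cnj (q$1), - cnj (q$4), cnj (q$3)]"

definition kq :: "complex^4 \<Rightarrow> complex^4" where
  "kq q = iq (jq q)"

definition conj_vec :: "complex^4 \<Rightarrow> complex^4" where
  "conj_vec q = (\<chi> m. cnj (q$m))"


section \<open>The manifold \<open>\<complex>P\<^sup>3\<close>\<close>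

quotient_type cp3 = "complex^4" / partial:
  "\<lambda>p q::complex^4. p \<noteq> 0 \<and> q \<noteq> 0 \<and> (\<exists>c. q = c *s p)"
proof (rule part_equivpI)
  show "\<exists>x::complex^4. x \<noteq> 0 \<and> x \<noteq> 0 \<and> (\<exists>c. x = c *s x)"
    by (rule exI[of _ "axis 1 1"]) (auto intro: exI[of _ 1] simp: axis_eq_0_iff)
  show "symp (\<lambda>p q::complex^4. p \<noteq> 0 \<and> q \<noteq> 0 \<and> (\<exists>c. q = c *s p))"
  proof (rule sympI, elim conjE exE, intro conjI)
    fix p q :: "complex^4" and c
    assume "q \<noteq> 0" "q = c *s p"
    then have "p = inverse c *s q" by (auto simp: vector_smult_assoc)
    then show "\<exists>c. p = c *s q" ..
  qed
  show "transp (\<lambda>p q::complex^4. p \<noteq> 0 \<and> q \<noteq> 0 \<and> (\<exists>c. q = c *s p))"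
    by (rule transpI) (auto simp: vector_smult_assoc)
qed

text \<open>The canonical projection, meaningful on all of \<open>\<complex>\<^sup>4 - {0}\<close>. The Hopf fibration is its
  restriction to the unit sphere \<open>S\<^sup>7\<close>.\<close>

definition hopf :: "complex^4 \<Rightarrow> cp3" where
  "hopf q = abs_cp3 q"

text \<open>The four standard affine parametrizations \<open>\<complex>\<^sup>3 \<rightarrow> U\<^sub>m = {[z]. z\<^sub>m \<noteq> 0}\<close>, with
  inverse \<open>[z] \<mapsto> (z\<^sub>l / z\<^sub>m)\<^bsub>l \<noteq> m\<^esub>\<close>.\<close>

definition affine_param :: "4 \<Rightarrow> complex^3 \<Rightarrow> cp3" where
  "affine_param m w = hopf
     (if m = 1 then vector [1, w$1, w$2, w$3]
      else if m = 2 then vector [w$1, 1, w$2, w$3]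
      else if m = 3 then vector [w$1, w$2, 1, w$3]
      else vector [w$1, w$2, w$3, 1])"

definition chart_dom :: "4 \<Rightarrow> cp3 set" where
  "chart_dom m = range (affine_param m)"

definition chart :: "4 \<Rightarrow> cp3 \<Rightarrow> complex^3" where
  "chart m = inv_into UNIV (affine_param m)"

definition smooth_cp3 :: "(cp3 \<Rightarrow> cp3) \<Rightarrow> bool" where
  "smooth_cp3 \<phi> \<longleftrightarrow>
     (\<forall>p. \<exists>m n W. open W \<and> p \<in> chart_dom m \<and> chart m p \<in> W \<and>
        \<phi> ` affine_param m ` W \<subseteq> chart_dom n \<and>
        smooth_on W (chart n \<circ> \<phi> \<circ> affine_param m))"

text \<open>A tangent vector at \<open>p\<close> is the family of its coordinate representations: \<open>X $ m\<close> is its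
  representation in the chart \<open>m\<close>, and is \<open>0\<close> by convention if \<open>p\<close> is outside that chart.\<close>

definition tangent_cp3 :: "cp3 \<Rightarrow> (complex^3^4) set" where
  "tangent_cp3 p = {X.
     (\<forall>m. p \<notin> chart_dom m \<longrightarrow> X$m = 0) \<and>
     (\<forall>m n. p \<in> chart_dom m \<and> p \<in> chart_dom n \<longrightarrow>
        X$n = frechet_derivative (chart n \<circ> affine_param m) (at (chart m p)) (X$m))}"

definition diff_cp3 :: "(cp3 \<Rightarrow> cp3) \<Rightarrow> cp3 \<Rightarrow> complex^3^4 \<Rightarrow> complex^3^4" where
  "diff_cp3 \<phi> p X =
     (let m = (SOME m. p \<in> chart_dom m) in
      \<chi> n. if \<phi> p \<in> chart_dom n
           then frechet_derivative (chart n \<circ> \<phi> \<circ> affine_param m) (at (chart m p)) (X$m)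
           else 0)"

text \<open>The differential of the projection at \<open>q \<in> \<complex>\<^sup>4 - {0}\<close>; the differential of the Hopf fibration at
  \<open>q \<in> S\<^sup>7\<close> is its restriction to the tangent space of the sphere.\<close>

definition dhopf :: "complex^4 \<Rightarrow> complex^4 \<Rightarrow> complex^3^4" where
  "dhopf q x =
     (\<chi> n. if hopf q \<in> chart_dom n then frechet_derivative (chart n \<circ> hopf) (at q) x else 0)"


section \<open>The metrics \<open>g\<^sub>a\<close>\<close>

definition tangent_S7 :: "complex^4 \<Rightarrow> (complex^4) set" where
  "tangent_S7 q = {x. x \<bullet> q = 0}"

definition horizontal :: "complex^4 \<Rightarrow> (complex^4) set" where
  "horizontal q = {x \<in> tangent_S7 q. x \<bullet> iq q = 0}"

text \<open>A chosen point of the Hopf fibre over \<open>p\<close>. The definitions below do not depend on the choice, since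
  the circle acts on \<open>S\<^sup>7\<close> by isometries which commute with \<open>i\<close> and preserve the span of \<open>jq, kq\<close>.\<close>

definition fibre_point :: "cp3 \<Rightarrow> complex^4" where
  "fibre_point p = (SOME q. q \<in> sphere 0 1 \<and> hopf q = p)"

definition horizontal_lift :: "complex^4 \<Rightarrow> complex^3^4 \<Rightarrow> complex^4" where
  "horizontal_lift q X = (THE x. x \<in> horizontal q \<and> dhopf q x = X)"

text \<open>The metric for which the Hopf fibration is a Riemannian submersion from the round \<open>S\<^sup>7\<close>.\<close>

definition fubini_study :: "cp3 \<Rightarrow> complex^3^4 \<Rightarrow> complex^3^4 \<Rightarrow> real" where
  "fubini_study p X Y =
     horizontal_lift (fibre_point p) X \<bullet> horizontal_lift (fibre_point p) Y"

definition D1 :: "cp3 \<Rightarrow> (complex^3^4) set" where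
  "D1 p = (let q = fibre_point p in dhopf q ` span {jq q, kq q})"

definition D2 :: "cp3 \<Rightarrow> (complex^3^4) set" where
  "D2 p = (let q = fibre_point p in
     dhopf q ` {x \<in> tangent_S7 q. \<forall>y \<in> span {iq q, jq q, kq q}. x \<bullet> y = 0})"

text \<open>The components of a tangent vector along \<open>T\<complex>P\<^sup>3 = D1 \<oplus> D2\<close>.\<close>

definition comp1 :: "cp3 \<Rightarrow> complex^3^4 \<Rightarrow> complex^3^4" where
  "comp1 p X = (THE Y. Y \<in> D1 p \<and> X - Y \<in> D2 p)"

definition comp2 :: "cp3 \<Rightarrow> complex^3^4 \<Rightarrow> complex^3^4" where
  "comp2 p X = X - comp1 p X"

definition g_metric :: "real \<Rightarrow> cp3 \<Rightarrow> complex^3^4 \<Rightarrow> complex^3^4 \<Rightarrow> real" where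
  "g_metric a p X Y =
     fubini_study p (comp1 p X) (comp1 p Y) + a * fubini_study p (comp2 p X) (comp2 p Y)"


section \<open>Isometries\<close>

definition isometry_cp3 :: "real \<Rightarrow> (cp3 \<Rightarrow> cp3) \<Rightarrow> bool" where
  "isometry_cp3 a \<phi> \<longleftrightarrow> smooth_cp3 \<phi> \<and>
     (\<forall>p. \<forall>X\<in>tangent_cp3 p. \<forall>Y\<in>tangent_cp3 p.
        g_metric a (\<phi> p) (diff_cp3 \<phi> p X) (diff_cp3 \<phi> p Y) = g_metric a p X Y)"

text \<open>That this monoid of self-maps is a group is not built into the definition.\<close>

definition Iso_CP3 :: "real \<Rightarrow> (cp3 \<Rightarrow> cp3) monoid" where
  "Iso_CP3 a = \<lparr>carrier = {\<phi>. isometry_cp3 a \<phi>}, monoid.mult = (\<circ>), one = id\<rparr>"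

definition SU4 :: "(complex^4^4) set" where
  "SU4 = {A. A ** (\<chi> m n. cnj (A$n$m)) = mat 1 \<and> det A = 1}"

definition Sp2 :: "(complex^4^4) set" where
  "Sp2 = {A \<in> SU4. \<forall>q. A *v jq q = jq (A *v q)}"

text \<open>The complex symplectic form is the one determined by the quaternionic structure:
  \<open>jq q = symp_J *v conj_vec q\<close>. It differs from the other common normal form of the symplectic matrix
  only by the order of the basis.\<close>

definition symp_J :: "complex^4^4" where
  "symp_J = vector [vector [0, -1, 0, 0], vector [1, 0, 0, 0],
                    vector [0, 0, 0, -1], vector [0, 0, 1, 0]]"

definition Sp4C :: "(complex^4^4) set" where
  "Sp4C = {A. transpose A ** symp_J ** A = symp_J}"

definition Sp2_maps :: "(cp3 \<Rightarrow> cp3) set" where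
  "Sp2_maps = {\<phi>. \<exists>A\<in>Sp2. \<forall>q\<in>sphere 0 1. hopf (A *v q) = \<phi> (hopf q)}"

lift_definition conj_cp3 :: "cp3 \<Rightarrow> cp3" is conj_vec
proof (elim conjE exE, intro conjI)
  fix p q :: "complex^4" and c
  assume "p \<noteq> 0" "q \<noteq> 0" "q = c *s p"
  then show "conj_vec p \<noteq> 0" "conj_vec q \<noteq> 0" "\<exists>c. conj_vec q = c *s conj_vec p"
    by (auto simp: conj_vec_def vec_eq_iff intro!: exI[of _ "cnj c"])
qed

definition internal_semidirect_product :: "('g, 'b) monoid_scheme \<Rightarrow> 'g set \<Rightarrow> 'g set \<Rightarrow> bool" where
  "internal_semidirect_product G N H \<longleftrightarrow>
     group G \<and> N \<lhd> G \<and> subgroup H G \<and> N \<inter> H = {\<one>\<^bsub>G\<^esub>} \<and> carrier G = N <#>\<^bsub>G\<^esub> H"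

end

theory Submission
  imports Defs
begin

text \<open>
  Pulled back to \<open>\<complex>\<^sup>4 - {0}\<close>, the metric \<open>g\<^sub>a\<close> is the explicit form \<open>G a\<close>, and an isometry lifts locally to a map
  preserving it. Around a point there are explicit normal coordinates for \<open>g\<^sub>a\<close>. In these an isometry fixing the
  point has vanishing second derivatives, and comparing third derivatives shows that its differential preserves
  the curvature \<open>R(u,v,v,u)\<close>. Subtracting \<open>|u \<and> v|\<^sup>2 / a\<^sup>2\<close>, one obtains a quartic form which, for \<open>a \<noteq> 1\<close> only,
  singles out \<open>D1\<close> as the set of all \<open>u\<close> for which it has rank at most one in \<open>v\<close>. So an isometry of \<open>g\<^sub>a\<close>
  preserves \<open>D1\<close> and \<open>D2\<close>, hence the Fubini-Study metric and the bracket \<open>D2 \<times> D2 \<rightarrow> D1\<close>. The latter forces its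
  differential at a point to be that of an element of \<open>Sp(2)\<close>, up to conjugation. Finally, a Fubini-Study isometry
  maps great circles to great circles, because the projector \<open>P\<close> onto the moving line satisfies \<open>P''' = - 4 P'\<close>;
  it is therefore determined by its differential at one point.
\<close>

section \<open>Calculus of \<open>C\<^sup>k\<close> maps\<close>

text \<open>A lift to \<open>complex^4\<close> is only determined up to a nonvanishing factor, and
  \<open>G a\<close> ignores the fibre direction. Both a point and its image are therefore moved to
  \<open>e1\<close> by \<open>Sp2\<close>, which preserves \<open>G a\<close> for every a, and
  curvature enters only through Taylor coefficients along rays. The constant \<kappa> = (1 - a) / a
  is forced by cancelling the linear term of the metric. The constant 1 / \<open>a\<^sup>2\<close>
  is the sectional curvature of a plane spanned by one vector of \<open>D1\<close> and one of
  \<open>D2\<close>, so subtracting it removes the mixed terms. Once \<open>D1\<close> is preserved,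
  the same lift preserves \<open>G b\<close> for all real b, and two values are exploited. For b = 1
  one has \<kappa> = 0, so the affine chart is already normal and second derivatives vanish at the
  origin. For b = 0 the form degenerates to the square of a holomorphic contact form with kernel
  \<open>D2\<close>. Differentiating the contact equation in the chart for b = 1 yields the bracket
  identity.\<close>

lemma C_k_on_subset: "C_k_on k S f \<Longrightarrow> T \<subseteq> S \<Longrightarrow> C_k_on k T f"
proof (induction k arbitrary: f)
  case 0
  then show ?case using continuous_on_subset by auto
next
  case (Suc k)
  then show ?case by (simp add: subset_iff)
qed

lemma C_k_on_cong:
  assumes "open S" "\<And>x. x \<in> S \<Longrightarrow> f x = g x" "C_k_on k S f"
  shows "C_k_on k S g"
  using assms(2,3)
proof (induction k arbitrary: f g)
  case 0
  then show ?case by (auto cong: continuous_on_cong)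
next
  case (Suc k)
  have *: "(g has_derivative frechet_derivative f (at x)) (at x)" if "x \<in> S" for x
  proof (rule has_derivative_transform_within_open[OF _ assms(1) that])
    show "(f has_derivative frechet_derivative f (at x)) (at x)"
      using Suc.prems(2) that frechet_derivative_works by (metis C_k_on.simps(2))
  qed (use Suc.prems in auto)
  then have eq: "frechet_derivative f (at x) = frechet_derivative g (at x)" if "x \<in> S" for x
    using that by (metis frechet_derivative_at)
  have "C_k_on k S (\<lambda>x. frechet_derivative g (at x) v)" for v
  proof (rule Suc.IH)
    show "C_k_on k S (\<lambda>x. frechet_derivative f (at x) v)"
      using Suc.prems(2) by simp
  qed (use eq in metis)
  moreover have "\<forall>x\<in>S. g differentiable (at x)"
    using * unfolding differentiable_def by blast
  ultimately show ?case by simp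
qed

text \<open>\<open>frechet_derivative\<close> is a choice operator; this rule lets an explicit
  derivative stand in for it, so that the closure properties below become inductions on the formula
  of \<open>f'\<close>.\<close>

lemma C_k_on_SucI:
  assumes "open S" "\<And>x. x \<in> S \<Longrightarrow> (f has_derivative f' x) (at x)"
    "\<And>v. C_k_on k S (\<lambda>x. f' x v)"
  shows "C_k_on (Suc k) S f"
proof -
  have eq: "f' x = frechet_derivative f (at x)" if "x \<in> S" for x
    using assms(2)[OF that] by (rule frechet_derivative_at)
  have "C_k_on k S (\<lambda>x. frechet_derivative f (at x) v)" for v
    by (rule C_k_on_cong[OF assms(1) _ assms(3)[of v]]) (use eq in metis)
  moreover have "\<forall>x\<in>S. f differentiable (at x)"
    using assms(2) unfolding differentiable_def by blast
  ultimately show ?thesis by simp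
qed

lemma C_k_on_SucD:
  assumes "C_k_on (Suc k) S f"
  shows "C_k_on k S f"
  using assms
proof (induction k arbitrary: f)
  case 0
  then show ?case
    by (simp add: differentiable_imp_continuous_on differentiable_on_def differentiable_at_withinI)
qed auto

lemma C_k_on_has_derivative:
  assumes "C_k_on (Suc k) S f" "x \<in> S"
  shows "(f has_derivative frechet_derivative f (at x)) (at x)"
  using assms by (metis C_k_on.simps(2) frechet_derivative_works)

lemma C_k_on_const: "C_k_on k S (\<lambda>x. c)"
  by (induction k arbitrary: c) auto

lemma C_k_on_linear:
  assumes "bounded_linear f"
  shows "C_k_on k S f"
proof (cases k)
  case 0
  then show ?thesis using assms by (auto intro: linear_continuous_on)
next
  case (Suc n)
  have *: "(f has_derivative f) (at x)" for x
    using assms bounded_linear_imp_has_derivative by blast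
  then have "frechet_derivative f (at x) = f" for x
    using frechet_derivative_at by metis
  moreover have "f differentiable (at x)" for x
    using * unfolding differentiable_def by blast
  ultimately show ?thesis
    using Suc by (simp add: C_k_on_const)
qed

lemma C_k_on_bounded_linear:
  assumes "bounded_linear L" "open S" "C_k_on k S f"
  shows "C_k_on k S (\<lambda>x. L (f x))"
  using assms(3)
proof (induction k arbitrary: f)
  case 0
  then show ?case using assms(1) by (auto intro: bounded_linear.continuous_on)
next
  case (Suc k)
  show ?case
    by (rule C_k_on_SucI[of S _ "\<lambda>x v. L (frechet_derivative f (at x) v)", OF assms(2)])
      (rule bounded_linear.has_derivative[OF assms(1) C_k_on_has_derivative] Suc.prems |
        assumption | rule Suc.IH | use Suc.prems in simp)+
qed

lemma C_k_on_add:
  assumes "open S" "C_k_on k S f" "C_k_on k S g"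
  shows "C_k_on k S (\<lambda>x. f x + g x)"
  using assms(2,3)
proof (induction k arbitrary: f g)
  case 0
  then show ?case by (auto intro: continuous_on_add)
next
  case (Suc k)
  show ?case
    by (rule C_k_on_SucI[of S _ "\<lambda>x v. frechet_derivative f (at x) v + frechet_derivative g (at x) v", OF assms(1)])
      (rule has_derivative_add[OF C_k_on_has_derivative C_k_on_has_derivative] Suc.prems |
        assumption | rule Suc.IH | use Suc.prems in simp)+
qed

lemma C_k_on_bilinear:
  assumes "bounded_bilinear p" "open S" "C_k_on k S f" "C_k_on k S g"
  shows "C_k_on k S (\<lambda>x. p (f x) (g x))"
  using assms(3,4)
proof (induction k arbitrary: f g)
  case 0
  then show ?case using assms(1) by (auto intro: bounded_bilinear.continuous_on)
next
  case (Suc k)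
  have "C_k_on k S f" "C_k_on k S g"
    using Suc.prems[THEN C_k_on_SucD] by simp_all
  then have "C_k_on k S (\<lambda>x. p (f x) (frechet_derivative g (at x) v) + p (frechet_derivative f (at x) v) (g x))" for v
    using Suc by (intro C_k_on_add assms) auto
  moreover have "((\<lambda>x. p (f x) (g x)) has_derivative
      (\<lambda>v. p (f x) (frechet_derivative g (at x) v) + p (frechet_derivative f (at x) v) (g x))) (at x)" if "x \<in> S" for x
    by (rule bounded_bilinear.FDERIV[OF assms(1) C_k_on_has_derivative C_k_on_has_derivative])
      (rule Suc.prems that)+
  ultimately show ?case
    by (intro C_k_on_SucI[of S _ "\<lambda>x v. p (f x) (frechet_derivative g (at x) v) + p (frechet_derivative f (at x) v) (g x)", OF assms(2)])
qed

lemmas C_k_on_mult = C_k_on_bilinear[OF bounded_bilinear_mult]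
lemmas C_k_on_scaleR = C_k_on_bilinear[OF bounded_bilinear_scaleR]

lemma C_k_on_minus: "open S \<Longrightarrow> C_k_on k S f \<Longrightarrow> C_k_on k S (\<lambda>x. - f x)"
  by (rule C_k_on_bounded_linear[OF bounded_linear_minus[OF bounded_linear_ident]])

lemma C_k_on_diff:
  assumes "open S" "C_k_on k S f" "C_k_on k S g"
  shows "C_k_on k S (\<lambda>x. f x - g x)"
  using C_k_on_add[OF assms(1,2) C_k_on_minus[OF assms(1,3)]] by simp

lemma C_k_on_sum:
  assumes "open S" "\<And>i. i \<in> I \<Longrightarrow> C_k_on k S (f i)"
  shows "C_k_on k S (\<lambda>x. \<Sum>i\<in>I. f i x)"
  using assms(2)
  by (induction I rule: infinite_finite_induct) (auto intro: C_k_on_const C_k_on_add[OF assms(1)])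

lemma C_k_on_inverse:
  fixes f :: "'a::real_normed_vector \<Rightarrow> 'b::real_normed_field"
  assumes "open S" "C_k_on k S f" "\<And>x. x \<in> S \<Longrightarrow> f x \<noteq> 0"
  shows "C_k_on k S (\<lambda>x. inverse (f x))"
  using assms(2)
proof (induction k)
  case 0
  then show ?case using assms(3) by (auto intro: continuous_on_inverse)
next
  case (Suc k)
  have *: "C_k_on k S (\<lambda>x. inverse (f x))"
    by (rule Suc.IH[OF C_k_on_SucD[OF Suc.prems]])
  show ?case
  proof (rule C_k_on_SucI[OF assms(1)])
    show "((\<lambda>x. inverse (f x)) has_derivative (\<lambda>v. - (inverse (f x) * frechet_derivative f (at x) v * inverse (f x)))) (at x)"
      if "x \<in> S" for x
      by (rule Deriv.has_derivative_inverse[OF assms(3)[OF that] C_k_on_has_derivative[OF Suc.prems that]])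
    show "C_k_on k S (\<lambda>x. - (inverse (f x) * frechet_derivative f (at x) v * inverse (f x)))" for v
      using Suc.prems by (intro C_k_on_minus C_k_on_mult assms(1) *) simp
  qed
qed

lemma C_k_on_divide:
  fixes f g :: "'a::real_normed_vector \<Rightarrow> 'b::real_normed_field"
  assumes "open S" "C_k_on k S f" "C_k_on k S g" "\<And>x. x \<in> S \<Longrightarrow> g x \<noteq> 0"
  shows "C_k_on k S (\<lambda>x. f x / g x)"
  unfolding divide_inverse using assms by (intro C_k_on_mult C_k_on_inverse)

text \<open>The chain rule gives the derivative of g in a direction that moves with x, whereas
  \<open>C_k_on\<close> freezes directions. Expanding in \<open>Basis\<close> restores fixed
  directions, so that the induction hypothesis applies to each partial derivative of g; hence the
  Euclidean middle space.\<close>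

lemma C_k_on_compose:
  fixes f :: "'a::real_normed_vector \<Rightarrow> 'b::euclidean_space"
  assumes "open S" "open T" "C_k_on k S f" "C_k_on k T g" "f ` S \<subseteq> T"
  shows "C_k_on k S (\<lambda>x. g (f x))"
  using assms(3,4)
proof (induction k arbitrary: g)
  case 0
  then show ?case using assms(5) by (auto intro: continuous_on_compose2)
next
  case (Suc k)
  let ?f' = "\<lambda>x. frechet_derivative f (at x)" and ?g' = "\<lambda>x. frechet_derivative g (at x)"
  have f': "(f has_derivative ?f' x) (at x)" if "x \<in> S" for x
    by (rule C_k_on_has_derivative[OF Suc.prems(1) that])
  have g': "(g has_derivative ?g' x) (at x)" if "x \<in> T" for x
    by (rule C_k_on_has_derivative[OF Suc.prems(2) that])
  have "C_k_on k S f"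
    by (rule C_k_on_SucD[OF Suc.prems(1)])
  then have *: "C_k_on k S (\<lambda>x. \<Sum>b\<in>Basis. (?f' x v \<bullet> b) *\<^sub>R ?g' (f x) b)" for v
    using Suc.prems
    by (intro C_k_on_sum C_k_on_scaleR C_k_on_bounded_linear[OF bounded_linear_inner_left] Suc.IH[of "\<lambda>x. ?g' x b" for b] assms) auto
  have "((\<lambda>x. g (f x)) has_derivative (\<lambda>v. \<Sum>b\<in>Basis. (?f' x v \<bullet> b) *\<^sub>R ?g' (f x) b)) (at x)"
    if "x \<in> S" for x
  proof -
    have "f x \<in> T" using that assms(5) by auto
    then have lin: "linear (?g' (f x))" by (rule has_derivative_linear[OF g'])
    have "(\<Sum>b\<in>Basis. (w \<bullet> b) *\<^sub>R ?g' (f x) b) = ?g' (f x) (\<Sum>b\<in>Basis. (w \<bullet> b) *\<^sub>R b)" for w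
      by (simp add: linear_sum[OF lin] linear_scale[OF lin])
    then have "(\<Sum>b\<in>Basis. (?f' x v \<bullet> b) *\<^sub>R ?g' (f x) b) = ?g' (f x) (?f' x v)" for v
      by (simp add: euclidean_representation)
    with has_derivative_compose[OF f'[OF that] g'[OF \<open>f x \<in> T\<close>]] show ?thesis by simp
  qed
  from C_k_on_SucI[OF assms(1) this *] show ?case .
qed

lemma bounded_linear_axis: "bounded_linear (axis i :: 'b::euclidean_space \<Rightarrow> 'b^'n)"
  by (auto simp: linear_conv_bounded_linear[symmetric] axis_def vec_eq_iff intro!: linearI)

lemma C_k_on_vec:
  fixes f :: "'a::real_normed_vector \<Rightarrow> 'b::euclidean_space^'n"
  assumes "open S" "\<And>i. C_k_on k S (\<lambda>x. f x $ i)"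
  shows "C_k_on k S f"
proof -
  have "f = (\<lambda>x. \<Sum>i\<in>UNIV. axis i (f x $ i))"
    by (auto simp: vec_eq_iff axis_def fun_eq_iff if_distrib sum.If_cases)
  moreover have "C_k_on k S (\<lambda>x. \<Sum>i\<in>UNIV. axis i (f x $ i))"
    by (intro C_k_on_sum C_k_on_bounded_linear[OF bounded_linear_axis] assms)
  ultimately show ?thesis by simp
qed

lemma C_k_on_component:
  "open S \<Longrightarrow> C_k_on k S f \<Longrightarrow> C_k_on k S (\<lambda>x. f x $ i)"
  by (rule C_k_on_bounded_linear[OF bounded_linear_vec_nth])

section \<open>Symmetry of second derivatives\<close>

text \<open>The mean value inequality is applied to the increment in direction v, as a function of
  the step along u. Its derivative is estimated by the differentiability of \<open>f' y u\<close> at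
  the single point x. The estimate treats u and v differently although the second difference is
  symmetric in them.\<close>

lemma second_difference_bound:
  fixes f :: "'a::real_normed_vector \<Rightarrow> 'b::real_normed_vector"
  assumes "open S" "x \<in> S" "\<And>y. y \<in> S \<Longrightarrow> (f has_derivative f' y) (at y)"
    and gu: "((\<lambda>y. f' y u) has_derivative gu) (at x)" and "e > 0"
  shows "\<exists>d>0. \<forall>s. 0 < s \<and> s < d \<longrightarrow>
    norm (f (x + s *\<^sub>R u + s *\<^sub>R v) - f (x + s *\<^sub>R u) - f (x + s *\<^sub>R v) + f x - s\<^sup>2 *\<^sub>R gu v) \<le> e * s\<^sup>2"
proof -
  define c where "c = norm u + norm v"
  \<comment> \<open>The derivative of \<phi> is a difference of two errors at distance at most s c
    from x, hence at most 2 c e' s.\<close>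
  define e' where "e' = e / (2 * c + 1)"
  have c: "c \<ge> 0" by (simp add: c_def)
  have e': "e' > 0" using c \<open>e > 0\<close> by (simp add: e'_def)
  have "2 * c * e' \<le> e" using c \<open>e > 0\<close> by (simp add: e'_def field_simps)
  obtain d1 where d1: "d1 > 0" "\<And>y. norm (y - x) < d1 \<Longrightarrow> norm (f' y u - f' x u - gu (y - x)) \<le> e' * norm (y - x)"
    using gu e' unfolding has_derivative_at_alt by blast
  obtain d2 where d2: "d2 > 0" "ball x d2 \<subseteq> S"
    using assms(1,2) openE by blast
  have lin: "linear gu" using gu has_derivative_linear by blast
  define d where "d = min d1 d2 / (c + 1)"
  have "d > 0" using d1 d2 c by (simp add: d_def)
  moreover have "norm (f (x + s *\<^sub>R u + s *\<^sub>R v) - f (x + s *\<^sub>R u) - f (x + s *\<^sub>R v) + f x - s\<^sup>2 *\<^sub>R gu v) \<le> e * s\<^sup>2"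
    if s: "0 < s" "s < d" for s
  proof -
    have sc: "s * c < min d1 d2"
    proof -
      have "s * (c + 1) < min d1 d2" using s c by (simp add: d_def field_simps)
      with s show ?thesis by (simp add: algebra_simps)
    qed
    have n1: "norm (t *\<^sub>R u + s *\<^sub>R v) \<le> s * c" if "t \<in> {0..s}" for t
    proof -
      have "norm (t *\<^sub>R u + s *\<^sub>R v) \<le> t * norm u + s * norm v"
        using that s norm_triangle_ineq[of "t *\<^sub>R u" "s *\<^sub>R v"] by auto
      also have "\<dots> \<le> s * norm u + s * norm v" using that by (intro add_mono mult_right_mono) auto
      finally show ?thesis by (simp add: c_def algebra_simps)
    qed
    have n2: "norm (t *\<^sub>R u) \<le> s * c" if "t \<in> {0..s}" for t
    proof -
      have "norm (t *\<^sub>R u) \<le> s * norm u" using that s by (auto intro: mult_right_mono)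
      also have "\<dots> \<le> s * c" using s by (intro mult_left_mono) (auto simp: c_def)
      finally show ?thesis .
    qed
    define \<phi> where "\<phi> t = f (x + (t *\<^sub>R u + s *\<^sub>R v)) - f (x + t *\<^sub>R u) - t *\<^sub>R (s *\<^sub>R gu v)" for t
    have "norm (\<phi> s - \<phi> 0) \<le> (2 * c * e' * s) * norm (s - 0)"
    proof (rule differentiable_bound[of "{0..s}" \<phi>
          "\<lambda>t h. h *\<^sub>R (f' (x + (t *\<^sub>R u + s *\<^sub>R v)) u - f' (x + t *\<^sub>R u) u - s *\<^sub>R gu v)"])
      fix t assume t: "t \<in> {0..s}"
      have S1: "x + (t *\<^sub>R u + s *\<^sub>R v) \<in> S" "x + t *\<^sub>R u \<in> S"
        using n1[OF t] n2[OF t] sc d2 by (auto simp: subset_iff dist_norm norm_minus_commute)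
      have D: "(f has_derivative f' y) (at y)" "linear (f' y)" if "y \<in> S" for y
        using assms(3) that has_derivative_linear by blast+
      have "((\<lambda>t. f (x + (t *\<^sub>R u + s *\<^sub>R v))) has_derivative (\<lambda>h. f' (x + (t *\<^sub>R u + s *\<^sub>R v)) (h *\<^sub>R u))) (at t within {0..s})"
        by (rule has_derivative_compose[of "\<lambda>t. x + (t *\<^sub>R u + s *\<^sub>R v)", OF _ D(1)[OF S1(1)]]) (auto intro!: derivative_eq_intros)
      moreover have "((\<lambda>t. f (x + t *\<^sub>R u)) has_derivative (\<lambda>h. f' (x + t *\<^sub>R u) (h *\<^sub>R u))) (at t within {0..s})"
        by (rule has_derivative_compose[of "\<lambda>t. x + t *\<^sub>R u", OF _ D(1)[OF S1(2)]]) (auto intro!: derivative_eq_intros)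
      ultimately have "(\<phi> has_derivative (\<lambda>h. f' (x + (t *\<^sub>R u + s *\<^sub>R v)) (h *\<^sub>R u) - f' (x + t *\<^sub>R u) (h *\<^sub>R u) - h *\<^sub>R (s *\<^sub>R gu v))) (at t within {0..s})"
        unfolding \<phi>_def by (intro has_derivative_diff) (auto intro!: derivative_eq_intros)
      then show "(\<phi> has_derivative (\<lambda>h. h *\<^sub>R (f' (x + (t *\<^sub>R u + s *\<^sub>R v)) u - f' (x + t *\<^sub>R u) u - s *\<^sub>R gu v))) (at t within {0..s})"
        using D(2)[OF S1(1)] D(2)[OF S1(2)] by (simp add: linear_scale algebra_simps)
      have "f' (x + (t *\<^sub>R u + s *\<^sub>R v)) u - f' (x + t *\<^sub>R u) u - s *\<^sub>R gu v =
        (f' (x + (t *\<^sub>R u + s *\<^sub>R v)) u - f' x u - gu (t *\<^sub>R u + s *\<^sub>R v)) - (f' (x + t *\<^sub>R u) u - f' x u - gu (t *\<^sub>R u))"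
        using lin by (simp add: linear_add linear_scale)
      also have "norm \<dots> \<le> e' * norm (t *\<^sub>R u + s *\<^sub>R v) + e' * norm (t *\<^sub>R u)"
        using d1(2)[of "x + (t *\<^sub>R u + s *\<^sub>R v)"] d1(2)[of "x + t *\<^sub>R u"] n1[OF t] n2[OF t] sc
        by (intro order_trans[OF norm_triangle_ineq4 add_mono]) simp_all
      also have "\<dots> \<le> e' * (s * c) + e' * (s * c)"
        using n1[OF t] n2[OF t] e' by (intro add_mono mult_left_mono) auto
      finally have *: "norm (f' (x + (t *\<^sub>R u + s *\<^sub>R v)) u - f' (x + t *\<^sub>R u) u - s *\<^sub>R gu v) \<le> 2 * c * e' * s"
        by (simp add: algebra_simps)
      then show "onorm (\<lambda>h. h *\<^sub>R (f' (x + (t *\<^sub>R u + s *\<^sub>R v)) u - f' (x + t *\<^sub>R u) u - s *\<^sub>R gu v)) \<le> 2 * c * e' * s"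
        by (intro onorm_bound) (use s c e' in \<open>auto simp: mult.commute intro!: mult_left_mono\<close>)
    qed (use s in auto)
    also have "\<dots> \<le> e * s\<^sup>2"
      using \<open>2 * c * e' \<le> e\<close> s by (auto simp: power2_eq_square mult.assoc[symmetric] intro!: mult_right_mono)
    finally show ?thesis by (simp add: \<phi>_def power2_eq_square algebra_simps)
  qed
  ultimately show ?thesis by blast
qed

text \<open>One and the same second difference is approximated by both values. Only two directional
  derivatives have to be differentiable at x, which is the form in which \<open>C_k_on\<close>
  supplies regularity.\<close>

lemma second_derivative_symmetric:
  fixes f :: "'a::real_normed_vector \<Rightarrow> 'b::real_normed_vector"
  assumes "open S" "x \<in> S" "\<And>y. y \<in> S \<Longrightarrow> (f has_derivative f' y) (at y)"
    and gu: "((\<lambda>y. f' y u) has_derivative gu) (at x)" and gv: "((\<lambda>y. f' y v) has_derivative gv) (at x)"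
  shows "gu v = gv u"
proof -
  have "norm (gu v - gv u) \<le> 0 + e" if e: "e > 0" for e
  proof -
    obtain d1 where d1: "d1 > 0" "\<And>s. 0 < s \<and> s < d1 \<Longrightarrow>
      norm (f (x + s *\<^sub>R u + s *\<^sub>R v) - f (x + s *\<^sub>R u) - f (x + s *\<^sub>R v) + f x - s\<^sup>2 *\<^sub>R gu v) \<le> (e/2) * s\<^sup>2"
      using second_difference_bound[OF assms(1-3) gu half_gt_zero[OF e], of v] by blast
    obtain d2 where d2: "d2 > 0" "\<And>s. 0 < s \<and> s < d2 \<Longrightarrow>
      norm (f (x + s *\<^sub>R v + s *\<^sub>R u) - f (x + s *\<^sub>R v) - f (x + s *\<^sub>R u) + f x - s\<^sup>2 *\<^sub>R gv u) \<le> (e/2) * s\<^sup>2"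
      using second_difference_bound[OF assms(1-3) gv half_gt_zero[OF e], of u] by blast
    define s where "s = min d1 d2 / 2"
    have s: "0 < s" "s < d1" "s < d2" using d1 d2 by (auto simp: s_def)
    have "norm (s\<^sup>2 *\<^sub>R (gu v - gv u)) \<le> (e/2) * s\<^sup>2 + (e/2) * s\<^sup>2"
    proof (rule order_trans[OF _ add_mono[OF d2(2) d1(2)]])
      show "norm (s\<^sup>2 *\<^sub>R (gu v - gv u)) \<le> norm (f (x + s *\<^sub>R v + s *\<^sub>R u) - f (x + s *\<^sub>R v) - f (x + s *\<^sub>R u) + f x - s\<^sup>2 *\<^sub>R gv u) +
        norm (f (x + s *\<^sub>R u + s *\<^sub>R v) - f (x + s *\<^sub>R u) - f (x + s *\<^sub>R v) + f x - s\<^sup>2 *\<^sub>R gu v)"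
        by (rule order_trans[OF _ norm_triangle_ineq4]) (simp add: algebra_simps)
    qed (use s in auto)
    then have "s\<^sup>2 * norm (gu v - gv u) \<le> s\<^sup>2 * e"
      unfolding norm_scaleR by (simp add: field_simps)
    then show ?thesis using s by simp
  qed
  then have "norm (gu v - gv u) \<le> 0" using field_le_epsilon by blast
  then show ?thesis by simp
qed

section \<open>Homogeneous coordinates\<close>

lemma vector_4 [simp]:
  "(vector [a,b,c,d] :: ('a::zero)^4) $ 1 = a"
  "(vector [a,b,c,d] :: ('a::zero)^4) $ 2 = b"
  "(vector [a,b,c,d] :: ('a::zero)^4) $ 3 = c"
  "(vector [a,b,c,d] :: ('a::zero)^4) $ 4 = d"
  by (simp_all add: vector_def)

lemma vec4_eq_iff: "x = y \<longleftrightarrow> x$1 = y$1 \<and> x$2 = y$2 \<and> x$3 = y$3 \<and> x$4 = (y::'a^4)$4"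
  by (simp add: vec_eq_iff forall_4)

lemma vec3_eq_iff: "x = y \<longleftrightarrow> x$1 = y$1 \<and> x$2 = y$2 \<and> x$3 = (y::'a^3)$3"
  by (simp add: vec_eq_iff forall_3)

text \<open>Complex-valued, so that real orthogonality to both q and \<open>iq q\<close> becomes the
  single equation \<open>hip x q = 0\<close>.\<close>

definition hip :: "complex^4 \<Rightarrow> complex^4 \<Rightarrow> complex" where
  "hip x y = (\<Sum>m\<in>UNIV. x$m * cnj (y$m))"

lemma hip_simps [simp]:
  "hip (x + y) z = hip x z + hip y z" "hip (x - y) z = hip x z - hip y z"
  "hip x (y + z) = hip x y + hip x z" "hip x (y - z) = hip x y - hip x z"
  "hip (c *s x) y = c * hip x y" "hip x (c *s y) = cnj c * hip x y"
  "hip (r *\<^sub>R x) y = r *\<^sub>R hip x y" "hip x (r *\<^sub>R y) = r *\<^sub>R hip x y"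
  "hip (- x) y = - hip x y" "hip x (- y) = - hip x y" "hip 0 y = 0" "hip x 0 = 0"
  by (simp_all add: hip_def sum_4 algebra_simps)

lemma hip_commute: "hip y x = cnj (hip x y)"
  by (simp add: hip_def mult.commute)

lemma inner_eq_Re_hip: "x \<bullet> y = Re (hip x y)"
  by (simp add: hip_def inner_vec_def inner_complex_def)

lemma hip_self: "hip x x = of_real ((norm x)\<^sup>2)"
  by (simp add: complex_eq_iff power2_norm_eq_inner inner_eq_Re_hip) (simp add: hip_def)

lemma norm_vec4: "(norm (x::complex^4))\<^sup>2 = (cmod (x$1))\<^sup>2 + (cmod (x$2))\<^sup>2 + (cmod (x$3))\<^sup>2 + (cmod (x$4))\<^sup>2"
  by (simp add: power2_norm_eq_inner inner_vec_def sum_4)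

lemma norm_vec3: "(norm (x::complex^3))\<^sup>2 = (cmod (x$1))\<^sup>2 + (cmod (x$2))\<^sup>2 + (cmod (x$3))\<^sup>2"
  by (simp add: power2_norm_eq_inner inner_vec_def sum_3)

lemma jq_nth [simp]: "jq q $ 1 = - cnj (q$2)" "jq q $ 2 = cnj (q$1)" "jq q $ 3 = - cnj (q$4)" "jq q $ 4 = cnj (q$3)"
  by (simp_all add: jq_def)

lemma jq_simps [simp]: "jq (x + y) = jq x + jq y" "jq (x - y) = jq x - jq y" "jq (c *s x) = cnj c *s jq x"
  "jq (r *\<^sub>R x) = r *\<^sub>R jq x" "jq (jq x) = - x" "jq 0 = 0"
  by (simp_all add: vec4_eq_iff)

lemma hip_jq [simp]: "hip (jq x) (jq y) = hip y x" "hip x (jq x) = 0" "hip (jq x) x = 0"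
  by (simp_all add: hip_def sum_4 algebra_simps)

lemma norm_smult4 [simp]: "norm (c *s (x::complex^4)) = cmod c * norm x"
proof -
  have "(norm (c *s x))\<^sup>2 = (cmod c * norm x)\<^sup>2"
    unfolding norm_vec4 power_mult_distrib by (simp add: norm_mult power_mult_distrib algebra_simps)
  then show ?thesis by simp
qed

lemma has_derivative_vecI:
  fixes f :: "'a::real_normed_vector \<Rightarrow> 'b::euclidean_space^'n"
  assumes "\<And>i. ((\<lambda>x. f x $ i) has_derivative (\<lambda>v. f' v $ i)) F"
  shows "(f has_derivative f') F"
proof -
  have *: "g = (\<lambda>x. \<Sum>i\<in>UNIV. axis i (g x $ i))" for g :: "'a \<Rightarrow> 'b^'n"
    by (auto simp: vec_eq_iff axis_def fun_eq_iff if_distrib sum.If_cases)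
  have "((\<lambda>x. \<Sum>i\<in>UNIV. axis i (f x $ i)) has_derivative (\<lambda>v. \<Sum>i\<in>UNIV. axis i (f' v $ i))) F"
    by (intro has_derivative_sum bounded_linear.has_derivative[OF bounded_linear_axis] assms)
  then show ?thesis using * by metis
qed

lemma has_derivative_nth:
  "(f has_derivative f') F \<Longrightarrow> ((\<lambda>x. f x $ i) has_derivative (\<lambda>v. f' v $ i)) F"
  by (rule bounded_linear.has_derivative[OF bounded_linear_vec_nth])

lemma has_derivative_of_nth [derivative_intros]: "((\<lambda>x. x $ i) has_derivative (\<lambda>v. v $ i)) F"
  by (rule bounded_linear_imp_has_derivative[OF bounded_linear_vec_nth])


section \<open>Affine charts as homogeneous functions\<close>

definition drop_coord :: "4 \<Rightarrow> complex^4 \<Rightarrow> complex^3" where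
  "drop_coord m z = (if m = 1 then vector [z$2, z$3, z$4] else if m = 2 then vector [z$1, z$3, z$4]
     else if m = 3 then vector [z$1, z$2, z$4] else vector [z$1, z$2, z$3])"

definition embed_coord :: "4 \<Rightarrow> complex^3 \<Rightarrow> complex^4" where
  "embed_coord m w = (if m = 1 then vector [0, w$1, w$2, w$3] else if m = 2 then vector [w$1, 0, w$2, w$3]
     else if m = 3 then vector [w$1, w$2, 0, w$3] else vector [w$1, w$2, w$3, 0])"

definition affine_vec :: "4 \<Rightarrow> complex^3 \<Rightarrow> complex^4" where
  "affine_vec m w = embed_coord m w + axis m 1"

text \<open>The chart read on \<open>complex^4\<close>: homogeneous of degree zero, so its
  differential \<open>dcoords\<close> kills exactly the complex line of z. Derivatives on the
  quotient thereby become derivatives on open subsets of \<open>complex^4\<close>.\<close>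

definition coords :: "4 \<Rightarrow> complex^4 \<Rightarrow> complex^3" where
  "coords m z = (1 / z$m) *s drop_coord m z"

definition dcoords :: "4 \<Rightarrow> complex^4 \<Rightarrow> complex^4 \<Rightarrow> complex^3" where
  "dcoords m z x = (1 / z$m) *s drop_coord m x - (x$m / (z$m)\<^sup>2) *s drop_coord m z"

lemma affine_param_eq: "affine_param m w = hopf (affine_vec m w)"
  unfolding affine_param_def affine_vec_def embed_coord_def
  using exhaust_4[of m] by (intro arg_cong[of _ _ hopf]) (auto simp: vec4_eq_iff axis_def)

lemma embed_coord_drop: "embed_coord m (drop_coord m z) = z - axis m (z$m)"
  using exhaust_4[of m] by (auto simp: vec4_eq_iff embed_coord_def drop_coord_def axis_def)

lemma drop_coord_embed [simp]: "drop_coord m (embed_coord m w) = w"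
  using exhaust_4[of m] by (auto simp: vec3_eq_iff embed_coord_def drop_coord_def)

lemma embed_coord_nth [simp]: "embed_coord m w $ m = 0"
  using exhaust_4[of m] by (auto simp: embed_coord_def)

lemma drop_coord_axis [simp]: "drop_coord m (axis m c) = 0"
  using exhaust_4[of m] by (auto simp: vec3_eq_iff axis_def drop_coord_def)

lemma drop_coord_linear [simp]: "drop_coord m (x + y) = drop_coord m x + drop_coord m y" "drop_coord m (x - y) = drop_coord m x - drop_coord m y"
  "drop_coord m (c *s x) = c *s drop_coord m x" "drop_coord m (r *\<^sub>R x) = r *\<^sub>R drop_coord m x" "drop_coord m 0 = 0"
  using exhaust_4[of m] by (auto simp: vec3_eq_iff drop_coord_def)

lemma embed_coord_linear [simp]: "embed_coord m (x + y) = embed_coord m x + embed_coord m y" "embed_coord m (x - y) = embed_coord m x - embed_coord m y"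
  "embed_coord m (c *s x) = c *s embed_coord m x" "embed_coord m (r *\<^sub>R x) = r *\<^sub>R embed_coord m x" "embed_coord m 0 = 0"
  using exhaust_4[of m] by (auto simp: vec4_eq_iff embed_coord_def)

lemma bounded_linear_drop: "bounded_linear (drop_coord m)"
  by (auto simp: linear_conv_bounded_linear[symmetric] intro!: linearI)

lemma bounded_linear_embed: "bounded_linear (embed_coord m)"
  by (auto simp: linear_conv_bounded_linear[symmetric] intro!: linearI)

lemma affine_vec_nth [simp]: "affine_vec m w $ m = 1"
  by (simp add: affine_vec_def)

lemma affine_vec_nonzero [simp]: "affine_vec m w \<noteq> 0"
  by (metis affine_vec_nth zero_index zero_neq_one)

lemma coords_affine_vec [simp]: "coords m (affine_vec m w) = w"
  by (simp add: coords_def affine_vec_def vec_eq_iff)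

lemma affine_vec_coords: "z$m \<noteq> 0 \<Longrightarrow> affine_vec m (coords m z) = (1 / z$m) *s z"
  by (simp add: affine_vec_def coords_def embed_coord_drop vec_eq_iff axis_def field_simps)

lemma coords_scale: "c \<noteq> 0 \<Longrightarrow> coords m (c *s z) = coords m z"
  by (simp add: coords_def vec_eq_iff)

lemma nonzero_nth: "(q::complex^4) \<noteq> 0 \<Longrightarrow> \<exists>m. q$m \<noteq> 0"
  by (metis vec_eq_iff zero_index)

lemma open_nth_nonzero: "open {z::complex^4. z$m \<noteq> 0}"
  by (auto intro!: open_Collect_neq continuous_intros)

lemma has_derivative_coords:
  assumes "z$m \<noteq> 0"
  shows "(coords m has_derivative dcoords m z) (at z)"
proof (rule has_derivative_vecI)
  fix i
  have "((\<lambda>z. z$m) has_derivative (\<lambda>x. x$m)) (at z)" "((\<lambda>z. drop_coord m z $ i) has_derivative (\<lambda>x. drop_coord m x $ i)) (at z)"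
    by (rule derivative_intros has_derivative_nth bounded_linear_imp_has_derivative bounded_linear_drop)+
  then show "((\<lambda>z. coords m z $ i) has_derivative (\<lambda>x. dcoords m z x $ i)) (at z)"
    unfolding coords_def dcoords_def
    by (auto intro!: derivative_eq_intros simp: assms power2_eq_square field_simps)
qed

lemma C_k_on_coords: "C_k_on k {z. z$m \<noteq> 0} (coords m)"
proof (rule C_k_on_vec[OF open_nth_nonzero])
  fix i
  have "C_k_on k {z. z$m \<noteq> 0} (\<lambda>z. (1 / z$m) * drop_coord m z $ i)"
    by (intro C_k_on_mult C_k_on_divide C_k_on_const C_k_on_component[OF _ C_k_on_linear[OF bounded_linear_drop]]
        C_k_on_linear[OF bounded_linear_vec_nth] open_nth_nonzero) auto
  then show "C_k_on k {z. z$m \<noteq> 0} (\<lambda>z. coords m z $ i)" by (simp add: coords_def)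
qed

lemma C_k_on_affine_vec: "open S \<Longrightarrow> C_k_on k S (affine_vec m)"
  unfolding affine_vec_def
  by (intro C_k_on_add C_k_on_const C_k_on_linear bounded_linear_embed)

lemma dcoords_eq_0_iff:
  assumes "z$m \<noteq> 0"
  shows "dcoords m z x = 0 \<longleftrightarrow> (\<exists>c. x = c *s z)"
proof
  assume "dcoords m z x = 0"
  then have "drop_coord m x = (x$m / z$m) *s drop_coord m z"
    using assms by (simp add: dcoords_def vec_eq_iff power2_eq_square field_simps)
  then have "x - axis m (x$m) = (x$m / z$m) *s (z - axis m (z$m))"
    by (metis embed_coord_drop embed_coord_linear(3))
  then have *: "x$i - axis m (x$m) $ i = (x$m / z$m) * (z$i - axis m (z$m) $ i)" for i
    by (metis vector_minus_component vector_smult_component)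
  have "x $ i = ((x$m / z$m) *s z) $ i" for i
    using assms *[of i] by (cases "i = m") (simp_all add: axis_def)
  then show "\<exists>c. x = c *s z" unfolding vec_eq_iff by blast
next
  assume "\<exists>c. x = c *s z"
  then show "dcoords m z x = 0"
    using assms by (auto simp: dcoords_def vec_eq_iff[where 'b=3] power2_eq_square)
qed

lemma dcoords_linear [simp]: "dcoords m z (x + y) = dcoords m z x + dcoords m z y"
  "dcoords m z (x - y) = dcoords m z x - dcoords m z y" "dcoords m z (c *s x) = c *s dcoords m z x"
  by (simp_all add: dcoords_def vec_eq_iff algebra_simps add_divide_distrib diff_divide_distrib)

lemma dcoords_scale: "c \<noteq> 0 \<Longrightarrow> dcoords m (c *s z) (c *s x) = dcoords m z x"
  by (simp add: dcoords_def vec_eq_iff power2_eq_square)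

lemma dcoords_surj:
  assumes "z$m \<noteq> 0"
  shows "dcoords m z ((z$m) *s embed_coord m w) = w"
  using assms by (simp add: dcoords_def vec_eq_iff)


section \<open>The projection, its differential and the tangent spaces\<close>

lemma hopf_eq_iff:
  assumes "p \<noteq> 0" "q \<noteq> 0"
  shows "hopf p = hopf q \<longleftrightarrow> (\<exists>c. c \<noteq> 0 \<and> q = c *s p)"
proof -
  have "p = 1 *s p" for p :: "complex^4" by simp
  then have "hopf p = hopf q \<longleftrightarrow> (\<exists>c. q = c *s p)"
    unfolding hopf_def using Quotient3_rel[OF Quotient3_cp3, of p q] assms by blast
  then show ?thesis using assms by (metis vector_smult_lzero)
qed

lemma hopf_scale: "c \<noteq> 0 \<Longrightarrow> q \<noteq> 0 \<Longrightarrow> hopf (c *s q) = hopf q"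
  using hopf_eq_iff[of q "c *s q"] by (metis vector_mul_eq_0)

lemma hopf_surj: obtains q where "q \<noteq> 0" "hopf q = p"
  unfolding hopf_def using Quotient3_abs_rep[OF Quotient3_cp3, of p] Quotient3_rep_reflp[OF Quotient3_cp3, of p]
  by blast

lemma hopf_surj_sphere: obtains q where "q \<in> sphere 0 1" "hopf q = p"
proof -
  obtain q where q: "q \<noteq> 0" "hopf q = p" by (rule hopf_surj)
  let ?q = "of_real (1 / norm q) *s q"
  have "norm ?q = 1" unfolding norm_smult4 norm_of_real using q by simp
  moreover have "hopf ?q = p" using q hopf_scale[of "of_real (1 / norm q)" q] by auto
  ultimately show ?thesis using that[of ?q] by (simp del: norm_smult4)
qed

lemma fibre_point: "fibre_point p \<in> sphere 0 1" "hopf (fibre_point p) = p"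
proof -
  obtain q where "q \<in> sphere 0 1 \<and> hopf q = p" by (meson hopf_surj_sphere)
  then have "fibre_point p \<in> sphere 0 1 \<and> hopf (fibre_point p) = p"
    unfolding fibre_point_def by (rule someI)
  then show "fibre_point p \<in> sphere 0 1" "hopf (fibre_point p) = p" by auto
qed

lemma chart_dom_iff:
  assumes "q \<noteq> 0"
  shows "hopf q \<in> chart_dom m \<longleftrightarrow> q$m \<noteq> 0"
proof
  assume "hopf q \<in> chart_dom m"
  then obtain w where "hopf (affine_vec m w) = hopf q"
    by (auto simp: chart_dom_def affine_param_eq)
  then show "q$m \<noteq> 0" using hopf_eq_iff[OF affine_vec_nonzero assms] by auto
next
  assume *: "q$m \<noteq> 0"
  then have "hopf q = affine_param m (coords m q)"
    using assms by (simp add: affine_param_eq affine_vec_coords hopf_scale)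
  then show "hopf q \<in> chart_dom m" by (simp add: chart_dom_def)
qed

lemma hopf_eq_imp_coords_eq:
  assumes "p \<noteq> 0" "q \<noteq> 0" "hopf p = hopf q"
  shows "coords m p = coords m q"
  using assms hopf_eq_iff coords_scale by metis

lemma chart_hopf:
  assumes "q$m \<noteq> 0"
  shows "chart m (hopf q) = coords m q"
proof -
  have q: "q \<noteq> 0" using assms by auto
  then have "hopf q = affine_param m (coords m q)"
    using assms by (simp add: affine_param_eq affine_vec_coords hopf_scale)
  moreover have "inj (affine_param m)"
    by (rule injI) (metis affine_param_eq affine_vec_nonzero coords_affine_vec hopf_eq_imp_coords_eq)
  ultimately show ?thesis by (simp add: chart_def inv_f_f)
qed

lemma dhopf_eq:
  assumes "q \<noteq> 0"
  shows "dhopf q x = (\<chi> n. if q$n \<noteq> 0 then dcoords n q x else 0)"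
proof -
  have "frechet_derivative (chart n \<circ> hopf) (at q) = dcoords n q" if "q$n \<noteq> 0" for n
  proof -
    have "((chart n \<circ> hopf) has_derivative dcoords n q) (at q)"
      by (rule has_derivative_transform_within_open[OF has_derivative_coords[OF that] open_nth_nonzero[of n]])
        (use that in \<open>auto simp: chart_hopf\<close>)
    then show ?thesis by (metis frechet_derivative_at)
  qed
  then show ?thesis using assms by (simp add: dhopf_def vec_eq_iff chart_dom_iff)
qed

lemma dhopf_linear [simp]:
  assumes "q \<noteq> 0"
  shows "dhopf q (x + y) = dhopf q x + dhopf q y" "dhopf q (x - y) = dhopf q x - dhopf q y"
  using assms by (simp_all add: dhopf_eq vec_eq_iff)

lemma dhopf_eq_0_iff:
  assumes "q \<noteq> 0"
  shows "dhopf q x = 0 \<longleftrightarrow> (\<exists>c. x = c *s q)"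
proof
  assume *: "dhopf q x = 0"
  obtain m where m: "q$m \<noteq> 0" using assms nonzero_nth by blast
  then have "dcoords m q x = 0"
    using arg_cong[OF *, of "\<lambda>X. X$m"] assms by (simp add: dhopf_eq)
  then show "\<exists>c. x = c *s q" using m by (simp add: dcoords_eq_0_iff)
next
  assume "\<exists>c. x = c *s q"
  then have "dcoords n q x = 0" if "q$n \<noteq> 0" for n
    using that by (simp add: dcoords_eq_0_iff)
  then show "dhopf q x = 0" using assms by (auto simp: dhopf_eq vec_eq_iff)
qed

lemma dhopf_scale:
  assumes "q \<noteq> 0" "c \<noteq> 0"
  shows "dhopf (c *s q) (c *s x) = dhopf q x"
  using assms by (simp add: dhopf_eq vec_eq_iff dcoords_scale del: dcoords_linear)

text \<open>Differentiating the identity between \<open>coords n\<close> and the transition map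
  after \<open>coords m\<close> shows that \<open>dcoords\<close> transforms like a tangent vector;
  conversely one coordinate of a compatible family determines all the others.\<close>

lemma tangent_cp3_eq:
  assumes "q \<noteq> 0"
  shows "tangent_cp3 (hopf q) = range (dhopf q)"
proof -
  have trans: "frechet_derivative (chart n \<circ> affine_param m) (at (chart m (hopf q))) (dcoords m q x) = dcoords n q x"
    if m: "q$m \<noteq> 0" and n: "q$n \<noteq> 0" for m n x
  proof -
    let ?w = "coords m q" and ?g = "chart n \<circ> affine_param m"
    let ?W = "{w. affine_vec m w $ n \<noteq> 0}"
    have W: "open ?W"
      using C_k_on_affine_vec[of UNIV 0 m] by (auto intro!: open_Collect_neq continuous_intros)
    have w: "?w \<in> ?W" using m n by (simp add: affine_vec_coords)
    have ck: "C_k_on (Suc 0) ?W (coords n \<circ> affine_vec m)"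
      unfolding o_def
      by (rule C_k_on_compose[OF W open_nth_nonzero[of n] C_k_on_affine_vec[OF W] C_k_on_coords]) auto
    have "C_k_on (Suc 0) ?W ?g"
      by (rule C_k_on_cong[OF W _ ck]) (auto simp: affine_param_eq chart_hopf)
    from C_k_on_has_derivative[OF this w]
    have g: "(?g has_derivative frechet_derivative ?g (at ?w)) (at ?w)" .
    have "((\<lambda>z. ?g (coords m z)) has_derivative (\<lambda>x. frechet_derivative ?g (at ?w) (dcoords m q x))) (at q)"
      by (rule has_derivative_compose[OF has_derivative_coords[OF m] g])
    then have "(coords n has_derivative (\<lambda>x. frechet_derivative ?g (at ?w) (dcoords m q x))) (at q)"
    proof (rule has_derivative_transform_within_open[OF _ open_Int[OF open_nth_nonzero[of m] open_nth_nonzero[of n]]])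
      fix z :: "complex^4" assume "z \<in> {z. z$m \<noteq> 0} \<inter> {z. z$n \<noteq> 0}"
      then show "?g (coords m z) = coords n z"
        by (simp add: affine_param_eq affine_vec_coords chart_hopf coords_scale)
    qed (use m n in auto)
    from has_derivative_unique[OF this has_derivative_coords[OF n]] m show ?thesis
      by (simp add: chart_hopf fun_eq_iff)
  qed
  show ?thesis
  proof (intro equalityI subsetI)
    fix X assume X: "X \<in> tangent_cp3 (hopf q)"
    obtain m where m: "q$m \<noteq> 0" using assms nonzero_nth by blast
    \<comment> \<open>Lifts the coordinate vector into the slice of constant m-th coordinate through
      q, where \<open>dcoords\<close> is inverted by \<open>dcoords_surj\<close>.\<close>
    define x where "x = (q$m) *s embed_coord m (X$m)"
    have Xm: "X$m = dcoords m q x" using m by (simp add: x_def dcoords_surj del: dcoords_linear)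
    have Xn: "X$n = (if q$n \<noteq> 0 then dcoords n q x else 0)" for n
    proof (cases "q$n = 0")
      case True
      then show ?thesis using X assms unfolding tangent_cp3_def by (simp add: chart_dom_iff)
    next
      case False
      then have "X$n = frechet_derivative (chart n \<circ> affine_param m) (at (chart m (hopf q))) (X$m)"
        using X m unfolding tangent_cp3_def mem_Collect_eq chart_dom_iff[OF assms] by blast
      also have "\<dots> = dcoords n q x"
        unfolding Xm by (rule trans[OF m False])
      finally show ?thesis using False by simp
    qed
    have "X = dhopf q x"
      unfolding dhopf_eq[OF assms] by (subst vec_eq_iff, intro allI, subst vec_lambda_beta, rule Xn)
    then show "X \<in> range (dhopf q)" by simp
  next
    fix X assume "X \<in> range (dhopf q)"
    then obtain x where x: "X = dhopf q x" by blast
    have X: "X$n = (if q$n \<noteq> 0 then dcoords n q x else 0)" for n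
      unfolding x dhopf_eq[OF assms] by simp
    show "X \<in> tangent_cp3 (hopf q)"
      unfolding tangent_cp3_def mem_Collect_eq chart_dom_iff[OF assms]
    proof (intro conjI allI impI)
      fix m n assume mn: "q$m \<noteq> 0 \<and> q$n \<noteq> 0"
      show "X$n = frechet_derivative (chart n \<circ> affine_param m) (at (chart m (hopf q))) (X$m)"
        using trans[of m n x] mn unfolding X by simp
    qed (simp add: X)
  qed
qed

section \<open>The metrics in homogeneous coordinates\<close>

lemma inner_iq: "x \<bullet> iq q = Im (hip x q)"
  by (simp add: inner_eq_Re_hip iq_def)

lemma horizontal_iff: "x \<in> horizontal q \<longleftrightarrow> hip x q = 0"
  by (auto simp: horizontal_def tangent_S7_def inner_iq complex_eq_iff) (simp_all add: inner_eq_Re_hip)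

lemma hip_unit: "q \<in> sphere 0 1 \<Longrightarrow> hip q q = 1"
  by (simp add: hip_self)

text \<open>The kernel of \<open>dhopf q\<close> is the complex line of q, so the lift is the
  Hermitian projection along q.\<close>

lemma horizontal_lift_dhopf:
  assumes "q \<in> sphere 0 1"
  shows "horizontal_lift q (dhopf q x) = x - hip x q *s q"
  unfolding horizontal_lift_def
proof (rule the_equality)
  have q: "q \<noteq> 0" "hip q q = 1" using assms hip_unit by auto
  have "dhopf q (hip x q *s q) = 0" using q dhopf_eq_0_iff by blast
  then show "x - hip x q *s q \<in> horizontal q \<and> dhopf q (x - hip x q *s q) = dhopf q x"
    using q by (simp add: horizontal_iff)
  fix y assume y: "y \<in> horizontal q \<and> dhopf q y = dhopf q x"
  then have "dhopf q (x - y) = 0" using q by simp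
  then obtain c where c: "x - y = c *s q" using dhopf_eq_0_iff q by blast
  from arg_cong[OF this, of "\<lambda>v. hip v q"] y q have "c = hip x q"
    by (simp add: horizontal_iff)
  with c show "y = x - hip x q *s q" by (simp add: algebra_simps)
qed

lemma D1_eq: "D1 p = {dhopf (fibre_point p) (c *s jq (fibre_point p)) |c. True}"
proof -
  let ?q = "fibre_point p"
  have "x \<in> span {jq ?q, kq ?q} \<longleftrightarrow> (\<exists>c. x = c *s jq ?q)" for x
  proof
    assume "x \<in> span {jq ?q, kq ?q}"
    then obtain r s where "x = r *\<^sub>R jq ?q + s *\<^sub>R kq ?q"
      by (auto simp: span_breakdown_eq algebra_simps) 
    then have "x = Complex r s *s jq ?q"
      by (simp add: kq_def iq_def vec_eq_iff complex_eq_iff)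
    then show "\<exists>c. x = c *s jq ?q" ..
  next
    assume "\<exists>c. x = c *s jq ?q"
    then obtain c where "x = c *s jq ?q" ..
    then have "x = Re c *\<^sub>R jq ?q + Im c *\<^sub>R kq ?q"
      by (simp add: kq_def iq_def vec_eq_iff complex_eq_iff)
    then show "x \<in> span {jq ?q, kq ?q}"
      by (simp add: span_add span_base span_scale)
  qed
  then show ?thesis by (auto simp: D1_def Let_def)
qed

lemma D2_eq: "D2 p = {dhopf (fibre_point p) x |x. hip x (fibre_point p) = 0 \<and> hip x (jq (fibre_point p)) = 0}"
proof -
  let ?q = "fibre_point p"
  have "(x \<bullet> ?q = 0 \<and> (\<forall>y \<in> span {iq ?q, jq ?q, kq ?q}. x \<bullet> y = 0)) \<longleftrightarrow> hip x ?q = 0 \<and> hip x (jq ?q) = 0"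
    (is "?l \<longleftrightarrow> ?r") for x
  proof
    assume ?l
    then have "x \<bullet> ?q = 0" "x \<bullet> iq ?q = 0" "x \<bullet> jq ?q = 0" "x \<bullet> kq ?q = 0"
      by (auto simp: span_base)
    then show ?r
      by (simp add: complex_eq_iff inner_iq kq_def) (simp add: inner_eq_Re_hip)
  next
    assume ?r
    then have *: "x \<bullet> ?q = 0" "x \<bullet> iq ?q = 0" "x \<bullet> jq ?q = 0" "x \<bullet> kq ?q = 0"
      by (simp_all add: inner_iq kq_def) (simp_all add: inner_eq_Re_hip)
    have "orthogonal x y" if "y \<in> span {iq ?q, jq ?q, kq ?q}" for y
      by (rule orthogonal_to_span[OF that]) (use * in \<open>auto simp: orthogonal_def\<close>)
    with * show ?l by (auto simp: orthogonal_def)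
  qed
  then show ?thesis by (auto simp: D2_def Let_def tangent_S7_def)
qed

lemma comp1_dhopf:
  fixes p defines "q \<equiv> fibre_point p"
  shows "comp1 p (dhopf q x) = dhopf q (hip x (jq q) *s jq q)"
  unfolding comp1_def
proof (rule the_equality)
  have q: "q \<noteq> 0" "hip q q = 1" using fibre_point[of p] hip_unit by (auto simp: q_def)
  let ?j = "hip x (jq q) *s jq q"
  have "dhopf q (hip x q *s q) = 0" using q dhopf_eq_0_iff by blast
  then have "dhopf q x - dhopf q ?j = dhopf q (x - ?j - hip x q *s q)" using q by simp
  moreover have "hip (x - ?j - hip x q *s q) q = 0" "hip (x - ?j - hip x q *s q) (jq q) = 0"
    using q by simp_all
  ultimately show "dhopf q ?j \<in> D1 p \<and> dhopf q x - dhopf q ?j \<in> D2 p"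
    unfolding D1_eq D2_eq q_def[symmetric] by blast
  fix Y assume "Y \<in> D1 p \<and> dhopf q x - Y \<in> D2 p"
  then obtain c y where c: "Y = dhopf q (c *s jq q)" "dhopf q x - Y = dhopf q y" "hip y (jq q) = 0"
    unfolding D1_eq D2_eq q_def[symmetric] by blast
  then have "dhopf q (x - c *s jq q - y) = 0" using q by simp
  then obtain d where "x - c *s jq q - y = d *s q" using dhopf_eq_0_iff q by blast
  from arg_cong[OF this, of "\<lambda>v. hip v (jq q)"] q c have "c = hip x (jq q)" by simp
  with c show "Y = dhopf q ?j" by simp
qed

text \<open>This is a times the Fubini-Study form plus 1 - a times its \<open>D1\<close> part, since
  \<open>jq z\<close> spans \<open>D1\<close> over \<open>hopf z\<close>. The denominator makes it
  invariant under a common scaling of z, x, y. It makes sense for every real a, including the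
  degenerate value 0.\<close>

definition G :: "real \<Rightarrow> complex^4 \<Rightarrow> complex^4 \<Rightarrow> complex^4 \<Rightarrow> real" where
  "G a z x y = (a * ((x \<bullet> y) * (norm z)\<^sup>2 - Re (hip x z * cnj (hip y z)))
     + (1 - a) * Re (hip x (jq z) * cnj (hip y (jq z)))) / (norm z) ^ 4"

lemma G_vertical: "G a z (x + \<mu> *s z) (y + \<nu> *s z) = G a z x y"
proof -
  have "hip z y = cnj (hip y z)" by (rule hip_commute)
  then have "(x + \<mu> *s z) \<bullet> (y + \<nu> *s z) * (norm z)\<^sup>2 - Re (hip (x + \<mu> *s z) z * cnj (hip (y + \<nu> *s z) z)) =
    (x \<bullet> y) * (norm z)\<^sup>2 - Re (hip x z * cnj (hip y z))"
    by (simp add: inner_eq_Re_hip hip_self algebra_simps)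
  then show ?thesis by (simp add: G_def)
qed

lemma G_scale:
  assumes "c \<noteq> 0"
  shows "G a (c *s z) (c *s x) (c *s y) = G a z x y"
proof -
  define N where "N = (cmod c)\<^sup>2"
  have n: "c * cnj c = of_real N" by (simp add: N_def complex_mult_cnj cmod_power2)
  have Re_n: "Re (c * cnj c * (c * cnj c) * w) = N * N * Re w" for w
    unfolding n by (simp flip: of_real_mult)
  have hc: "hip (c *s x) (c *s y) = of_real N * hip x y" unfolding n[symmetric] by simp
  have "(c *s x) \<bullet> (c *s y) = N * (x \<bullet> y)"
    unfolding inner_eq_Re_hip hc by simp
  moreover have "Re (hip (c *s x) (c *s z) * cnj (hip (c *s y) (c *s z))) = N * N * Re (hip x z * cnj (hip y z))"
    unfolding Re_n[symmetric] by (rule arg_cong[of _ _ Re]) simp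
  moreover have "Re (hip (c *s x) (jq (c *s z)) * cnj (hip (c *s y) (jq (c *s z)))) = N * N * Re (hip x (jq z) * cnj (hip y (jq z)))"
    unfolding Re_n[symmetric] by (rule arg_cong[of _ _ Re]) simp
  moreover have "(norm (c *s z))\<^sup>2 = N * (norm z)\<^sup>2" "norm (c *s z) ^ 4 = N * N * norm z ^ 4"
    by (simp_all add: N_def power_mult_distrib power4_eq_xxxx power2_eq_square)
  ultimately have "G a (c *s z) (c *s x) (c *s y) = ((N * N) * (a * ((x \<bullet> y) * (norm z)\<^sup>2 - Re (hip x z * cnj (hip y z)))
     + (1 - a) * Re (hip x (jq z) * cnj (hip y (jq z))))) / ((N * N) * (norm z) ^ 4)"
    unfolding G_def by (simp only: algebra_simps)
  also have "\<dots> = G a z x y"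
    unfolding G_def using assms by (subst mult_divide_mult_cancel_left) (auto simp: N_def)
  finally show ?thesis .
qed

text \<open>The definition works at the arbitrary \<open>fibre_point\<close>; there the lifts are
  explicit projections, and the scale invariance of \<open>G\<close> carries the formula to any
  other representative.\<close>

lemma g_metric_dhopf:
  assumes "q \<noteq> 0"
  shows "g_metric a (hopf q) (dhopf q x) (dhopf q y) = G a q x y"
proof -
  define r where "r = fibre_point (hopf q)"
  have r: "r \<in> sphere 0 1" "hopf r = hopf q" "r \<noteq> 0" "hip r r = 1"
    using fibre_point[of "hopf q"] hip_unit by (auto simp: r_def)
  obtain c where c: "c \<noteq> 0" "r = c *s q" using hopf_eq_iff[OF assms r(3)] r(2) by auto
  have *: "g_metric a (hopf q) (dhopf r x) (dhopf r y) = G a r x y" for x y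
  proof -
    have v: "horizontal_lift r (dhopf r (hip x (jq r) *s jq r)) = hip x (jq r) *s jq r" for x
      by (simp add: horizontal_lift_dhopf[OF r(1)])
    have w: "horizontal_lift r (comp2 (hopf q) (dhopf r x)) = x - hip x (jq r) *s jq r - hip x r *s r" for x
    proof -
      have "comp2 (hopf q) (dhopf r x) = dhopf r (x - hip x (jq r) *s jq r)"
        using comp1_dhopf[of "hopf q" x] r by (simp add: comp2_def r_def)
      then show ?thesis by (simp add: horizontal_lift_dhopf[OF r(1)])
    qed
    have c: "hip r y = cnj (hip y r)" "hip (jq r) y = cnj (hip y (jq r))" by (rule hip_commute)+
    have n: "norm r = 1" using r(1) by simp
    have h1: "hip (\<alpha> *s jq r) (\<beta> *s jq r) = \<alpha> * cnj \<beta>" for \<alpha> \<beta>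
      using r(4) by simp
    have h2: "hip (x - hip x (jq r) *s jq r - hip x r *s r) (y - hip y (jq r) *s jq r - hip y r *s r) =
      hip x y - hip x (jq r) * cnj (hip y (jq r)) - hip x r * cnj (hip y r)"
      using r(4) c by (simp add: algebra_simps)
    have R: "Re (A - B - C) = Re A - Re B - Re C" for A B C by simp
    have "g_metric a (hopf q) (dhopf r x) (dhopf r y) = Re (hip x (jq r) * cnj (hip y (jq r))) +
      a * (Re (hip x y) - Re (hip x (jq r) * cnj (hip y (jq r))) - Re (hip x r * cnj (hip y r)))"
      unfolding g_metric_def fubini_study_def r_def[symmetric] w comp1_dhopf[of "hopf q", folded r_def] v
        inner_eq_Re_hip h1 h2 R ..
    then show ?thesis
      unfolding G_def n inner_eq_Re_hip power_one div_by_1 mult_1_right by (simp only: left_diff_distrib right_diff_distrib mult_1_left) 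
  qed
  have "dhopf q x = dhopf r (c *s x)" for x
    using c assms dhopf_scale by simp
  then show ?thesis using * c G_scale by simp
qed


section \<open>Lifts of maps to homogeneous coordinates\<close>

text \<open>The lift is the coordinate expression followed by the affine section over the target
  chart; its n-th coordinate is constantly 1, so it avoids 0.\<close>

lemma smooth_cp3_lift:
  assumes "smooth_cp3 \<phi>" "q \<noteq> 0"
  obtains U F where "open U" "q \<in> U" "0 \<notin> U" "\<And>k. C_k_on k U F" "\<And>z. z \<in> U \<Longrightarrow> F z \<noteq> 0 \<and> hopf (F z) = \<phi> (hopf z)"
proof -
  obtain m n W where W: "open W" "hopf q \<in> chart_dom m" "chart m (hopf q) \<in> W"
    "\<phi> ` affine_param m ` W \<subseteq> chart_dom n" "smooth_on W (chart n \<circ> \<phi> \<circ> affine_param m)"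
    using assms(1) unfolding smooth_cp3_def by metis
  have qm: "q$m \<noteq> 0" using W chart_dom_iff assms by blast
  define U where "U = {z. z$m \<noteq> 0} \<inter> coords m -` W"
  define F where "F z = affine_vec n ((chart n \<circ> \<phi> \<circ> affine_param m) (coords m z))" for z
  have "continuous_on {z. z$m \<noteq> 0} (coords m)" using C_k_on_coords[of 0 m] by simp
  then have U: "open U" unfolding U_def
    using W(1) open_nth_nonzero continuous_open_preimage by blast
  have "C_k_on k U (\<lambda>z. (chart n \<circ> \<phi> \<circ> affine_param m) (coords m z))" for k
    by (rule C_k_on_compose[OF U W(1) C_k_on_subset[OF C_k_on_coords]])
      (use W(5) in \<open>auto simp: U_def smooth_on_def comp_def\<close>)
  then have F: "C_k_on k U F" for k unfolding F_def
    by (rule C_k_on_compose[OF U open_UNIV _ C_k_on_affine_vec[OF open_UNIV]]) auto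
  have "hopf (F z) = \<phi> (hopf z)" if "z \<in> U" for z
  proof -
    have z: "z$m \<noteq> 0" "coords m z \<in> W" "z \<noteq> 0" using that by (auto simp: U_def)
    then have h: "affine_param m (coords m z) = hopf z"
      by (simp add: affine_param_eq affine_vec_coords hopf_scale)
    then have "\<phi> (hopf z) \<in> chart_dom n" using W(4) z by force
    then obtain w where "\<phi> (hopf z) = hopf (affine_vec n w)" by (auto simp: chart_dom_def affine_param_eq)
    then show ?thesis by (simp add: F_def h chart_hopf)
  qed
  then show ?thesis using that[OF U _ _ F] qm W(3) by (auto simp: U_def F_def chart_hopf)
qed

text \<open>In charts the map is F restricted to an affine slice through q. A vector x also has a
  component along the fibre; it is harmless because z and its projection into the slice lie over the
  same point, so F sends them over the same point too.\<close>

lemma diff_cp3_lift: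
  assumes "open U" "q \<in> U" "0 \<notin> U" "\<And>z. z \<in> U \<Longrightarrow> F z \<noteq> 0 \<and> hopf (F z) = \<phi> (hopf z)"
    and F': "(F has_derivative F') (at q)"
  shows "diff_cp3 \<phi> (hopf q) (dhopf q x) = dhopf (F q) (F' x)"
proof -
  have q: "q \<noteq> 0" "F q \<noteq> 0" "\<phi> (hopf q) = hopf (F q)" using assms by auto
  define m where "m = (SOME m. hopf q \<in> chart_dom m)"
  have "\<exists>m. hopf q \<in> chart_dom m" using nonzero_nth[OF q(1)] chart_dom_iff[OF q(1)] by blast
  then have "hopf q \<in> chart_dom m" unfolding m_def by (rule someI_ex)
  then have qm: "q$m \<noteq> 0" using chart_dom_iff[OF q(1)] by blast
  have "frechet_derivative (chart n \<circ> \<phi> \<circ> affine_param m) (at (coords m q)) (dcoords m q x) = dcoords n (F q) (F' x)"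
    if n: "F q $ n \<noteq> 0" for n
  proof -
    let ?g = "chart n \<circ> \<phi> \<circ> affine_param m" and ?w = "coords m q"
    \<comment> \<open>The affine section is rescaled by the m-th coordinate of q so that it passes
      through q itself, where the derivative of F is given.\<close>
    define s where "s w = (q$m) *s affine_vec m w" for w
    have s: "s ?w = q" using qm by (simp add: s_def affine_vec_coords)
    have s': "(s has_derivative (\<lambda>v. (q$m) *s embed_coord m v)) (at w)" for w
      unfolding s_def affine_vec_def
      by (rule has_derivative_vecI) (auto intro!: derivative_eq_intros has_derivative_nth bounded_linear_imp_has_derivative bounded_linear_embed)
    have Fc: "((\<lambda>w. coords n (F (s w))) has_derivative (\<lambda>v. dcoords n (F q) (F' ((q$m) *s embed_coord m v)))) (at ?w)"
      using F' has_derivative_coords[OF n]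
      by (intro has_derivative_compose[of "\<lambda>w. F (s w)", OF has_derivative_compose[of s, OF s']]) (simp_all add: s)
    have sU: "eventually (\<lambda>w. s w \<in> U) (at ?w)"
      using has_derivative_continuous[OF s', of ?w] assms(1,2) s
      unfolding continuous_within by (metis topological_tendstoD)
    have "continuous (at ?w) (\<lambda>w. F (s w) $ n)"
    proof (rule has_derivative_continuous[OF has_derivative_nth])
      show "((\<lambda>w. F (s w)) has_derivative (\<lambda>v. F' ((q$m) *s embed_coord m v))) (at ?w)"
        by (rule has_derivative_compose[of s, OF s']) (simp add: s F')
    qed
    then have "eventually (\<lambda>w. F (s w) $ n \<noteq> 0) (at ?w)"
      unfolding continuous_within using n s by (metis tendsto_imp_eventually_ne)
    with sU have ev: "eventually (\<lambda>w. coords n (F (s w)) = ?g w) (at ?w)"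
    proof eventually_elim
      case (elim w)
      have "hopf (s w) = affine_param m w"
        using qm by (simp add: s_def affine_param_eq hopf_scale)
      then have "\<phi> (affine_param m w) = hopf (F (s w))" using assms(4) elim by metis
      then show ?case using elim by (simp add: chart_hopf)
    qed
    have "coords n (F (s ?w)) = ?g ?w"
      using n q qm by (simp add: s affine_param_eq affine_vec_coords hopf_scale chart_hopf)
    from has_derivative_transform_eventually[OF Fc ev this]
    have g: "frechet_derivative ?g (at ?w) = (\<lambda>v. dcoords n (F q) (F' ((q$m) *s embed_coord m v)))"
      by (metis UNIV_I frechet_derivative_at)
    have d1: "((\<lambda>z. coords n (F z)) has_derivative (\<lambda>x. dcoords n (F q) (F' x))) (at q)"
      by (rule has_derivative_compose[OF F' has_derivative_coords[OF n]])
    have d2: "((\<lambda>z. coords n (F (s (coords m z)))) has_derivative (\<lambda>x. dcoords n (F q) (F' ((q$m) *s embed_coord m (dcoords m q x))))) (at q)"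
      by (rule has_derivative_compose[OF has_derivative_coords[OF qm] Fc])
    have sc: "((\<lambda>z. s (coords m z)) has_derivative (\<lambda>x. (q$m) *s embed_coord m (dcoords m q x))) (at q)"
      by (rule has_derivative_compose[OF has_derivative_coords[OF qm] s'])
    have "eventually (\<lambda>z. s (coords m z) \<in> U) (at q)"
      using has_derivative_continuous[OF sc] assms(1,2) s
      unfolding continuous_within by (metis topological_tendstoD)
    moreover have "eventually (\<lambda>z. z \<in> U \<inter> {z. z$m \<noteq> 0}) (at q)"
      using assms(1,2) qm open_nth_nonzero by (intro eventually_at_in_open') auto
    ultimately have ev2: "eventually (\<lambda>z. coords n (F (s (coords m z))) = coords n (F z)) (at q)"
    proof eventually_elim
      case (elim z)
      then have "s (coords m z) = (q$m / z$m) *s z" "z \<noteq> 0" "q$m / z$m \<noteq> 0"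
        using qm by (auto simp: s_def affine_vec_coords)
      then have "hopf (s (coords m z)) = hopf z" by (metis hopf_scale)
      then have "hopf (F (s (coords m z))) = hopf (F z)" "F z \<noteq> 0" "F (s (coords m z)) \<noteq> 0"
        using assms(4) elim by (metis IntD1)+
      then show ?case by (metis hopf_eq_imp_coords_eq)
    qed
    have "coords n (F (s ?w)) = coords n (F q)" by (simp add: s)
    from has_derivative_unique[OF has_derivative_transform_eventually[OF d2 ev2 this UNIV_I] d1]
    show ?thesis unfolding g by (rule fun_cong)
  qed
  then show ?thesis
    using q qm unfolding diff_cp3_def m_def[symmetric] Let_def
    by (simp add: dhopf_eq vec_eq_iff[where 'b=4] chart_dom_iff chart_hopf)
qed

lemma isometry_cp3_lift:
  assumes "isometry_cp3 a \<phi>" "open U" "q \<in> U" "0 \<notin> U" "\<And>z. z \<in> U \<Longrightarrow> F z \<noteq> 0 \<and> hopf (F z) = \<phi> (hopf z)"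
    and F': "(F has_derivative F') (at q)"
  shows "G a (F q) (F' x) (F' y) = G a q x y"
proof -
  have q: "q \<noteq> 0" "F q \<noteq> 0" "\<phi> (hopf q) = hopf (F q)" using assms by auto
  have "dhopf q v \<in> tangent_cp3 (hopf q)" for v using tangent_cp3_eq[OF q(1)] by blast
  with assms(1) have "g_metric a (\<phi> (hopf q)) (diff_cp3 \<phi> (hopf q) (dhopf q x)) (diff_cp3 \<phi> (hopf q) (dhopf q y)) =
    g_metric a (hopf q) (dhopf q x) (dhopf q y)"
    unfolding isometry_cp3_def by blast
  moreover have d: "diff_cp3 \<phi> (hopf q) (dhopf q v) = dhopf (F q) (F' v)" for v
    by (rule diff_cp3_lift[OF assms(2-4) _ F']) (rule assms(5))
  ultimately show ?thesis
    unfolding d q(3) g_metric_dhopf[OF q(1)] g_metric_dhopf[OF q(2)] by blast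
qed

text \<open>Only real linearity is asked for, so that complex conjugation is covered together with
  \<open>Sp2\<close>.\<close>

lemma isometry_cp3_of_linear:
  assumes F: "bounded_linear F" "\<And>z. z \<noteq> 0 \<Longrightarrow> F z \<noteq> 0" "\<And>z. z \<noteq> 0 \<Longrightarrow> hopf (F z) = \<phi> (hopf z)"
    and G: "\<And>z x y. G a (F z) (F x) (F y) = G a z x y"
  shows "isometry_cp3 a \<phi>"
  unfolding isometry_cp3_def smooth_cp3_def
proof (intro conjI allI ballI)
  fix p
  obtain q where q: "q \<noteq> 0" "hopf q = p" by (rule hopf_surj)
  obtain m where m: "q$m \<noteq> 0" using nonzero_nth[OF q(1)] by blast
  obtain n where n: "F q $ n \<noteq> 0" using nonzero_nth[OF F(2)[OF q(1)]] by blast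
  let ?W = "{w. F (affine_vec m w) $ n \<noteq> 0}"
  have Fa: "C_k_on k UNIV (\<lambda>w. F (affine_vec m w))" for k
    by (rule C_k_on_bounded_linear[OF F(1) open_UNIV C_k_on_affine_vec[OF open_UNIV]])
  have W: "open ?W"
    using C_k_on_component[OF open_UNIV Fa[of 0], of n] by (auto intro!: open_Collect_neq continuous_intros)
  have "hopf (F (affine_vec m (coords m q))) = hopf (F q)"
    using m q F by (simp add: affine_vec_coords hopf_scale)
  then have qW: "coords m q \<in> ?W"
    using n chart_dom_iff[OF F(2)[OF q(1)], of n] chart_dom_iff[OF F(2)[OF affine_vec_nonzero[of m "coords m q"]], of n]
    by simp
  have *: "chart n (hopf (F (affine_vec m w))) = (chart n \<circ> \<phi> \<circ> affine_param m) w" for w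
    using F(3)[OF affine_vec_nonzero] by (simp add: affine_param_eq)
  have "C_k_on k ?W (chart n \<circ> \<phi> \<circ> affine_param m)" for k
  proof (rule C_k_on_cong[OF W])
    show "C_k_on k ?W (\<lambda>w. coords n (F (affine_vec m w)))"
      by (rule C_k_on_compose[OF W open_nth_nonzero[of n] C_k_on_subset[OF Fa] C_k_on_coords]) auto
  qed (subst *[symmetric], subst chart_hopf, auto)
  moreover have "\<phi> ` affine_param m ` ?W \<subseteq> chart_dom n"
    by (auto simp: affine_param_eq F(3)[OF affine_vec_nonzero, symmetric] chart_dom_iff F(2))
  ultimately show "\<exists>m n W. open W \<and> p \<in> chart_dom m \<and> chart m p \<in> W \<and>
      \<phi> ` affine_param m ` W \<subseteq> chart_dom n \<and> smooth_on W (chart n \<circ> \<phi> \<circ> affine_param m)"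
    using W qW q m unfolding smooth_on_def
    by (intro exI[of _ m] exI[of _ n] exI[of _ ?W]) (auto simp: chart_dom_iff chart_hopf)
next
  fix p X Y assume XY: "X \<in> tangent_cp3 p" "Y \<in> tangent_cp3 p"
  obtain q where q: "q \<noteq> 0" "hopf q = p" by (rule hopf_surj)
  then obtain x y where xy: "X = dhopf q x" "Y = dhopf q y" using XY tangent_cp3_eq[OF q(1)] by blast
  have U: "open (- {0::complex^4})" by auto
  have d: "diff_cp3 \<phi> (hopf q) (dhopf q x) = dhopf (F q) (F x)" for x
    by (rule diff_cp3_lift[OF U _ _ _ bounded_linear_imp_has_derivative[OF F(1)]]) (use q F in auto)
  show "g_metric a (\<phi> p) (diff_cp3 \<phi> p X) (diff_cp3 \<phi> p Y) = g_metric a p X Y"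
    unfolding xy q(2)[symmetric] d F(3)[OF q(1), symmetric] g_metric_dhopf[OF q(1)] g_metric_dhopf[OF F(2)[OF q(1)]]
    by (rule G)
qed

section \<open>Two-jets of metrics and three-jets of isometries\<close>

abbreviation fd :: "('a::real_normed_vector \<Rightarrow> 'b::real_normed_vector) \<Rightarrow> 'a \<Rightarrow> 'a \<Rightarrow> 'b" where
  "fd f y v \<equiv> frechet_derivative f (at y) v"

text \<open>The hypothesis says that f pulls the constant form b back to b up to order two along
  rays. Order zero makes the differential isometric, order one kills the second derivatives, and
  order two expresses P by third derivatives, whose symmetry is all that is recorded of
  them.\<close>

lemma jets_at_zero:
  fixes f :: "'a::euclidean_space \<Rightarrow> 'a" and b :: "'a \<Rightarrow> 'a \<Rightarrow> real"
  assumes V: "open V" "0 \<in> V" and f: "C_k_on 3 V f"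
    and b: "bounded_bilinear b" "\<And>u v. b u v = b v u" "\<And>u. u \<noteq> 0 \<Longrightarrow> b u u > 0"
    and lim: "\<And>v u. ((\<lambda>t. (b (fd f (t *\<^sub>R v) u) (fd f (t *\<^sub>R v) u) - b u u) / t\<^sup>2) \<longlongrightarrow> P v u) (at 0)"
  shows jets_isometric: "b (fd f 0 u) (fd f 0 v) = b u v"
    and jets_surj: "surj (fd f 0)"
    and jets_second: "fd (\<lambda>y. fd f y u) 0 v = 0"
    and jets_third: "\<exists>c. (\<forall>v u s. linear (\<lambda>w. c w v u s)) \<and> (\<forall>w v u. linear (c w v u)) \<and>
      (\<forall>w v u s. c w v u s = c v w u s) \<and> (\<forall>w v u s. c w v u s = c w u v s) \<and>
      (\<forall>v u. P v u = c v v u u)"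
proof -
  interpret b: bounded_bilinear b by (rule b(1))
  define D1 where "D1 y u = fd f y u" for y u
  define D2 where "D2 y u v = fd (\<lambda>y. D1 y u) y v" for y u v
  define D3 where "D3 y u v w = fd (\<lambda>y. D2 y u v) y w" for y u v w
  have ck: "C_k_on (Suc (Suc (Suc 0))) V f" using f by (simp only: numeral_3_eq_3)
  have c1: "C_k_on (Suc (Suc 0)) V (\<lambda>y. D1 y u)" for u
    using ck unfolding D1_def C_k_on.simps(2)[of "Suc (Suc 0)"] by blast
  have c2: "C_k_on (Suc 0) V (\<lambda>y. D2 y u v)" for u v
    using c1[of u] unfolding D2_def C_k_on.simps(2)[of "Suc 0"] by blast
  have h1: "(f has_derivative D1 y) (at y)" if "y \<in> V" for y
    unfolding D1_def using C_k_on_has_derivative[OF ck that] .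
  have h2: "((\<lambda>y. D1 y u) has_derivative D2 y u) (at y)" if "y \<in> V" for y u
    unfolding D2_def using C_k_on_has_derivative[OF c1 that] .
  have h3: "((\<lambda>y. D2 y u v) has_derivative D3 y u v) (at y)" if "y \<in> V" for y u v
    unfolding D3_def using C_k_on_has_derivative[OF c2 that] .
  have lin1: "linear (D1 y)" if "y \<in> V" for y using has_derivative_linear[OF h1[OF that]] .
  have s2: "D2 y u v = D2 y v u" if "y \<in> V" for y u v
    by (rule second_derivative_symmetric[OF V(1) that h1 h2[OF that] h2[OF that]])
  have s3: "D3 0 u v w = D3 0 u w v" for u v w
    by (rule second_derivative_symmetric[OF V h2 h3[OF V(2)] h3[OF V(2)]])
  have s3': "D3 0 u v w = D3 0 v u w" for u v w
  proof -
    have "((\<lambda>y. D2 y u v) has_derivative D3 0 v u) (at 0)"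
      by (rule has_derivative_transform_within_open[OF h3[OF V(2)] V]) (rule s2)
    from has_derivative_unique[OF this h3[OF V(2)]] show ?thesis by simp
  qed
  define \<beta> where "\<beta> v u t = b (D1 (t *\<^sub>R v) u) (D1 (t *\<^sub>R v) u)" for v u t
  have ray: "((\<lambda>t. t *\<^sub>R v) has_derivative (\<lambda>s. s *\<^sub>R v)) (at t)" for v :: 'a and t
    by (auto intro!: derivative_eq_intros)
  have g1: "((\<lambda>t. D1 (t *\<^sub>R v) u) has_derivative (\<lambda>s. s *\<^sub>R D2 (t *\<^sub>R v) u v)) (at t)" if "t *\<^sub>R v \<in> V" for t v u
    using has_derivative_compose[OF ray h2[OF that]] linear_scale[OF has_derivative_linear[OF h2[OF that]]] by simp
  have g2: "((\<lambda>t. D2 (t *\<^sub>R v) u v) has_derivative (\<lambda>s. s *\<^sub>R D3 (t *\<^sub>R v) u v v)) (at t)" if "t *\<^sub>R v \<in> V" for t v u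
    using has_derivative_compose[OF ray h3[OF that]] linear_scale[OF has_derivative_linear[OF h3[OF that]]] by simp
  have evV: "eventually (\<lambda>t. t *\<^sub>R v \<in> V) (at 0)" for v
  proof -
    have "((\<lambda>t. t *\<^sub>R v) \<longlongrightarrow> 0 *\<^sub>R v) (at (0::real))" by (intro tendsto_intros)
    then show ?thesis using V by (auto dest: topological_tendstoD)
  qed
  have b1: "(\<beta> v u has_real_derivative 2 * b (D1 (t *\<^sub>R v) u) (D2 (t *\<^sub>R v) u v)) (at t)" if "t *\<^sub>R v \<in> V" for t v u
    unfolding \<beta>_def has_field_derivative_def
    by (rule has_derivative_eq_rhs[OF b.FDERIV[OF g1[OF that] g1[OF that]]])
      (auto simp: b.scaleR_right b.scaleR_left b(2) fun_eq_iff)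
  have lim': "((\<lambda>t. (\<beta> v u t - b u u) / t\<^sup>2) \<longlongrightarrow> P v u) (at 0)" for v u
    using lim[of v u] unfolding \<beta>_def D1_def .
  have b0: "\<beta> v u 0 = b u u" for v u
  proof -
    have "((\<lambda>t. (\<beta> v u t - b u u) / t\<^sup>2 * t\<^sup>2 + b u u) \<longlongrightarrow> P v u * 0\<^sup>2 + b u u) (at 0)"
      by (intro tendsto_intros lim')
    moreover have "eventually (\<lambda>t. (\<beta> v u t - b u u) / t\<^sup>2 * t\<^sup>2 + b u u = \<beta> v u t) (at 0)"
      by (auto simp: eventually_at intro!: exI[of _ 1])
    ultimately have "(\<beta> v u \<longlongrightarrow> P v u * 0\<^sup>2 + b u u) (at 0)"
      by (rule Lim_transform_eventually)
    then have "(\<beta> v u \<longlongrightarrow> b u u) (at 0)" by simp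
    moreover have "(\<beta> v u \<longlongrightarrow> \<beta> v u 0) (at 0)"
      using DERIV_isCont[OF b1[of 0 v u]] V(2) by (simp add: isCont_def)
    ultimately show ?thesis using tendsto_unique[OF at_neq_bot] by blast
  qed
  have lim'': "((\<lambda>t. (\<beta> v u t - \<beta> v u 0) / t\<^sup>2) \<longlongrightarrow> P v u) (at 0)" for v u
    using lim' b0 by simp
  have A: "linear (D1 0)" by (rule lin1[OF V(2)])
  have iso: "b (D1 0 u) (D1 0 v) = b u v" for u v
  proof -
    have q: "b (D1 0 u) (D1 0 u) = b u u" for u using b0[of 0 u] by (simp add: \<beta>_def)
    have "b (D1 0 (u + v)) (D1 0 (u + v)) = b (u + v) (u + v)" by (rule q)
    then show ?thesis
      using q[of u] q[of v] b(2)[of v u] b(2)[of "D1 0 v" "D1 0 u"]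
      by (simp add: linear_add[OF A] b.add_left b.add_right)
  qed
  have sur: "surj (D1 0)"
  proof (rule linear_injective_imp_surjective[OF A])
    have "u = 0" if "D1 0 u = 0" for u
      using b(3)[of u] iso[of u u] that by (auto simp: b.zero_left)
    then show "inj (D1 0)" using linear_injective_0[OF A] by blast
  qed simp
  have B0: "b (D1 0 u) (D2 0 u v) = 0" for u v
  proof -
    have "((\<lambda>t. (\<beta> v u t - \<beta> v u 0) / t\<^sup>2 * t) \<longlongrightarrow> P v u * 0) (at 0)"
      by (intro tendsto_intros lim'')
    moreover have "x / t\<^sup>2 * t = x / t" for x t :: real
      by (simp add: power2_eq_square)
    ultimately have "((\<lambda>t. (\<beta> v u (0 + t) - \<beta> v u 0) / t) \<longlongrightarrow> 0) (at 0)"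
      by simp
    then have "(\<beta> v u has_real_derivative 0) (at 0)" by (simp add: DERIV_def)
    from DERIV_unique[OF this b1[of 0]] V(2) show ?thesis by simp
  qed
  \<comment> \<open>Uniqueness of the Levi-Civita connection in disguise: b(Au, D2 w v), with A =
    \<open>D1 0\<close>, is skew in u, w and symmetric in w, v, hence zero, and A is onto.\<close>
  have B: "D2 0 u v = 0" for u v
  proof -
    have l2: "D2 0 (u + w) v = D2 0 u v + D2 0 w v" for u w v
      using s2[OF V(2)] linear_add[OF has_derivative_linear[OF h2[OF V(2)]]] by metis
    have anti: "b (D1 0 u) (D2 0 w v) = - b (D1 0 w) (D2 0 u v)" for u v w
      using B0[of "u + w" v] B0[of u v] B0[of w v]
      by (simp add: linear_add[OF A] l2 b.add_left b.add_right)
    have z: "b (D1 0 u) (D2 0 w v) = 0" for u v w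
      using anti[of u w v] anti[of w v u] anti[of v u w] s2[OF V(2), of u v] s2[OF V(2), of u w] s2[OF V(2), of w v]
      by simp
    obtain w where "D1 0 w = D2 0 u v" using sur by (metis surjD)
    with z[of w u v] b(3)[of "D2 0 u v"] show ?thesis by force
  qed
  \<comment> \<open>The first derivative of \<beta> vanishes at 0, so the limit is half the second
    one; the term with two factors \<open>D2\<close> drops out by \<open>B\<close>.\<close>
  have C: "P v u = b (D1 0 u) (D3 0 u v v)" for v u
  proof -
    have "((\<lambda>t. (\<beta> v u t - \<beta> v u 0) / t\<^sup>2) \<longlongrightarrow> b (D1 0 u) (D3 0 u v v)) (at 0)"
    proof (rule lhopital)
      have "(\<beta> v u \<longlongrightarrow> \<beta> v u 0) (at 0)"
        using DERIV_isCont[OF b1[of 0 v u]] V(2) by (simp add: isCont_def)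
      then show "((\<lambda>t. \<beta> v u t - \<beta> v u 0) \<longlongrightarrow> 0) (at 0)" by (simp add: LIM_zero)
      have "((\<lambda>t::real. t\<^sup>2) \<longlongrightarrow> 0\<^sup>2) (at 0)" by (intro tendsto_intros)
      then show "((\<lambda>t::real. t\<^sup>2) \<longlongrightarrow> 0) (at 0)" by simp
      show "eventually (\<lambda>t::real. t\<^sup>2 \<noteq> 0) (at 0)" "eventually (\<lambda>t::real. 2 * t \<noteq> 0) (at 0)"
        by (auto simp: eventually_at intro!: exI[of _ 1])
      show "eventually (\<lambda>t. ((\<lambda>t. \<beta> v u t - \<beta> v u 0) has_real_derivative 2 * b (D1 (t *\<^sub>R v) u) (D2 (t *\<^sub>R v) u v)) (at t)) (at 0)"
        using evV[of v] by eventually_elim (use b1 in \<open>auto intro!: derivative_eq_intros\<close>)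
      show "eventually (\<lambda>t. ((\<lambda>t::real. t\<^sup>2) has_real_derivative 2 * t) (at t)) (at 0)"
        by (auto intro!: always_eventually derivative_eq_intros)
      have "((\<lambda>t. b (D1 (t *\<^sub>R v) u) (D2 (t *\<^sub>R v) u v)) has_derivative
          (\<lambda>s. b (D1 (0 *\<^sub>R v) u) (s *\<^sub>R D3 (0 *\<^sub>R v) u v v) + b (s *\<^sub>R D2 (0 *\<^sub>R v) u v) (D2 (0 *\<^sub>R v) u v))) (at 0)"
        by (rule b.FDERIV[OF g1 g2]) (use V(2) in auto)
      then have "((\<lambda>t. b (D1 (t *\<^sub>R v) u) (D2 (t *\<^sub>R v) u v)) has_real_derivative b (D1 0 u) (D3 0 u v v)) (at 0)"
        unfolding has_field_derivative_def
        by (rule has_derivative_eq_rhs) (simp add: B b.zero_right b.scaleR_right fun_eq_iff mult.commute)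
      then have "((\<lambda>t. b (D1 (t *\<^sub>R v) u) (D2 (t *\<^sub>R v) u v) / t) \<longlongrightarrow> b (D1 0 u) (D3 0 u v v)) (at 0)"
        by (simp add: DERIV_def B b.zero_right)
      then show "((\<lambda>t. 2 * b (D1 (t *\<^sub>R v) u) (D2 (t *\<^sub>R v) u v) / (2 * t)) \<longlongrightarrow> b (D1 0 u) (D3 0 u v v)) (at 0)"
        by simp
    qed
    then show ?thesis using tendsto_unique[OF at_neq_bot] lim'' by blast
  qed
  show "b (fd f 0 u) (fd f 0 v) = b u v" using iso unfolding D1_def .
  show "surj (fd f 0)" using sur unfolding D1_def .
  show "fd (\<lambda>y. fd f y u) 0 v = 0" using B unfolding D1_def D2_def .
  \<comment> \<open>Mixed partials commute in w, v, u, but s enters through the differential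
    instead; so only the first three slots are symmetric.\<close>
  define c where "c w v u s = b (D1 0 s) (D3 0 u v w)" for w v u s
  have l3: "linear (D3 0 u v)" for u v by (rule has_derivative_linear[OF h3[OF V(2)]])
  have "linear (\<lambda>w. c w v u s)" for v u s
    unfolding c_def by (intro linearI) (auto simp: linear_add[OF l3] linear_scale[OF l3] b.add_right b.scaleR_right)
  moreover have "linear (c w v u)" for w v u
    unfolding c_def by (intro linearI) (auto simp: linear_add[OF A] linear_scale[OF A] b.add_left b.scaleR_left)
  moreover have "c w v u s = c v w u s" "c w v u s = c w u v s" for w v u s
    unfolding c_def using s3 s3' by metis+
  moreover have "P v u = c v v u u" for v u unfolding c_def by (rule C)
  ultimately show "\<exists>c. (\<forall>v u s. linear (\<lambda>w. c w v u s)) \<and> (\<forall>w v u. linear (c w v u)) \<and>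
      (\<forall>w v u s. c w v u s = c v w u s) \<and> (\<forall>w v u s. c w v u s = c w u v s) \<and> (\<forall>v u. P v u = c v v u u)"
    by (intro exI[of _ c]) blast
qed

text \<open>If the metric is \<open>b + Q y + o(|y|\<^sup>2)\<close> in normal coordinates \<open>y\<close>, then \<open>curv Q u v\<close> is, by polarization,
  \<open>2 \<partial>\<^sub>u\<partial>\<^sub>v g(u,v) - \<partial>\<^sub>u\<partial>\<^sub>u g(v,v) - \<partial>\<^sub>v\<partial>\<^sub>v g(u,u)\<close> at the origin, that is \<open>2 R(u,v,v,u)\<close>.\<close>

definition curv :: "('a::real_vector \<Rightarrow> 'a \<Rightarrow> real) \<Rightarrow> 'a \<Rightarrow> 'a \<Rightarrow> real" where
  "curv Q u v = (Q (u + v) (u + v) - Q (u + v) (u - v) - Q (u - v) (u + v) + Q (u - v) (u - v)) / 4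
     - 2 * Q v u - 2 * Q u v"

text \<open>A form c(v,v,u,u) symmetric in its first three slots has vanishing \<open>curv\<close>:
  the polarized term equals 2 c(u,u,v,v) + 2 c(v,v,u,u), and exactly these are subtracted. So the
  third derivatives of the isometry leave no trace.\<close>

lemma curv_invariant:
  assumes c: "\<And>v u s. linear (\<lambda>w. c w v u s)" "\<And>w v u. linear (c w v u)"
    "\<And>w v u s. c w v u s = c v w u s" "\<And>w v u s. c w v u s = c w u v s"
    and P: "\<And>v u. Q v u - Q (A v) (A u) = c v v u u" and A: "linear A"
  shows "curv Q (A u) (A v) = curv Q u v"
proof -
  have a1: "c (w + w') v u s = c w v u s + c w' v u s" "c (w - w') v u s = c w v u s - c w' v u s" for w w' v u s
    using linear_add[OF c(1)] linear_diff[OF c(1)] by auto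
  have a2: "c w (v + w') u s = c w v u s + c w w' u s" "c w (v - w') u s = c w v u s - c w w' u s" for w w' v u s
    using a1 c(3) by metis+
  have a3: "c w v (u + w') s = c w v u s + c w v w' s" "c w v (u - w') s = c w v u s - c w v w' s" for w w' v u s
    using a2 c(4) by metis+
  have a4: "c w v u (s + w') = c w v u s + c w v u w'" "c w v u (s - w') = c w v u s - c w v u w'" for w w' v u s
    using linear_add[OF c(2)] linear_diff[OF c(2)] by auto
  have sv: "c v u u s = c u u v s" "c u v u s = c u u v s" "c v u v s = c u v v s" "c v v u s = c u v v s" for s
    using c(3,4) by metis+
  have P': "Q (A v) (A u) = Q v u - c v v u u" for u v using P[of v u] by simp
  show ?thesis
    unfolding curv_def linear_add[OF A, symmetric] linear_diff[OF A, symmetric] P' a1 a2 a3 a4 sv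
    by (simp add: field_simps)
qed

section \<open>Normal coordinates at a point\<close>

text \<open>Coordinates of \<open>\<complex>P\<^sup>3\<close> around \<open>[1:0:0:0]\<close> in which, for \<open>\<kappa> = (1 - a) / a\<close>, the first derivatives of \<open>g\<^sub>a\<close>
  vanish at the origin; \<open>ncoord_inv \<kappa>\<close> is their inverse.\<close>

definition ncoord :: "real \<Rightarrow> complex^3 \<Rightarrow> complex^4" where
  "ncoord \<kappa> y = vector [1, y$1, y$2 + of_real \<kappa> * (y$1 * cnj (y$3)), y$3 - of_real \<kappa> * (y$1 * cnj (y$2))]"

definition dncoord :: "real \<Rightarrow> complex^3 \<Rightarrow> complex^3 \<Rightarrow> complex^4" where
  "dncoord \<kappa> y u = vector [0, u$1, u$2 + of_real \<kappa> * (u$1 * cnj (y$3) + y$1 * cnj (u$3)),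
     u$3 - of_real \<kappa> * (u$1 * cnj (y$2) + y$1 * cnj (u$2))]"

definition ncoord_inv :: "real \<Rightarrow> complex^4 \<Rightarrow> complex^3" where
  "ncoord_inv \<kappa> z = (let w = coords 1 z; d = 1 + of_real (\<kappa>\<^sup>2) * (w$1 * cnj (w$1)) in
     vector [w$1, (w$2 - of_real \<kappa> * (w$1 * cnj (w$3))) / d, (w$3 + of_real \<kappa> * (w$1 * cnj (w$2))) / d])"

lemma ncoord_nth [simp]: "ncoord \<kappa> y $ 1 = 1" "ncoord \<kappa> y $ 2 = y$1" "ncoord \<kappa> y $ 3 = y$2 + of_real \<kappa> * (y$1 * cnj (y$3))"
  "ncoord \<kappa> y $ 4 = y$3 - of_real \<kappa> * (y$1 * cnj (y$2))"
  by (simp_all add: ncoord_def)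

lemma dncoord_nth [simp]: "dncoord \<kappa> y u $ 1 = 0" "dncoord \<kappa> y u $ 2 = u$1"
  "dncoord \<kappa> y u $ 3 = u$2 + of_real \<kappa> * (u$1 * cnj (y$3) + y$1 * cnj (u$3))"
  "dncoord \<kappa> y u $ 4 = u$3 - of_real \<kappa> * (u$1 * cnj (y$2) + y$1 * cnj (u$2))"
  by (simp_all add: dncoord_def)

text \<open>For fixed first coordinate, \<open>ncoord\<close> is complex linear in the pair of the
  second coordinate and the conjugate of the third; this is the determinant of that system.\<close>

lemma ncoord_inv_denominator: "1 + of_real (\<kappa>\<^sup>2) * (w * cnj w) \<noteq> (0::complex)"
proof -
  have "1 + of_real (\<kappa>\<^sup>2) * (w * cnj w) = complex_of_real (1 + \<kappa>\<^sup>2 * (cmod w)\<^sup>2)"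
    by (simp add: complex_norm_square flip: of_real_power)
  moreover have "1 + \<kappa>\<^sup>2 * (cmod w)\<^sup>2 > 0" by (simp add: add_pos_nonneg)
  ultimately show ?thesis by (metis of_real_eq_0_iff less_irrefl)
qed

lemma coords_ncoord: "coords 1 (ncoord \<kappa> y) = vector [y$1, y$2 + of_real \<kappa> * (y$1 * cnj (y$3)), y$3 - of_real \<kappa> * (y$1 * cnj (y$2))]"
  by (simp add: coords_def drop_coord_def vec3_eq_iff)

lemma ncoord_inv_ncoord: "ncoord_inv \<kappa> (ncoord \<kappa> y) = y"
  using ncoord_inv_denominator[of \<kappa> "y$1"]
  by (simp add: ncoord_inv_def coords_ncoord Let_def vec3_eq_iff field_simps power2_eq_square)

lemma ncoord_ncoord_inv:
  assumes "z$1 \<noteq> 0"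
  shows "ncoord \<kappa> (ncoord_inv \<kappa> z) = (1 / z$1) *s z"
proof -
  define w where "w = coords 1 z"
  define d where "d = 1 + of_real (\<kappa>\<^sup>2) * (w$1 * cnj (w$1))"
  have d: "d \<noteq> 0" "cnj d = d" using ncoord_inv_denominator[of \<kappa> "w$1"] by (simp_all add: d_def mult.commute)
  have r: "ncoord_inv \<kappa> z $ 1 = w$1" "ncoord_inv \<kappa> z $ 2 = (w$2 - of_real \<kappa> * (w$1 * cnj (w$3))) / d"
    "ncoord_inv \<kappa> z $ 3 = (w$3 + of_real \<kappa> * (w$1 * cnj (w$2))) / d"
    by (simp_all add: ncoord_inv_def w_def d_def Let_def)
  have "ncoord \<kappa> (ncoord_inv \<kappa> z) $ 3 = w$2"
  proof -
    have c: "cnj (ncoord_inv \<kappa> z $ 3) = (cnj (w$3) + of_real \<kappa> * (cnj (w$1) * w$2)) / d"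
      unfolding r complex_cnj_divide d(2) by simp
    have "ncoord \<kappa> (ncoord_inv \<kappa> z) $ 3 = (w$2 - of_real \<kappa> * (w$1 * cnj (w$3)) + of_real \<kappa> * (w$1 * (cnj (w$3) + of_real \<kappa> * (cnj (w$1) * w$2)))) / d"
      unfolding ncoord_nth c unfolding r add_divide_distrib[of "w$2 - _"] by simp
    also have "\<dots> = (w$2 * d) / d" unfolding d_def by (simp add: algebra_simps power2_eq_square)
    finally show ?thesis using d by simp
  qed
  moreover have "ncoord \<kappa> (ncoord_inv \<kappa> z) $ 4 = w$3"
  proof -
    have c: "cnj (ncoord_inv \<kappa> z $ 2) = (cnj (w$2) - of_real \<kappa> * (cnj (w$1) * w$3)) / d"
      unfolding r complex_cnj_divide d(2) by simp
    have "ncoord \<kappa> (ncoord_inv \<kappa> z) $ 4 = (w$3 + of_real \<kappa> * (w$1 * cnj (w$2)) - of_real \<kappa> * (w$1 * (cnj (w$2) - of_real \<kappa> * (cnj (w$1) * w$3)))) / d"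
      unfolding ncoord_nth c unfolding r diff_divide_distrib[of "w$3 + _"] by simp
    also have "\<dots> = (w$3 * d) / d" unfolding d_def by (simp add: algebra_simps power2_eq_square)
    finally show ?thesis using d by simp
  qed
  ultimately show ?thesis
    using assms r(1) by (simp add: vec4_eq_iff w_def coords_def drop_coord_def)
qed

lemma has_derivative_ncoord: "(ncoord \<kappa> has_derivative dncoord \<kappa> y) (at y)"
proof (rule has_derivative_vecI)
  fix i :: 4
  have c: "((\<lambda>y. cnj (y$m)) has_derivative (\<lambda>u. cnj (u$m))) (at y)" for m :: 3 and y :: "complex^3"
    by (intro bounded_linear.has_derivative[OF bounded_linear_cnj] derivative_intros)
  show "((\<lambda>y. ncoord \<kappa> y $ i) has_derivative (\<lambda>u. dncoord \<kappa> y u $ i)) (at y)"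
    using exhaust_4[of i] by (auto intro!: derivative_eq_intros c simp: algebra_simps)
qed

lemma C_k_on_cnj_nth: "open S \<Longrightarrow> C_k_on k S f \<Longrightarrow> C_k_on k S (\<lambda>y. cnj (f y $ m))"
  by (intro C_k_on_bounded_linear[OF bounded_linear_cnj] C_k_on_component)

lemma C_k_on_nth: "C_k_on k S (\<lambda>y. y $ m)"
  by (rule C_k_on_linear[OF bounded_linear_vec_nth])

lemma C_k_on_ident: "C_k_on k S (\<lambda>y. y)"
  by (rule C_k_on_linear[OF bounded_linear_ident])

lemma C_k_on_ncoord: "C_k_on k UNIV (ncoord \<kappa>)"
proof (rule C_k_on_vec[OF open_UNIV])
  fix i :: 4
  have c: "C_k_on k UNIV (\<lambda>y::complex^3. cnj (y$m))" for m
    by (rule C_k_on_cnj_nth[OF open_UNIV C_k_on_ident])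
  show "C_k_on k UNIV (\<lambda>y. ncoord \<kappa> y $ i)"
    using exhaust_4[of i]
    by (auto intro!: C_k_on_add C_k_on_diff C_k_on_mult C_k_on_const C_k_on_nth c)
qed

lemma C_k_on_ncoord_inv: "C_k_on k {z. z$1 \<noteq> 0} (ncoord_inv \<kappa>)"
proof (rule C_k_on_vec[OF open_nth_nonzero])
  fix i :: 3
  note o = open_nth_nonzero[of 1]
  have w: "C_k_on k {z. z$1 \<noteq> 0} (\<lambda>z. coords 1 z $ m)" "C_k_on k {z. z$1 \<noteq> 0} (\<lambda>z. cnj (coords 1 z $ m))" for m
    by (rule C_k_on_component[OF o C_k_on_coords] C_k_on_cnj_nth[OF o C_k_on_coords])+
  show "C_k_on k {z. z$1 \<noteq> 0} (\<lambda>z. ncoord_inv \<kappa> z $ i)"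
    using exhaust_3[of i] unfolding ncoord_inv_def Let_def
    by (auto intro!: C_k_on_add C_k_on_diff C_k_on_mult C_k_on_divide C_k_on_const w o simp: ncoord_inv_denominator simp del: of_real_power)
qed

section \<open>Local isometries read in normal coordinates\<close>

text \<open>F need not be homogeneous: \<open>G a\<close> ignores the direction of z, so the
  condition sees only the induced map of the quotient, whatever scalar factor F carries.\<close>

definition lift_iso :: "real \<Rightarrow> (complex^4) set \<Rightarrow> (complex^4 \<Rightarrow> complex^4) \<Rightarrow> bool" where
  "lift_iso a U F \<longleftrightarrow> open U \<and> 0 \<notin> U \<and> (\<forall>k. C_k_on k U F) \<and>
     (\<forall>z\<in>U. F z \<noteq> 0 \<and> (\<forall>x. G a (F z) (fd F z x) (fd F z x) = G a z x x))"

abbreviation e1 :: "complex^4" where "e1 \<equiv> axis 1 1"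

definition chart_form :: "real \<Rightarrow> real \<Rightarrow> complex^3 \<Rightarrow> complex^3 \<Rightarrow> real" where
  "chart_form a \<kappa> y u = G a (ncoord \<kappa> y) (dncoord \<kappa> y u) (dncoord \<kappa> y u)"

lemma ncoord_0 [simp]: "ncoord \<kappa> 0 = e1"
  by (simp add: vec4_eq_iff axis_def)

lemma dncoord_0: "dncoord \<kappa> 0 u = embed_coord 1 u"
  by (simp add: vec4_eq_iff embed_coord_def)

lemma ncoord_inv_has_derivative: "z$1 \<noteq> 0 \<Longrightarrow> (ncoord_inv \<kappa> has_derivative fd (ncoord_inv \<kappa>) z) (at z)"
  using C_k_on_has_derivative[OF C_k_on_ncoord_inv[of "Suc 0"]] by simp

lemma dncoord_ncoord_inv:
  assumes "z$1 \<noteq> 0"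
  shows "dncoord \<kappa> (ncoord_inv \<kappa> z) (fd (ncoord_inv \<kappa>) z x) = (1 / z$1) *s x + (- x$1 / (z$1)\<^sup>2) *s z"
proof -
  have "((\<lambda>z. ncoord \<kappa> (ncoord_inv \<kappa> z)) has_derivative (\<lambda>x. dncoord \<kappa> (ncoord_inv \<kappa> z) (fd (ncoord_inv \<kappa>) z x))) (at z)"
    by (rule has_derivative_compose[OF ncoord_inv_has_derivative[OF assms] has_derivative_ncoord])
  then have d: "((\<lambda>z. (1 / z$1) *s z) has_derivative (\<lambda>x. dncoord \<kappa> (ncoord_inv \<kappa> z) (fd (ncoord_inv \<kappa>) z x))) (at z)"
    by (rule has_derivative_transform_within_open[OF _ open_nth_nonzero[of 1]]) (use assms ncoord_ncoord_inv in auto)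
  have "((\<lambda>z. (1 / z$1) *s z) has_derivative (\<lambda>x. (1 / z$1) *s x + (- x$1 / (z$1)\<^sup>2) *s z)) (at z)"
    by (rule has_derivative_vecI)
      (use assms in \<open>auto intro!: derivative_eq_intros simp: power2_eq_square divide_simps algebra_simps\<close>)
  from fun_cong[OF has_derivative_unique[OF d this]] show ?thesis .
qed

text \<open>\<open>ncoord_inv\<close> followed by \<open>ncoord\<close> is division by the first
  coordinate, and the derivative of that factor contributes only a multiple of z, which
  \<open>G\<close> ignores.\<close>

lemma chart_form_ncoord_inv:
  assumes "z$1 \<noteq> 0"
  shows "chart_form a \<kappa> (ncoord_inv \<kappa> z) (fd (ncoord_inv \<kappa>) z x) = G a z x x"
  unfolding chart_form_def dncoord_ncoord_inv[OF assms] ncoord_ncoord_inv[OF assms]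
proof -
  have eq: "(1 / z$1) *s x + (- x$1 / (z$1)\<^sup>2) *s z = (1 / z$1) *s (x + (- x$1 / z$1) *s z)"
    using assms by (simp add: vec_eq_iff power2_eq_square field_simps)
  have nz: "1 / z$1 \<noteq> 0" using assms by simp
  show "G a ((1 / z$1) *s z) ((1 / z$1) *s x + (- x$1 / (z$1)\<^sup>2) *s z) ((1 / z$1) *s x + (- x$1 / (z$1)\<^sup>2) *s z) = G a z x x"
    unfolding eq G_scale[OF nz] G_vertical ..
qed

text \<open>The parameters a and \<kappa> are left unrelated: the locale is used later with both
  equal to 0, where the coordinates are not normal for the form but f is the same map as for a =
  1.\<close>

locale fixed_chart =
  fixes a \<kappa> :: real and U F
  assumes F: "lift_iso a U F" and e1: "e1 \<in> U" "F e1 = e1"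
begin

definition "f y = ncoord_inv \<kappa> (F (ncoord \<kappa> y))"
definition "V = ncoord \<kappa> -` (U \<inter> F -` {z. z$1 \<noteq> 0})"

lemma U: "open U" "0 \<notin> U" and C_k_F: "C_k_on k U F"
  and F_iso: "z \<in> U \<Longrightarrow> G a (F z) (fd F z x) (fd F z x) = G a z x x"
  using F unfolding lift_iso_def by blast+

lemma F_has_derivative: "z \<in> U \<Longrightarrow> (F has_derivative fd F z) (at z)"
  using C_k_on_has_derivative[OF C_k_F] .

lemma V: "open V" "0 \<in> V"
proof -
  have "continuous_on U F" using C_k_F[of 0] by simp
  then have "open (U \<inter> F -` {z. z$1 \<noteq> 0})"
    using U(1) open_nth_nonzero continuous_open_preimage by blast
  moreover have "continuous_on UNIV (ncoord \<kappa>)" using C_k_on_ncoord[of 0] by simp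
  ultimately show "open V" unfolding V_def using open_vimage by blast
  show "0 \<in> V" using e1 by (simp add: V_def)
qed

lemma C_k_f: "C_k_on k V f"
  unfolding f_def
proof (rule C_k_on_compose[OF V(1) open_nth_nonzero[of 1] _ C_k_on_ncoord_inv])
  show "C_k_on k V (\<lambda>y. F (ncoord \<kappa> y))"
    by (rule C_k_on_compose[OF V(1) U(1) C_k_on_subset[OF C_k_on_ncoord] C_k_F]) (auto simp: V_def)
qed (auto simp: V_def)

lemma fd_f:
  assumes "y \<in> V"
  shows "fd f y u = fd (ncoord_inv \<kappa>) (F (ncoord \<kappa> y)) (fd F (ncoord \<kappa> y) (dncoord \<kappa> y u))"
proof -
  have "(f has_derivative (\<lambda>u. fd (ncoord_inv \<kappa>) (F (ncoord \<kappa> y)) (fd F (ncoord \<kappa> y) (dncoord \<kappa> y u)))) (at y)"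
    unfolding f_def
    by (rule has_derivative_compose[of "\<lambda>y. F (ncoord \<kappa> y)", OF has_derivative_compose[OF has_derivative_ncoord F_has_derivative] ncoord_inv_has_derivative])
      (use assms in \<open>auto simp: V_def\<close>)
  then show ?thesis by (metis frechet_derivative_at)
qed

lemma chart_form_f: "y \<in> V \<Longrightarrow> chart_form a \<kappa> (f y) (fd f y u) = chart_form a \<kappa> y u"
  unfolding fd_f unfolding f_def by (subst chart_form_ncoord_inv) (auto simp: F_iso V_def chart_form_def)

lemma f_0: "f 0 = 0"
  using ncoord_inv_ncoord[of \<kappa> 0] by (simp add: f_def e1)

lemma fd_f_0: "fd f 0 u = drop_coord 1 (fd F e1 (embed_coord 1 u))"
proof -
  have "embed_coord 1 (fd (ncoord_inv \<kappa>) e1 x) = x + (- x$1) *s e1" for x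
    using dncoord_ncoord_inv[of e1 \<kappa> x] ncoord_inv_ncoord[of \<kappa> 0] by (simp add: dncoord_0)
  from arg_cong[OF this, of "drop_coord 1"] have "fd (ncoord_inv \<kappa>) e1 x = drop_coord 1 x" for x
    by simp
  then show ?thesis by (simp add: fd_f[OF V(2)] e1 dncoord_0)
qed

end

section \<open>Second-order expansion of the metric\<close>

text \<open>The metric at the point of \<open>e1\<close>; since \<open>jq e1\<close> is the second
  basis vector, the first chart coordinate is the \<open>D1\<close> direction and the other two span
  \<open>D2\<close>.\<close>

definition origin_form :: "real \<Rightarrow> complex^3 \<Rightarrow> complex^3 \<Rightarrow> real" where
  "origin_form a u v = u$1 \<bullet> v$1 + a * (u$2 \<bullet> v$2 + u$3 \<bullet> v$3)"

lemma origin_form_bilinear: "bounded_bilinear (origin_form a)"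
  unfolding bilinear_conv_bounded_bilinear[symmetric] bilinear_def origin_form_def
  by (auto intro!: linearI simp: algebra_simps inner_simps)

lemma origin_form_commute: "origin_form a u v = origin_form a v u"
  by (simp add: origin_form_def inner_commute)

lemma origin_form_self: "origin_form a u u = (cmod (u$1))\<^sup>2 + a * ((cmod (u$2))\<^sup>2 + (cmod (u$3))\<^sup>2)"
  by (simp add: origin_form_def power2_norm_eq_inner)

lemma origin_form_pos:
  assumes "a > 0" "u \<noteq> 0"
  shows "origin_form a u u > 0"
proof -
  have "(cmod (u$1))\<^sup>2 + a * ((cmod (u$2))\<^sup>2 + (cmod (u$3))\<^sup>2) = 0 \<longleftrightarrow> u = 0"
    using assms(1) by (auto simp: add_nonneg_eq_0_iff vec3_eq_iff)
  moreover have "origin_form a u u \<ge> 0" using assms(1) by (simp add: origin_form_self)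
  ultimately show ?thesis using assms(2) unfolding origin_form_self by linarith
qed

text \<open>The remainder \<open>chart_form a \<kappa> (t y) u - origin_form a u u\<close>, multiplied by \<open>|ncoord \<kappa> (t y)|\<^sup>4\<close> and divided by \<open>t\<^sup>2\<close>.\<close>

definition remainder :: "real \<Rightarrow> real \<Rightarrow> real \<Rightarrow> complex^3 \<Rightarrow> complex^3 \<Rightarrow> real" where
  "remainder a \<kappa> t y u =
    (let s2 = u$1 * cnj (y$3) + y$1 * cnj (u$3); s3 = - (u$1 * cnj (y$2) + y$1 * cnj (u$2));
       p2 = y$1 * cnj (y$3); p3 = - (y$1 * cnj (y$2));
       x2 = u$2 + of_real (\<kappa> * t) * s2; x3 = u$3 + of_real (\<kappa> * t) * s3;
       q2 = y$2 + of_real (\<kappa> * t) * p2; q3 = y$3 + of_real (\<kappa> * t) * p3;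
       N = (cmod (y$1))\<^sup>2 + (cmod q2)\<^sup>2 + (cmod q3)\<^sup>2;
       \<sigma> = u$3 * y$2 - u$2 * y$3;
       Z = of_real \<kappa> * (u$3 * p2 - u$2 * p3 - s2 * y$3 + s3 * y$2) + of_real (t * \<kappa>\<^sup>2) * (s3 * p2 - s2 * p3) in
     a * \<kappa>\<^sup>2 * ((cmod s2)\<^sup>2 + (cmod s3)\<^sup>2) + a * N * ((cmod (u$1))\<^sup>2 + (cmod x2)\<^sup>2 + (cmod x3)\<^sup>2)
     - a * (cmod (u$1 * cnj (y$1) + x2 * cnj q2 + x3 * cnj q3))\<^sup>2
     + (1 - a) * ((cmod \<sigma>)\<^sup>2 + 2 * (u$1 \<bullet> Z) + 2 * t * (\<sigma> \<bullet> Z) + t\<^sup>2 * (cmod Z)\<^sup>2)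
     - origin_form a u u * (2 * N + t\<^sup>2 * N\<^sup>2))"

lemma norm_ncoord_nonzero: "norm (ncoord \<kappa> y) \<noteq> 0"
  by (metis ncoord_nth(1) norm_eq_zero zero_index zero_neq_one)

lemma cmod_add_scaled: "(cmod (p + of_real r * q))\<^sup>2 = (cmod p)\<^sup>2 + 2 * r * (p \<bullet> q) + r\<^sup>2 * (cmod q)\<^sup>2"
  unfolding cmod_power2 inner_complex_def by (simp add: power2_eq_square algebra_simps)

lemma scaleR_nth: "(t *\<^sub>R y) $ m = of_real t * (y $ m)" for y :: "complex^'n"
  by (simp add: scaleR_conv_of_real[where 'a=complex])

lemma G_self: "G a z x x = (a * ((norm x)\<^sup>2 * (norm z)\<^sup>2 - (cmod (hip x z))\<^sup>2) + (1 - a) * (cmod (hip x (jq z)))\<^sup>2) / norm z ^ 4"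
  by (simp add: G_def power2_norm_eq_inner[symmetric] complex_norm_square[symmetric] flip: of_real_power)

text \<open>An exact identity rather than an asymptotic one, so that later only the continuity of
  \<open>remainder\<close> is required and no error term has to be estimated.\<close>

lemma chart_form_expand:
  assumes "a * \<kappa> = 1 - a"
  shows "(chart_form a \<kappa> (t *\<^sub>R y) u - origin_form a u u) * norm (ncoord \<kappa> (t *\<^sub>R y)) ^ 4 = t\<^sup>2 * remainder a \<kappa> t y u"
proof -
  define s2 s3 where s: "s2 = u$1 * cnj (y$3) + y$1 * cnj (u$3)" "s3 = - (u$1 * cnj (y$2) + y$1 * cnj (u$2))"
  define p2 p3 where p: "p2 = y$1 * cnj (y$3)" "p3 = - (y$1 * cnj (y$2))"
  define x2 x3 where x: "x2 = u$2 + of_real (\<kappa> * t) * s2" "x3 = u$3 + of_real (\<kappa> * t) * s3"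
  define q2 q3 where q: "q2 = y$2 + of_real (\<kappa> * t) * p2" "q3 = y$3 + of_real (\<kappa> * t) * p3"
  define N where "N = (cmod (y$1))\<^sup>2 + (cmod q2)\<^sup>2 + (cmod q3)\<^sup>2"
  define \<sigma> where "\<sigma> = u$3 * y$2 - u$2 * y$3"
  define Z where "Z = of_real \<kappa> * (u$3 * p2 - u$2 * p3 - s2 * y$3 + s3 * y$2) + of_real (t * \<kappa>\<^sup>2) * (s3 * p2 - s2 * p3)"
  define S where "S = (cmod s2)\<^sup>2 + (cmod s3)\<^sup>2"
  define X where "X = (cmod (u$1))\<^sup>2 + (cmod x2)\<^sup>2 + (cmod x3)\<^sup>2"
  define W where "W = u$1 * cnj (y$1) + x2 * cnj q2 + x3 * cnj q3"
  let ?e = "ncoord \<kappa> (t *\<^sub>R y)" and ?x = "dncoord \<kappa> (t *\<^sub>R y) u"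
  have e: "?e$1 = 1" "?e$2 = of_real t * y$1" "?e$3 = of_real t * q2" "?e$4 = of_real t * q3"
    by (simp_all add: q p scaleR_nth algebra_simps del: vector_scaleR_component)
  have xx: "?x$1 = 0" "?x$2 = u$1" "?x$3 = x2" "?x$4 = x3"
    by (simp_all add: x s scaleR_nth algebra_simps del: vector_scaleR_component)
  have ne: "(norm ?e)\<^sup>2 = 1 + t\<^sup>2 * N"
    unfolding norm_vec4 e N_def by (simp add: norm_mult power_mult_distrib algebra_simps)
  have nx: "(norm ?x)\<^sup>2 = X"
    unfolding norm_vec4 xx X_def by simp
  have hx: "(cmod (hip ?x ?e))\<^sup>2 = t\<^sup>2 * (cmod W)\<^sup>2"
  proof -
    have "hip ?x ?e = of_real t * W"
      unfolding hip_def sum_4 e xx W_def by (simp add: algebra_simps)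
    then show ?thesis by (simp add: norm_mult power_mult_distrib)
  qed
  have hje: "hip ?x (jq ?e) = u$1 + of_real t * (\<sigma> + of_real t * Z)"
    unfolding hip_def sum_4 jq_nth e xx unfolding x q \<sigma>_def Z_def by (simp add: algebra_simps power2_eq_square)
  have ir: "p \<bullet> (of_real r * q) = r * (p \<bullet> q)" for p q :: complex and r
    by (simp add: inner_complex_def algebra_simps)
  have hj: "(cmod (hip ?x (jq ?e)))\<^sup>2 = (cmod (u$1))\<^sup>2 + 2 * t * (u$1 \<bullet> \<sigma>) +
      t\<^sup>2 * ((cmod \<sigma>)\<^sup>2 + 2 * (u$1 \<bullet> Z) + 2 * t * (\<sigma> \<bullet> Z) + t\<^sup>2 * (cmod Z)\<^sup>2)"
    unfolding hje cmod_add_scaled inner_add_right ir by (simp add: algebra_simps power2_eq_square)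
  \<comment> \<open>This identity dictates the shape of \<open>ncoord\<close>: the correction
    contributes -2 a \<kappa> t times the inner product of the first coordinate of u with \<sigma>,
    and the \<open>D1\<close> part contributes the same with +2 (1 - a) t. They cancel precisely
    when a \<kappa> = 1 - a.\<close>
  have L: "u$2 \<bullet> s2 + u$3 \<bullet> s3 = - (u$1 \<bullet> \<sigma>)"
    unfolding s \<sigma>_def inner_complex_def by (simp add: algebra_simps)
  have "X = (cmod (u$1))\<^sup>2 + (cmod (u$2))\<^sup>2 + (cmod (u$3))\<^sup>2 + 2 * \<kappa> * t * (u$2 \<bullet> s2 + u$3 \<bullet> s3) + \<kappa>\<^sup>2 * t\<^sup>2 * S"
    unfolding X_def x cmod_add_scaled S_def by (simp add: algebra_simps power_mult_distrib)
  then have X: "X = (cmod (u$1))\<^sup>2 + (cmod (u$2))\<^sup>2 + (cmod (u$3))\<^sup>2 - 2 * \<kappa> * t * (u$1 \<bullet> \<sigma>) + \<kappa>\<^sup>2 * t\<^sup>2 * S"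
    unfolding L by simp
  have M: "remainder a \<kappa> t y u = a * \<kappa>\<^sup>2 * S + a * N * X - a * (cmod W)\<^sup>2 +
      (1 - a) * ((cmod \<sigma>)\<^sup>2 + 2 * (u$1 \<bullet> Z) + 2 * t * (\<sigma> \<bullet> Z) + t\<^sup>2 * (cmod Z)\<^sup>2) - origin_form a u u * (2 * N + t\<^sup>2 * N\<^sup>2)"
    unfolding remainder_def Let_def s[symmetric] p[symmetric] unfolding x[symmetric] q[symmetric]
    unfolding N_def[symmetric] \<sigma>_def[symmetric] Z_def[symmetric] S_def[symmetric] X_def[symmetric] W_def[symmetric] ..
  define T where "T = (cmod \<sigma>)\<^sup>2 + 2 * (u$1 \<bullet> Z) + 2 * t * (\<sigma> \<bullet> Z) + t\<^sup>2 * (cmod Z)\<^sup>2"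
  have n4: "norm ?e ^ 4 = (1 + t\<^sup>2 * N)\<^sup>2"
    unfolding ne[symmetric] by simp
  have "norm ?e ^ 4 \<noteq> 0" using norm_ncoord_nonzero by simp
  then have "chart_form a \<kappa> (t *\<^sub>R y) u * norm ?e ^ 4 = a * (X * (1 + t\<^sup>2 * N) - t\<^sup>2 * (cmod W)\<^sup>2) +
      (1 - a) * ((cmod (u$1))\<^sup>2 + 2 * t * (u$1 \<bullet> \<sigma>) + t\<^sup>2 * T)"
    unfolding chart_form_def G_self ne nx hx hj T_def by simp
  moreover have "a * X = origin_form a u u - (1 - a) * (cmod (u$1))\<^sup>2 - 2 * (1 - a) * t * (u$1 \<bullet> \<sigma>) + a * \<kappa>\<^sup>2 * t\<^sup>2 * S"
  proof -
    have "origin_form a u u = a * ((cmod (u$1))\<^sup>2 + (cmod (u$2))\<^sup>2 + (cmod (u$3))\<^sup>2) + (1 - a) * (cmod (u$1))\<^sup>2"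
      by (simp add: origin_form_self algebra_simps)
    then show ?thesis
      unfolding X assms[symmetric] by (simp add: algebra_simps)
  qed
  ultimately show ?thesis
    unfolding M T_def[symmetric] left_diff_distrib n4 by (simp add: algebra_simps power2_eq_square)
qed

lemma remainder_tendsto:
  assumes "(\<tau> \<longlongrightarrow> t) F" "(Y \<longlongrightarrow> y) F" "(X \<longlongrightarrow> u) F"
  shows "((\<lambda>s. remainder a \<kappa> (\<tau> s) (Y s) (X s)) \<longlongrightarrow> remainder a \<kappa> t y u) F"
  unfolding remainder_def Let_def origin_form_def by (intro tendsto_intros assms)

locale normal_chart = fixed_chart +
  assumes a: "a > 0" and \<kappa>: "a * \<kappa> = 1 - a"
begin

text \<open>The isometry equates the chart forms at t v and at its image; subtracting the two exact
  expansions and dividing by \<open>t\<^sup>2\<close> leaves a difference of remainders that is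
  continuous at t = 0.\<close>

lemma origin_form_limit:
  "((\<lambda>t. (origin_form a (fd f (t *\<^sub>R v) u) (fd f (t *\<^sub>R v) u) - origin_form a u u) / t\<^sup>2) \<longlongrightarrow>
     remainder a \<kappa> 0 v u - remainder a \<kappa> 0 (fd f 0 v) (fd f 0 u)) (at 0)"
proof -
  let ?Y = "\<lambda>t. (1 / t) *\<^sub>R f (t *\<^sub>R v)" and ?X = "\<lambda>t. fd f (t *\<^sub>R v) u"
  have ray: "((\<lambda>t. t *\<^sub>R v) has_derivative (\<lambda>s. s *\<^sub>R v)) (at 0)"
    by (auto intro!: derivative_eq_intros)
  have f': "(f has_derivative fd f 0) (at (0 *\<^sub>R v))"
    using C_k_on_has_derivative[OF C_k_f V(2)] by simp
  have "((\<lambda>t. f (t *\<^sub>R v)) has_derivative (\<lambda>s. s *\<^sub>R fd f 0 v)) (at 0)"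
    using has_derivative_compose[OF ray f'] linear_scale[OF has_derivative_linear[OF f']] by simp
  then have vd: "((\<lambda>t. f (t *\<^sub>R v)) has_vector_derivative fd f 0 v) (at 0)"
    by (simp add: has_vector_derivative_def)
  have Y: "(?Y \<longlongrightarrow> fd f 0 v) (at 0)"
  proof (rule LIM_zero_cancel, rule tendsto_norm_zero_cancel)
    have "((\<lambda>t. norm (f (t *\<^sub>R v) - t *\<^sub>R fd f 0 v) / \<bar>t\<bar>) \<longlongrightarrow> 0) (at 0)"
      using vd by (simp add: has_vector_derivative_def has_derivative_iff_norm f_0)
    moreover have "eventually (\<lambda>t. norm (f (t *\<^sub>R v) - t *\<^sub>R fd f 0 v) / \<bar>t\<bar> = norm (?Y t - fd f 0 v)) (at 0)"
      unfolding eventually_at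
    proof (intro exI[of _ 1] conjI ballI impI)
      fix t :: real assume "t \<noteq> 0 \<and> dist t 0 < 1"
      then have "?Y t - fd f 0 v = (1 / t) *\<^sub>R (f (t *\<^sub>R v) - t *\<^sub>R fd f 0 v)"
        by (simp add: scaleR_diff_right)
      then show "norm (f (t *\<^sub>R v) - t *\<^sub>R fd f 0 v) / \<bar>t\<bar> = norm (?Y t - fd f 0 v)" by simp
    qed simp
    ultimately show "((\<lambda>t. norm (?Y t - fd f 0 v)) \<longlongrightarrow> 0) (at 0)"
      by (rule Lim_transform_eventually)
  qed
  have ray0: "((\<lambda>t. t *\<^sub>R v) \<longlongrightarrow> 0) (at 0)"
    using has_derivative_continuous[OF ray] by (simp add: continuous_within)
  have "C_k_on (Suc 0) V f" by (rule C_k_f)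
  then have "continuous_on V (\<lambda>y. fd f y u)" by simp
  then have "isCont (\<lambda>y. fd f y u) 0" using V continuous_on_eq_continuous_at by blast
  then have X: "(?X \<longlongrightarrow> fd f 0 u) (at 0)"
    by (rule isCont_tendsto_compose[OF _ ray0])
  have "continuous_on UNIV (ncoord \<kappa>)" using C_k_on_ncoord[of 0] by simp
  then have en0: "isCont (ncoord \<kappa>) 0" using continuous_on_eq_continuous_at by blast
  have e1: "((\<lambda>t. norm (ncoord \<kappa> (t *\<^sub>R v)) ^ 4) \<longlongrightarrow> norm (ncoord \<kappa> 0) ^ 4) (at 0)"
    by (intro tendsto_intros isCont_tendsto_compose[OF en0 ray0])
  have "isCont f 0" using has_derivative_continuous[OF f'] by simp
  from isCont_tendsto_compose[OF this ray0] have "((\<lambda>t. f (t *\<^sub>R v)) \<longlongrightarrow> 0) (at 0)" by (simp add: f_0)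
  then have e2: "((\<lambda>t. norm (ncoord \<kappa> (f (t *\<^sub>R v))) ^ 4) \<longlongrightarrow> norm (ncoord \<kappa> 0) ^ 4) (at 0)"
    by (intro tendsto_intros isCont_tendsto_compose[OF en0])
  have nz: "norm (ncoord \<kappa> y) ^ 4 \<noteq> 0" for y using norm_ncoord_nonzero by simp
  have "((\<lambda>t. remainder a \<kappa> t v u / norm (ncoord \<kappa> (t *\<^sub>R v)) ^ 4 - remainder a \<kappa> t (?Y t) (?X t) / norm (ncoord \<kappa> (f (t *\<^sub>R v))) ^ 4) \<longlongrightarrow>
     remainder a \<kappa> 0 v u / norm (ncoord \<kappa> 0) ^ 4 - remainder a \<kappa> 0 (fd f 0 v) (fd f 0 u) / norm (ncoord \<kappa> 0) ^ 4) (at 0)"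
    by (intro tendsto_diff tendsto_divide remainder_tendsto e1 e2 X Y nz tendsto_ident_at tendsto_const)
  moreover have "eventually (\<lambda>t. remainder a \<kappa> t v u / norm (ncoord \<kappa> (t *\<^sub>R v)) ^ 4 - remainder a \<kappa> t (?Y t) (?X t) / norm (ncoord \<kappa> (f (t *\<^sub>R v))) ^ 4
      = (origin_form a (?X t) (?X t) - origin_form a u u) / t\<^sup>2) (at 0)"
  proof -
    have "eventually (\<lambda>t. t *\<^sub>R v \<in> V) (at 0)" using topological_tendstoD[OF ray0 V] .
    moreover have "eventually (\<lambda>t. t \<noteq> 0) (at (0::real))" by (auto simp: eventually_at intro!: exI[of _ 1])
    ultimately show ?thesis
    proof eventually_elim
      case (elim t)
      \<comment> \<open>The image point is written as t times a difference quotient that converges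
        to the differential, so the same expansion applies there with the same t.\<close>
      have f: "t *\<^sub>R ?Y t = f (t *\<^sub>R v)" using elim by simp
      have "chart_form a \<kappa> (t *\<^sub>R v) u - origin_form a u u = t\<^sup>2 * (remainder a \<kappa> t v u / norm (ncoord \<kappa> (t *\<^sub>R v)) ^ 4)"
        using chart_form_expand[OF \<kappa>, of t v u] nz by (simp add: field_simps)
      moreover have "chart_form a \<kappa> (f (t *\<^sub>R v)) (?X t) - origin_form a (?X t) (?X t) = t\<^sup>2 * (remainder a \<kappa> t (?Y t) (?X t) / norm (ncoord \<kappa> (f (t *\<^sub>R v))) ^ 4)"
        using chart_form_expand[OF \<kappa>, of t "?Y t" "?X t"] nz unfolding f by (simp add: field_simps)
      moreover have "chart_form a \<kappa> (f (t *\<^sub>R v)) (?X t) = chart_form a \<kappa> (t *\<^sub>R v) u" using chart_form_f elim by blast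
      ultimately have "origin_form a (?X t) (?X t) - origin_form a u u = t\<^sup>2 * (remainder a \<kappa> t v u / norm (ncoord \<kappa> (t *\<^sub>R v)) ^ 4 - remainder a \<kappa> t (?Y t) (?X t) / norm (ncoord \<kappa> (f (t *\<^sub>R v))) ^ 4)"
        by (simp only: right_diff_distrib)
      then show ?case using elim by simp
    qed
  qed
  ultimately have "((\<lambda>t. (origin_form a (?X t) (?X t) - origin_form a u u) / t\<^sup>2) \<longlongrightarrow>
     remainder a \<kappa> 0 v u / norm (ncoord \<kappa> 0) ^ 4 - remainder a \<kappa> 0 (fd f 0 v) (fd f 0 u) / norm (ncoord \<kappa> 0) ^ 4) (at 0)"
    by (rule Lim_transform_eventually)
  then show ?thesis by simp
qed

lemmas jets = V C_k_f origin_form_bilinear origin_form_commute origin_form_pos[OF a] origin_form_limit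

lemma isometric: "origin_form a (fd f 0 u) (fd f 0 v) = origin_form a u v"
  by (rule jets_isometric[OF jets])

lemma surj: "surj (fd f 0)"
  by (rule jets_surj[OF jets])

lemma second_zero: "fd (\<lambda>y. fd f y u) 0 v = 0"
  by (rule jets_second[OF jets])

lemma linear: "linear (fd f 0)"
  using C_k_on_has_derivative[OF C_k_f V(2)] has_derivative_linear by blast

lemma curv_preserved: "curv (remainder a \<kappa> 0) (fd f 0 u) (fd f 0 v) = curv (remainder a \<kappa> 0) u v"
proof -
  obtain c where "\<And>v u s. linear (\<lambda>w. c w v u s)" "\<And>w v u. linear (c w v u)"
    "\<And>w v u s. c w v u s = c v w u s" "\<And>w v u s. c w v u s = c w u v s"
    "\<And>v u. remainder a \<kappa> 0 v u - remainder a \<kappa> 0 (fd f 0 v) (fd f 0 u) = c v v u u"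
    using jets_third[OF jets] by blast
  from curv_invariant[where c = c and Q = "remainder a \<kappa> 0" and A = "fd f 0", OF this linear] show ?thesis .
qed

end

section \<open>The curvature at the origin\<close>

definition quad_coeff :: "real \<Rightarrow> complex^3 \<Rightarrow> complex^3 \<Rightarrow> real" where
  "quad_coeff \<kappa> y u =
    \<kappa>\<^sup>2 * ((cmod (u$1 * cnj (y$3) + y$1 * cnj (u$3)))\<^sup>2 + (cmod (u$1 * cnj (y$2) + y$1 * cnj (u$2)))\<^sup>2)
    + ((cmod (y$1))\<^sup>2 + (cmod (y$2))\<^sup>2 + (cmod (y$3))\<^sup>2) * ((cmod (u$1))\<^sup>2 + (cmod (u$2))\<^sup>2 + (cmod (u$3))\<^sup>2)
    - (cmod (u$1 * cnj (y$1) + u$2 * cnj (y$2) + u$3 * cnj (y$3)))\<^sup>2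
    + \<kappa> * ((cmod (u$3 * y$2 - u$2 * y$3))\<^sup>2 + 2 * \<kappa> * (u$1 \<bullet>
        (u$3 * (y$1 * cnj (y$3)) + u$2 * (y$1 * cnj (y$2)) - (u$1 * cnj (y$3) + y$1 * cnj (u$3)) * y$3
          - (u$1 * cnj (y$2) + y$1 * cnj (u$2)) * y$2)))
    - 2 * ((1 + \<kappa>) * (cmod (u$1))\<^sup>2 + (cmod (u$2))\<^sup>2 + (cmod (u$3))\<^sup>2) * ((cmod (y$1))\<^sup>2 + (cmod (y$2))\<^sup>2 + (cmod (y$3))\<^sup>2)"

text \<open>Replacing 1 - a by a \<kappa> pulls a factor a out of every coefficient and leaves
  \<kappa> as the only parameter.\<close>

lemma remainder_eq_quad_coeff:
  assumes "a * \<kappa> = 1 - a"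
  shows "remainder a \<kappa> 0 y u = a * quad_coeff \<kappa> y u"
proof -
  have b: "origin_form a u u = a * ((1 + \<kappa>) * (cmod (u$1))\<^sup>2 + (cmod (u$2))\<^sup>2 + (cmod (u$3))\<^sup>2)"
  proof -
    have "a * ((1 + \<kappa>) * (cmod (u$1))\<^sup>2 + (cmod (u$2))\<^sup>2 + (cmod (u$3))\<^sup>2) =
      (a + a * \<kappa>) * (cmod (u$1))\<^sup>2 + a * ((cmod (u$2))\<^sup>2 + (cmod (u$3))\<^sup>2)"
      by (simp add: algebra_simps)
    then show ?thesis using assms by (simp add: origin_form_self)
  qed
  have ir: "p \<bullet> (of_real r * q) = r * (p \<bullet> q)" for p q :: complex and r
    by (simp add: inner_complex_def algebra_simps)
  have m: "(cmod (- p))\<^sup>2 = (cmod p)\<^sup>2" for p by simp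
  show ?thesis
    unfolding remainder_def Let_def b quad_coeff_def assms[symmetric] mult_zero_right mult_zero_left of_real_0 add_0_right m ir
    by (simp add: algebra_simps)
qed

lemma curv_linear:
  "curv (\<lambda>y u. P y u + Q y u) u v = curv P u v + curv Q u v"
  "curv (\<lambda>y u. P y u - Q y u) u v = curv P u v - curv Q u v"
  "curv (\<lambda>y u. c * Q y u) u v = c * curv Q u v"
  by (simp_all add: curv_def algebra_simps add_divide_distrib diff_divide_distrib)

text \<open>First of three polarization rules, for squares of symmetric forms, products of two
  antisymmetric forms and products of a quadratic form in y with one in u; \<open>quad_coeff\<close>
  is a combination of these types.\<close>

lemma curv_symmetric:
  fixes s :: "'a::real_vector \<Rightarrow> 'a \<Rightarrow> 'b::real_inner"
  assumes "\<And>x y z. s (x + y) z = s x z + s y z" "\<And>x y z. s (x - y) z = s x z - s y z" "\<And>x y. s x y = s y x"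
  shows "curv (\<lambda>y u. (norm (s y u))\<^sup>2) u v = 2 * (s u u \<bullet> s v v) - 2 * (norm (s u v))\<^sup>2"
proof -
  have r: "s x (y + z) = s x y + s x z" "s x (y - z) = s x y - s x z" for x y z
    using assms by metis+
  have "s v u = s u v" by (rule assms(3))
  then show ?thesis
    unfolding curv_def power2_norm_eq_inner assms(1,2) r
    by (simp add: inner_add_left inner_add_right inner_diff_left inner_diff_right inner_commute[of "s v v" "s u v"]
      inner_commute[of "s v v" "s u u"] inner_commute[of "s u v" "s u u"] field_simps)
qed

lemma curv_antisymmetric:
  fixes b c :: "'a::real_vector \<Rightarrow> 'a \<Rightarrow> real"
  assumes "\<And>x y z. b (x + y) z = b x z + b y z" "\<And>x y z. b (x - y) z = b x z - b y z" "\<And>x y. b x y = - b y x"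
    and "\<And>x y z. c (x + y) z = c x z + c y z" "\<And>x y z. c (x - y) z = c x z - c y z" "\<And>x y. c x y = - c y x"
  shows "curv (\<lambda>y u. b y u * c y u) u v = - 6 * (b u v * c u v)"
proof -
  have r: "b x (y + z) = b x y + b x z" "b x (y - z) = b x y - b x z"
    "c x (y + z) = c x y + c x z" "c x (y - z) = c x y - c x z" for x y z
    using assms(3)[of x] assms(6)[of x] by (simp_all add: assms(1,2,4,5))
  have z: "b x x = 0" "c x x = 0" for x using assms(3)[of x x] assms(6)[of x x] by auto
  show ?thesis
    unfolding curv_def assms(1,2,4,5) r z using assms(3)[of v u] assms(6)[of v u] by (simp add: field_simps)
qed

lemma curv_quadratic:
  fixes b c :: "'a::real_vector \<Rightarrow> 'a \<Rightarrow> real"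
  assumes "\<And>x y z. b (x + y) z = b x z + b y z" "\<And>x y z. b (x - y) z = b x z - b y z" "\<And>x y. b x y = b y x"
    and "\<And>x y z. c (x + y) z = c x z + c y z" "\<And>x y z. c (x - y) z = c x z - c y z" "\<And>x y. c x y = c y x"
  shows "curv (\<lambda>y u. b y y * c u u) u v = 4 * b u v * c u v - 2 * b v v * c u u - 2 * b u u * c v v"
proof -
  have r: "b x (y + z) = b x y + b x z" "b x (y - z) = b x y - b x z"
    "c x (y + z) = c x y + c x z" "c x (y - z) = c x y - c x z" for x y z
    using assms(3)[of x] assms(6)[of x] by (simp_all add: assms(1,2,4,5))
  show ?thesis
    unfolding curv_def assms(1,2,4,5) r using assms(3)[of v u] assms(6)[of v u] by (simp add: field_simps)
qed

text \<open>The building blocks are the symmetric forms \<open>s2\<close>, \<open>s3\<close> and the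
  inner product, the antisymmetric \<omega> (Kaehler form) and \<sigma> (bracket of the contact
  distribution), and squared lengths.\<close>

lemma curv_quad_coeff:
  "curv (quad_coeff \<kappa>) u v =
    \<kappa>\<^sup>2 * ((2 * ((2 * u$1 * cnj (u$3)) \<bullet> (2 * v$1 * cnj (v$3))) - 2 * (cmod (v$1 * cnj (u$3) + u$1 * cnj (v$3)))\<^sup>2) +
      (2 * ((2 * u$1 * cnj (u$2)) \<bullet> (2 * v$1 * cnj (v$2))) - 2 * (cmod (v$1 * cnj (u$2) + u$1 * cnj (v$2)))\<^sup>2))
    + (4 * (u \<bullet> v) * (u \<bullet> v) - 4 * (u \<bullet> u) * (v \<bullet> v))
    - (2 * (u \<bullet> u) * (v \<bullet> v) - 2 * (u \<bullet> v)\<^sup>2)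
    + 6 * (Im (v$1 * cnj (u$1) + v$2 * cnj (u$2) + v$3 * cnj (u$3)))\<^sup>2
    - 6 * \<kappa> * (cmod (v$3 * u$2 - v$2 * u$3))\<^sup>2
    - 2 * \<kappa>\<^sup>2 * (4 * (u$2 \<bullet> v$2 + u$3 \<bullet> v$3) * (u$1 \<bullet> v$1) - 2 * ((cmod (v$2))\<^sup>2 + (cmod (v$3))\<^sup>2) * (cmod (u$1))\<^sup>2
        - 2 * ((cmod (u$2))\<^sup>2 + (cmod (u$3))\<^sup>2) * (cmod (v$1))\<^sup>2)
    - 24 * \<kappa>\<^sup>2 * (Im (v$2 * cnj (u$2) + v$3 * cnj (u$3)) * Im (v$1 * cnj (u$1)))
    - 2 * (4 * (u \<bullet> v) * (u \<bullet> v + \<kappa> * (u$1 \<bullet> v$1)) - 2 * (v \<bullet> v) * (u \<bullet> u + \<kappa> * (cmod (u$1))\<^sup>2)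
        - 2 * (u \<bullet> u) * (v \<bullet> v + \<kappa> * (cmod (v$1))\<^sup>2))"
proof -
  define s2 s3 :: "complex^3 \<Rightarrow> complex^3 \<Rightarrow> complex"
    where s: "s2 y u = u$1 * cnj (y$3) + y$1 * cnj (u$3)" "s3 y u = u$1 * cnj (y$2) + y$1 * cnj (u$2)" for y u
  define b1 b2 :: "complex^3 \<Rightarrow> complex^3 \<Rightarrow> real"
    where b: "b1 y u = u$1 \<bullet> y$1" "b2 y u = u$2 \<bullet> y$2 + u$3 \<bullet> y$3" for y u
  define bb where bb: "bb y u = u \<bullet> y + \<kappa> * (u$1 \<bullet> y$1)" for y u :: "complex^3"
  define \<omega>1 \<omega>2 \<omega> :: "complex^3 \<Rightarrow> complex^3 \<Rightarrow> real"
    where \<omega>: "\<omega>1 y u = Im (u$1 * cnj (y$1))" "\<omega>2 y u = Im (u$2 * cnj (y$2) + u$3 * cnj (y$3))"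
      "\<omega> y u = Im (u$1 * cnj (y$1) + u$2 * cnj (y$2) + u$3 * cnj (y$3))" for y u
  define \<sigma>1 \<sigma>2 :: "complex^3 \<Rightarrow> complex^3 \<Rightarrow> real"
    where \<sigma>: "\<sigma>1 y u = Re (u$3 * y$2 - u$2 * y$3)" "\<sigma>2 y u = Im (u$3 * y$2 - u$2 * y$3)" for y u
  note d = s b bb \<omega> \<sigma>
  have cs: "curv (\<lambda>y u. (norm (s2 y u))\<^sup>2) u v = 2 * (s2 u u \<bullet> s2 v v) - 2 * (norm (s2 u v))\<^sup>2"
    "curv (\<lambda>y u. (norm (s3 y u))\<^sup>2) u v = 2 * (s3 u u \<bullet> s3 v v) - 2 * (norm (s3 u v))\<^sup>2"
    "curv (\<lambda>y u. (norm (u \<bullet> y))\<^sup>2) u v = 2 * ((u \<bullet> u) \<bullet> (v \<bullet> v)) - 2 * (norm (v \<bullet> u))\<^sup>2"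
    by (rule curv_symmetric; simp add: d algebra_simps inner_simps inner_commute)+
  have ca: "curv (\<lambda>y u. \<omega> y u * \<omega> y u) u v = - 6 * (\<omega> u v * \<omega> u v)"
    "curv (\<lambda>y u. \<sigma>1 y u * \<sigma>1 y u) u v = - 6 * (\<sigma>1 u v * \<sigma>1 u v)"
    "curv (\<lambda>y u. \<sigma>2 y u * \<sigma>2 y u) u v = - 6 * (\<sigma>2 u v * \<sigma>2 u v)"
    "curv (\<lambda>y u. \<omega>2 y u * \<omega>1 y u) u v = - 6 * (\<omega>2 u v * \<omega>1 u v)"
    by (rule curv_antisymmetric; simp add: d algebra_simps)+
  have cq: "curv (\<lambda>y u. b2 y y * b1 u u) u v = 4 * b2 u v * b1 u v - 2 * b2 v v * b1 u u - 2 * b2 u u * b1 v v"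
    "curv (\<lambda>y u. (y \<bullet> y) * (u \<bullet> u)) u v = 4 * (u \<bullet> v) * (u \<bullet> v) - 2 * (v \<bullet> v) * (u \<bullet> u) - 2 * (u \<bullet> u) * (v \<bullet> v)"
    "curv (\<lambda>y u. (y \<bullet> y) * bb u u) u v = 4 * (u \<bullet> v) * bb u v - 2 * (v \<bullet> v) * bb u u - 2 * (u \<bullet> u) * bb v v"
    by (rule curv_quadratic; simp add: d algebra_simps inner_simps inner_commute)+
  have "quad_coeff \<kappa> = (\<lambda>y u. \<kappa>\<^sup>2 * ((norm (s2 y u))\<^sup>2 + (norm (s3 y u))\<^sup>2) + (y \<bullet> y) * (u \<bullet> u) - (norm (u \<bullet> y))\<^sup>2 - \<omega> y u * \<omega> y u
     + \<kappa> * (\<sigma>1 y u * \<sigma>1 y u + \<sigma>2 y u * \<sigma>2 y u) - (2 * \<kappa>\<^sup>2) * (b2 y y * b1 u u) + (4 * \<kappa>\<^sup>2) * (\<omega>2 y u * \<omega>1 y u)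
     - 2 * ((y \<bullet> y) * bb u u))"
    (is "_ = ?R")
  proof (intro ext)
    fix y u :: "complex^3"
    have n: "(cmod (y$1))\<^sup>2 + (cmod (y$2))\<^sup>2 + (cmod (y$3))\<^sup>2 = y \<bullet> y" for y :: "complex^3"
      by (simp add: power2_norm_eq_inner inner_vec_def sum_3)
    have W: "(cmod (u$1 * cnj (y$1) + u$2 * cnj (y$2) + u$3 * cnj (y$3)))\<^sup>2 = (norm (u \<bullet> y))\<^sup>2 + \<omega> y u * \<omega> y u"
    proof -
      have "Re (u$1 * cnj (y$1) + u$2 * cnj (y$2) + u$3 * cnj (y$3)) = u \<bullet> y"
        by (simp add: inner_vec_def sum_3 inner_complex_def)
      then show ?thesis unfolding cmod_power2 \<omega> by (simp add: power2_eq_square)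
    qed
    have S: "(cmod (u$3 * y$2 - u$2 * y$3))\<^sup>2 = \<sigma>1 y u * \<sigma>1 y u + \<sigma>2 y u * \<sigma>2 y u"
      unfolding cmod_power2 \<sigma> by (simp add: power2_eq_square)
    \<comment> \<open>The only cross term of \<open>quad_coeff\<close> that is not visibly a square
      splits into one product of lengths and one product of antisymmetric forms.\<close>
    have D: "u$1 \<bullet> (u$3 * (y$1 * cnj (y$3)) + u$2 * (y$1 * cnj (y$2)) - (u$1 * cnj (y$3) + y$1 * cnj (u$3)) * y$3
          - (u$1 * cnj (y$2) + y$1 * cnj (u$2)) * y$2) = - (b2 y y * b1 u u) + 2 * (\<omega>2 y u * \<omega>1 y u)"
      unfolding d inner_complex_def by (simp add: algebra_simps)
    have B: "(1 + \<kappa>) * (cmod (u$1))\<^sup>2 + (cmod (u$2))\<^sup>2 + (cmod (u$3))\<^sup>2 = bb u u"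
      unfolding bb n[symmetric] by (simp add: power2_norm_eq_inner[symmetric] algebra_simps)
    show "quad_coeff \<kappa> y u = ?R y u"
      unfolding quad_coeff_def n W S D B s by (simp add: algebra_simps power2_eq_square)
  qed
  then have "curv (quad_coeff \<kappa>) u v = curv ?R u v" by (rule arg_cong)
  also have "\<dots> = \<kappa>\<^sup>2 * ((2 * (s2 u u \<bullet> s2 v v) - 2 * (norm (s2 u v))\<^sup>2) + (2 * (s3 u u \<bullet> s3 v v) - 2 * (norm (s3 u v))\<^sup>2))
     + (4 * (u \<bullet> v) * (u \<bullet> v) - 2 * (v \<bullet> v) * (u \<bullet> u) - 2 * (u \<bullet> u) * (v \<bullet> v))
     - (2 * ((u \<bullet> u) \<bullet> (v \<bullet> v)) - 2 * (norm (v \<bullet> u))\<^sup>2) - (- 6 * (\<omega> u v * \<omega> u v))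
     + \<kappa> * (- 6 * (\<sigma>1 u v * \<sigma>1 u v) + - 6 * (\<sigma>2 u v * \<sigma>2 u v))
     - (2 * \<kappa>\<^sup>2) * (4 * b2 u v * b1 u v - 2 * b2 v v * b1 u u - 2 * b2 u u * b1 v v)
     + (4 * \<kappa>\<^sup>2) * (- 6 * (\<omega>2 u v * \<omega>1 u v))
     - 2 * (4 * (u \<bullet> v) * bb u v - 2 * (v \<bullet> v) * bb u u - 2 * (u \<bullet> u) * bb v v)"
    unfolding curv_linear cs ca cq ..
  finally have E: "curv (quad_coeff \<kappa>) u v = \<dots>" .
  have S: "(cmod (v$3 * u$2 - v$2 * u$3))\<^sup>2 = \<sigma>1 u v * \<sigma>1 u v + \<sigma>2 u v * \<sigma>2 u v"
    unfolding cmod_power2 \<sigma> by (simp add: power2_eq_square)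
  have ss: "s2 x x = 2 * x$1 * cnj (x$3)" "s3 x x = 2 * x$1 * cnj (x$2)" for x
    by (simp_all add: s)
  show ?thesis
    unfolding E S ss unfolding s b bb \<omega> power2_norm_eq_inner inner_real_def inner_commute[of "v$_" "u$_"] inner_commute[of v u]
    by (simp add: algebra_simps power2_eq_square)
qed

lemma inner3: "u \<bullet> v = u$1 \<bullet> v$1 + u$2 \<bullet> v$2 + u$3 \<bullet> v$3" for u v :: "complex^3"
  by (simp add: inner_vec_def sum_3)

definition wedge :: "real \<Rightarrow> complex^3 \<Rightarrow> complex^3 \<Rightarrow> real" where
  "wedge a u v = origin_form a u u * origin_form a v v - (origin_form a u v)\<^sup>2"

text \<open>Two kinds of planes contribute: the first term reflects curvature 4 in the
  \<open>D1\<close> plane, the second curvature 1 / \<open>a\<^sup>2\<close> for planes with one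
  vector in \<open>D1\<close> and one in \<open>D2\<close>.\<close>

lemma curv_vertical:
  assumes "u$2 = 0" "u$3 = 0"
  shows "curv (quad_coeff \<kappa>) u v = (1 + \<kappa>) * (8 * (Im (cnj (u$1) * v$1))\<^sup>2 + 2 * (1 + \<kappa>) * (cmod (u$1))\<^sup>2 * ((cmod (v$2))\<^sup>2 + (cmod (v$3))\<^sup>2))"
  unfolding curv_quad_coeff inner3 assms cmod_power2 inner_complex_def
  by (simp add: algebra_simps power2_eq_square)

text \<open>Here v is a complex multiple of j applied to the \<open>D2\<close> part of u. All
  Hermitian products of u and v vanish while the bracket attains its maximal modulus; this isolates
  a term proportional to \<kappa>.\<close>

lemma curv_horizontal:
  assumes "v$1 = 0" "v$2 = - \<mu> * cnj (u$3)" "v$3 = \<mu> * cnj (u$2)"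
  defines "X \<equiv> (cmod (u$2))\<^sup>2 + (cmod (u$3))\<^sup>2"
  shows "curv (quad_coeff \<kappa>) u v = - 8 * \<kappa> * (cmod \<mu>)\<^sup>2 * X\<^sup>2 + 2 * (1 + \<kappa>) * ((1 + \<kappa>) * (cmod (u$1))\<^sup>2 + X) * ((cmod \<mu>)\<^sup>2 * X)"
proof -
  have sq: "(cmod (v$2))\<^sup>2 = (cmod \<mu>)\<^sup>2 * (cmod (u$3))\<^sup>2" "(cmod (v$3))\<^sup>2 = (cmod \<mu>)\<^sup>2 * (cmod (u$2))\<^sup>2"
    unfolding assms by (simp_all add: norm_mult power_mult_distrib)
  have i0: "u$2 \<bullet> v$2 + u$3 \<bullet> v$3 = 0" "Im (v$2 * cnj (u$2) + v$3 * cnj (u$3)) = 0"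
    unfolding assms inner_complex_def by (simp_all add: algebra_simps)
  then have i1: "u \<bullet> v = 0" "Im (v$1 * cnj (u$1) + v$2 * cnj (u$2) + v$3 * cnj (u$3)) = 0"
    unfolding inner3 by (simp_all add: assms(1))
  have uu: "u \<bullet> u = (cmod (u$1))\<^sup>2 + X" unfolding inner3 X_def by (simp add: power2_norm_eq_inner)
  have vv: "v \<bullet> v = (cmod \<mu>)\<^sup>2 * X" unfolding inner3 power2_norm_eq_inner[symmetric] sq X_def
    by (simp add: assms(1) algebra_simps)
  have sv: "(cmod (v$2))\<^sup>2 + (cmod (v$3))\<^sup>2 = (cmod \<mu>)\<^sup>2 * X" unfolding sq X_def by (simp add: algebra_simps)
  have "v$3 * u$2 - v$2 * u$3 = \<mu> * of_real X"
    unfolding assms X_def of_real_add complex_norm_square by (simp add: algebra_simps)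
  then have \<sigma>: "(cmod (v$3 * u$2 - v$2 * u$3))\<^sup>2 = (cmod \<mu>)\<^sup>2 * X\<^sup>2"
    by (simp add: norm_mult power_mult_distrib)
  have s0: "(cmod (0 * cnj (u$3) + u$1 * cnj (v$3)))\<^sup>2 = (cmod (u$1))\<^sup>2 * ((cmod \<mu>)\<^sup>2 * (cmod (u$2))\<^sup>2)"
    "(cmod (0 * cnj (u$2) + u$1 * cnj (v$2)))\<^sup>2 = (cmod (u$1))\<^sup>2 * ((cmod \<mu>)\<^sup>2 * (cmod (u$3))\<^sup>2)"
    unfolding sq[symmetric] by (simp_all add: norm_mult power_mult_distrib)
  show ?thesis
    unfolding curv_quad_coeff i1 i0 uu vv \<sigma> sv unfolding assms(1) s0
    by (simp add: X_def algebra_simps power2_eq_square)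
qed

section \<open>The differential preserves the splitting into \<open>D1\<close> and
  \<open>D2\<close>\<close>

context normal_chart
begin

lemma A_linear: "fd f 0 (u + v) = fd f 0 u + fd f 0 v" "fd f 0 (r *\<^sub>R u) = r *\<^sub>R fd f 0 u"
  using linear by (simp_all add: linear_add linear_scale)

text \<open>The coefficient is tuned to cancel the mixed term of \<open>curv_vertical\<close>: with
  1 + \<kappa> = 1 / a and the factor a between \<open>quad_coeff\<close> and the metric, it amounts
  to subtracting curvature 1 / \<open>a\<^sup>2\<close> from twice the curvature form.\<close>

lemma reduced_curvature_preserved:
  "curv (quad_coeff \<kappa>) (fd f 0 u) (fd f 0 v) - 2 * (1 + \<kappa>) / a\<^sup>2 * wedge a (fd f 0 u) (fd f 0 v) =
   curv (quad_coeff \<kappa>) u v - 2 * (1 + \<kappa>) / a\<^sup>2 * wedge a u v"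
proof -
  have "remainder a \<kappa> 0 = (\<lambda>y u. a * quad_coeff \<kappa> y u)"
    by (intro ext remainder_eq_quad_coeff \<kappa>)
  then have "curv (remainder a \<kappa> 0) u v = a * curv (quad_coeff \<kappa>) u v" for u v
    by (simp only: curv_linear(3))
  then have "a * curv (quad_coeff \<kappa>) (fd f 0 u) (fd f 0 v) = a * curv (quad_coeff \<kappa>) u v"
    using curv_preserved[of u v] by metis
  then show ?thesis using a by (simp add: wedge_def isometric)
qed

text \<open>For \<open>u\<close> tangent to the fibre the reduced form vanishes on a hyperplane, whereas for a vector \<open>x\<close> with
  a component across the fibre it is definite on the plane of the \<open>\<mu> j x\<close>, unless \<open>a = 1\<close>.\<close>

lemma vertical_preserved:
  assumes "a \<noteq> 1" and u: "u$2 = 0" "u$3 = 0"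
  shows "fd f 0 u $ 2 = 0 \<and> fd f 0 u $ 3 = 0"
proof -
  define x where "x = fd f 0 u"
  define X where "X = (cmod (x$2))\<^sup>2 + (cmod (x$3))\<^sup>2"
  define jx :: "complex \<Rightarrow> complex^3" where "jx \<mu> = vector [0, - \<mu> * cnj (x$3), \<mu> * cnj (x$2)]" for \<mu>
  have k1: "a * (1 + \<kappa>) = 1" using \<kappa> by (simp add: algebra_simps)
  have k0: "\<kappa> \<noteq> 0" using \<kappa> assms(1) by auto
  have ka: "1 + \<kappa> = 1 / a" using k1 a by (simp add: field_simps)
  obtain v1 v2 where v: "fd f 0 v1 = jx 1" "fd f 0 v2 = jx \<i>" using surj by (metis surjD)
  define m where "m v = Im (cnj (u$1) * v$1)" for v :: "complex^3"
  \<comment> \<open>The vectors \<open>jx \<mu>\<close> fill a real plane, so the hyperplane on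
    which the reduced form of u vanishes pulls back to at least a line of \<mu>; a nonzero element
    of it is picked.\<close>
  obtain r s :: real where rs: "r \<noteq> 0 \<or> s \<noteq> 0" "r * m v1 + s * m v2 = 0"
  proof (cases "m v1 = 0 \<and> m v2 = 0")
    case True
    then show ?thesis using that[of 1 0] by simp
  next
    case False
    then show ?thesis using that[of "m v2" "- m v1"] by auto
  qed
  define v where "v = r *\<^sub>R v1 + s *\<^sub>R v2"
  define \<mu> where "\<mu> = Complex r s"
  have Av: "fd f 0 v = jx \<mu>"
    unfolding v_def A_linear v by (simp add: jx_def \<mu>_def vec3_eq_iff complex_eq_iff algebra_simps)
  have "m v = 0"
    using rs(2) by (simp add: m_def v_def algebra_simps)
  then have M: "Im (cnj (u$1) * v$1) = 0" by (simp add: m_def)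
  have V: "curv (quad_coeff \<kappa>) u v - 2 * (1 + \<kappa>) / a\<^sup>2 * wedge a u v = 0"
  proof -
    have "origin_form a u v = u$1 \<bullet> v$1" by (simp add: origin_form_def u)
    moreover have "(cmod (u$1))\<^sup>2 * (cmod (v$1))\<^sup>2 = (u$1 \<bullet> v$1)\<^sup>2 + (Im (cnj (u$1) * v$1))\<^sup>2"
      unfolding cmod_power2 inner_complex_def by (simp add: algebra_simps power2_eq_square)
    ultimately have "wedge a u v = a * (cmod (u$1))\<^sup>2 * ((cmod (v$2))\<^sup>2 + (cmod (v$3))\<^sup>2)"
      unfolding wedge_def origin_form_self u M by (simp add: algebra_simps)
    then show ?thesis
      unfolding curv_vertical[OF u] M ka using a by (simp add: field_simps power2_eq_square)
  qed
  have H: "curv (quad_coeff \<kappa>) x (jx \<mu>) - 2 * (1 + \<kappa>) / a\<^sup>2 * wedge a x (jx \<mu>) = - 8 * \<kappa> * (cmod \<mu>)\<^sup>2 * X\<^sup>2"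
  proof -
    have j: "jx \<mu> $ 1 = 0" "jx \<mu> $ 2 = - \<mu> * cnj (x$3)" "jx \<mu> $ 3 = \<mu> * cnj (x$2)" by (simp_all add: jx_def)
    have "origin_form a x (jx \<mu>) = 0"
      unfolding origin_form_def j inner_complex_def by (simp add: algebra_simps)
    then have "wedge a x (jx \<mu>) = ((cmod (x$1))\<^sup>2 + a * X) * (a * ((cmod \<mu>)\<^sup>2 * X))"
      unfolding wedge_def origin_form_self j X_def by (simp add: norm_mult power_mult_distrib algebra_simps)
    then show ?thesis
      unfolding curv_horizontal[OF j] X_def[symmetric] ka using a by (simp add: field_simps power2_eq_square)
  qed
  have "\<kappa> * (cmod \<mu>)\<^sup>2 * X\<^sup>2 = 0"
    using reduced_curvature_preserved[of u v] unfolding V Av x_def[symmetric] H by simp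
  moreover have "\<mu> \<noteq> 0" using rs(1) by (auto simp: \<mu>_def complex_eq_iff)
  ultimately have "X = 0" using k0 by simp
  then show ?thesis unfolding X_def x_def by (simp add: add_nonneg_eq_0_iff)
qed

text \<open>The \<open>D1\<close> plane is mapped onto itself isometrically, so its orthogonal
  complement is preserved as well, and only the \<open>D1\<close> part of u reaches the first
  coordinate.\<close>

lemma cmod_first_preserved:
  assumes "a \<noteq> 1"
  shows "cmod (fd f 0 u $ 1) = cmod (u$1)"
proof -
  have split: "origin_form a w w = (cmod (w$1))\<^sup>2" if "w$2 = 0" "w$3 = 0" for w using that by (simp add: origin_form_self)
  define h :: "complex^3" where "h = vector [0, u$2, u$3]"
  define v :: "complex \<Rightarrow> complex^3" where "v c = vector [c, 0, 0]" for c
  have vv: "fd f 0 (v c) $ 2 = 0" "fd f 0 (v c) $ 3 = 0" for c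
    using vertical_preserved[OF assms, of "v c"] by (simp_all add: v_def)
  have cv: "cmod (fd f 0 (v c) $ 1) = cmod c" for c
  proof -
    have "(cmod (fd f 0 (v c) $ 1))\<^sup>2 = (cmod c)\<^sup>2"
      using isometric[of "v c" "v c"] split[OF vv] split[of "v c"] by (simp add: v_def)
    then show ?thesis by simp
  qed
  have l: "Real_Vector_Spaces.linear (\<lambda>c. fd f 0 (v c) $ 1)"
  proof (rule linearI)
    fix c d r
    have "v (c + d) = v c + v d" "v (r *\<^sub>R c) = r *\<^sub>R v c" by (simp_all add: v_def vec3_eq_iff)
    then show "fd f 0 (v (c + d)) $ 1 = fd f 0 (v c) $ 1 + fd f 0 (v d) $ 1"
      "fd f 0 (v (r *\<^sub>R c)) $ 1 = r *\<^sub>R fd f 0 (v c) $ 1" by (simp_all add: A_linear)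
  qed
  have "c = 0" if "fd f 0 (v c) $ 1 = 0" for c
    using cv[of c] that by simp
  then have "inj (\<lambda>c. fd f 0 (v c) $ 1)" using linear_injective_0[OF l] by blast
  then have "range (\<lambda>c. fd f 0 (v c) $ 1) = UNIV"
    using linear_injective_imp_surjective[OF l] by simp
  \<comment> \<open>A \<open>D1\<close> vector with the same first coordinate as the image of h: its
    orthogonality to h then says that this coordinate has square zero.\<close>
  from surjD[OF this, of "fd f 0 h $ 1"] obtain c where c: "fd f 0 (v c) $ 1 = fd f 0 h $ 1"
    by auto
  have "origin_form a h (v c) = 0" by (simp add: origin_form_def h_def v_def)
  then have "origin_form a (fd f 0 h) (fd f 0 (v c)) = 0" by (simp add: isometric)
  then have h0: "fd f 0 h $ 1 = 0" by (simp add: origin_form_def vv c)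
  have "u = v (u$1) + h" by (simp add: v_def h_def vec3_eq_iff)
  then have "fd f 0 u $ 1 = fd f 0 (v (u$1)) $ 1 + fd f 0 h $ 1" by (metis A_linear(1) vector_add_component)
  then show ?thesis using h0 cv by simp
qed

lemma fd_F_linear: "Real_Vector_Spaces.linear (fd F e1)"
  using F_has_derivative[OF e1(1)] has_derivative_linear by blast

lemma G_e1: "G c e1 x x = origin_form c (drop_coord 1 x) (drop_coord 1 x)"
proof -
  have "hip x e1 = x$1" "hip x (jq e1) = x$2" by (simp_all add: hip_def sum_4 axis_def)
  then show ?thesis
    by (simp add: G_self norm_vec4 origin_form_self drop_coord_def algebra_simps)
qed

text \<open>The fibre direction has length zero for \<open>G a\<close>, so positivity of
  \<open>origin_form\<close> forces its image into the fibre direction; hence the differential of F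
  descends to that of f.\<close>

lemma drop_coord_fd_F: "drop_coord 1 (fd F e1 x) = fd f 0 (drop_coord 1 x)"
proof -
  have "G a e1 (fd F e1 (x$1 *s e1)) (fd F e1 (x$1 *s e1)) = G a e1 (x$1 *s e1) (x$1 *s e1)"
    using F_iso[OF e1(1)] e1(2) by metis
  then have "origin_form a (drop_coord 1 (fd F e1 (x$1 *s e1))) (drop_coord 1 (fd F e1 (x$1 *s e1))) = 0"
    unfolding G_e1 by (simp add: origin_form_def)
  then have z: "drop_coord 1 (fd F e1 (x$1 *s e1)) = 0"
    using origin_form_pos[OF a] by (metis less_irrefl)
  have "x = embed_coord 1 (drop_coord 1 x) + x$1 *s e1"
    by (simp add: embed_coord_drop vec_eq_iff axis_def)
  then have "fd F e1 x = fd F e1 (embed_coord 1 (drop_coord 1 x)) + fd F e1 (x$1 *s e1)"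
    by (metis linear_add[OF fd_F_linear])
  then show ?thesis by (simp add: fd_f_0 z)
qed

text \<open>The lengths of the \<open>D1\<close> and \<open>D2\<close> parts are preserved
  separately, hence so is every combination, whatever the sign of the weight c.\<close>

lemma all_metrics_preserved:
  assumes "a \<noteq> 1"
  shows "G c e1 (fd F e1 x) (fd F e1 x) = G c e1 x x"
proof -
  let ?u = "drop_coord 1 x"
  have 1: "(cmod (fd f 0 ?u $ 1))\<^sup>2 = (cmod (?u $ 1))\<^sup>2" using cmod_first_preserved[OF assms] by simp
  have "origin_form a (fd f 0 ?u) (fd f 0 ?u) = origin_form a ?u ?u" by (rule isometric)
  then have "(cmod (fd f 0 ?u $ 2))\<^sup>2 + (cmod (fd f 0 ?u $ 3))\<^sup>2 = (cmod (?u $ 2))\<^sup>2 + (cmod (?u $ 3))\<^sup>2"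
    using a 1 by (simp add: origin_form_self)
  with 1 show ?thesis unfolding G_e1 drop_coord_fd_F origin_form_self by simp
qed

end

section \<open>The group \<open>Sp(2)\<close>\<close>

text \<open>Laplace expansion along the first two columns; for a matrix commuting with j these form
  a quaternionic pair.\<close>

lemma det_4:
  "det (A::'a::comm_ring_1^4^4) =
    (A$1$1 * A$2$2 - A$1$2 * A$2$1) * (A$3$3 * A$4$4 - A$3$4 * A$4$3) -
    (A$1$1 * A$3$2 - A$1$2 * A$3$1) * (A$2$3 * A$4$4 - A$2$4 * A$4$3) +
    (A$1$1 * A$4$2 - A$1$2 * A$4$1) * (A$2$3 * A$3$4 - A$2$4 * A$3$3) +
    (A$2$1 * A$3$2 - A$2$2 * A$3$1) * (A$1$3 * A$4$4 - A$1$4 * A$4$3) -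
    (A$2$1 * A$4$2 - A$2$2 * A$4$1) * (A$1$3 * A$3$4 - A$1$4 * A$3$3) +
    (A$3$1 * A$4$2 - A$3$2 * A$4$1) * (A$1$3 * A$2$4 - A$1$4 * A$2$3)"
proof -
  have f1: "finite {2::4, 3, 4}" "1 \<notin> {2::4, 3, 4}" by auto
  have f2: "finite {3::4, 4}" "2 \<notin> {3::4, 4}" by auto
  have f3: "finite {4::4}" "3 \<notin> {4::4}" by auto
  show ?thesis
    unfolding det_def UNIV_4
    unfolding sum_over_permutations_insert[OF f1]
    unfolding sum_over_permutations_insert[OF f2]
    unfolding sum_over_permutations_insert[OF f3]
    unfolding permutes_sing
    by (simp add: sign_swap_id permutation_swap_id permutation_compose sign_compose sign_id swap_id_eq algebra_simps)
qed

definition adj :: "complex^4^4 \<Rightarrow> complex^4^4" where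
  "adj A = (\<chi> m n. cnj (A$n$m))"

lemma mult_vec_nth: "(A *v x) $ m = (\<Sum>n\<in>UNIV. A$m$n * x$n)" for A :: "complex^4^4"
  by (simp add: matrix_vector_mult_def)

lemma mult_vec_linear [simp]:
  fixes A :: "complex^4^4"
  shows "A *v (c *s x) = c *s (A *v x)" "A *v (x - y) = A *v x - A *v y" "A *v (r *\<^sub>R x) = r *\<^sub>R (A *v x)"
  by (simp_all add: vec_eq_iff mult_vec_nth sum_4 algebra_simps)

lemma bounded_linear_mult_vec: "bounded_linear ((*v) (A::complex^4^4))"
  by (auto simp: linear_conv_bounded_linear[symmetric] matrix_vector_right_distrib intro!: linearI)

lemma hip_adj: "hip (A *v x) y = hip x (adj A *v y)"
  by (simp add: hip_def mult_vec_nth adj_def sum_4 algebra_simps)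

lemma adj_adj [simp]: "adj (adj A) = A"
  by (simp add: adj_def vec_eq_iff)

lemma basis_decomp: "(x::complex^4) = x$1 *s axis 1 1 + x$2 *s axis 2 1 + x$3 *s axis 3 1 + x$4 *s axis 4 1"
  by (simp add: vec4_eq_iff axis_def)

lemma mult_vec_axis [simp]: "((A::complex^4^4) *v axis n 1) $ m = A$m$n"
  using exhaust_4[of n] by (auto simp: mult_vec_nth sum_4 axis_def)

lemma hip_zero_imp: "(\<And>x. hip x w = 0) \<Longrightarrow> w = 0"
  by (metis hip_self norm_eq_zero of_real_eq_0_iff power_eq_0_iff)

lemma unitary_iff_hip: "adj A ** A = mat 1 \<longleftrightarrow> (\<forall>x y. hip (A *v x) (A *v y) = hip x y)"
proof
  assume "adj A ** A = mat 1"
  then have "adj A *v (A *v y) = y" for y by (simp add: matrix_vector_mul_assoc)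
  then show "\<forall>x y. hip (A *v x) (A *v y) = hip x y" by (simp add: hip_adj)
next
  assume *: "\<forall>x y. hip (A *v x) (A *v y) = hip x y"
  have "(adj A ** A) $ m $ n = hip (A *v axis n 1) (A *v axis m 1)" for m n
    by (simp add: matrix_matrix_mult_def adj_def hip_def sum_4 mult.commute)
  moreover have "hip (axis n 1) (axis m 1) = (mat 1 :: complex^4^4) $ m $ n" for m n :: 4
    using exhaust_4[of n] exhaust_4[of m] by (auto simp: hip_def sum_4 axis_def mat_def)
  ultimately show "adj A ** A = mat 1" using * by (simp add: vec_eq_iff)
qed

lemma SU4_hip: "A \<in> SU4 \<Longrightarrow> hip (A *v x) (A *v y) = hip x y"
  using unitary_iff_hip[of A] matrix_left_right_inverse[of A "adj A"]
  by (simp add: SU4_def adj_def)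

text \<open>The \<open>2 \<times> 2\<close> minors of the columns \<open>u, ju\<close> and \<open>v, jv\<close> of such a matrix are linked by the orthonormality
  of its rows, which turns the Laplace expansion into a sum of squares.\<close>

lemma det_quaternionic_unitary:
  assumes h: "\<And>x y. hip (A *v x) (A *v y) = hip x y" and j: "\<And>x. A *v jq x = jq (A *v x)"
  shows "det A = 1"
proof -
  have A2: "A$m$2 = jq (A *v axis 1 1) $ m" for m
  proof -
    have "axis 2 1 = jq (axis 1 1)" by (simp add: vec4_eq_iff axis_def)
    then show ?thesis using j[of "axis 1 1"] mult_vec_axis[of A 2 m] by simp
  qed
  have A4: "A$m$4 = jq (A *v axis 3 1) $ m" for m
  proof -
    have "axis 4 1 = jq (axis 3 1)" by (simp add: vec4_eq_iff axis_def)
    then show ?thesis using j[of "axis 3 1"] mult_vec_axis[of A 4 m] by simp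
  qed
  define u where "u = (\<lambda>m. A$m$1)"
  define v where "v = (\<lambda>m. A$m$3)"
  have e: "A$1$1 = u 1" "A$2$1 = u 2" "A$3$1 = u 3" "A$4$1 = u 4"
    "A$1$3 = v 1" "A$2$3 = v 2" "A$3$3 = v 3" "A$4$3 = v 4"
    "A$1$2 = - cnj (u 2)" "A$2$2 = cnj (u 1)" "A$3$2 = - cnj (u 4)" "A$4$2 = cnj (u 3)"
    "A$1$4 = - cnj (v 2)" "A$2$4 = cnj (v 1)" "A$3$4 = - cnj (v 4)" "A$4$4 = cnj (v 3)"
    by (simp_all add: A2 A4 u_def v_def)
  have "adj A ** A = mat 1" using unitary_iff_hip h by blast
  then have "A ** adj A = mat 1" using matrix_left_right_inverse by blast
  then have rows: "(A ** adj A) $ m $ n = (if m = n then 1 else 0)" for m n by (simp add: mat_def)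
  have r11: "u 1 * cnj (u 1) + u 2 * cnj (u 2) + v 1 * cnj (v 1) + v 2 * cnj (v 2) = 1"
    using rows[of 1 1] by (simp add: matrix_matrix_mult_def adj_def sum_4 e algebra_simps)
  have r33: "u 3 * cnj (u 3) + u 4 * cnj (u 4) + v 3 * cnj (v 3) + v 4 * cnj (v 4) = 1"
    using rows[of 3 3] by (simp add: matrix_matrix_mult_def adj_def sum_4 e algebra_simps)
  have r13: "u 1 * cnj (u 3) + cnj (u 2) * u 4 = - (v 1 * cnj (v 3) + cnj (v 2) * v 4)"
    unfolding eq_neg_iff_add_eq_0 using rows[of 1 3] by (simp add: matrix_matrix_mult_def adj_def sum_4 e algebra_simps)
  have r14: "u 1 * cnj (u 4) - cnj (u 2) * u 3 = - (v 1 * cnj (v 4) - cnj (v 2) * v 3)"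
    unfolding eq_neg_iff_add_eq_0 using rows[of 1 4] by (simp add: matrix_matrix_mult_def adj_def sum_4 e algebra_simps)
  have "hip (A *v axis 1 1) (A *v axis 1 1) = hip (axis 1 1) (axis 1 1)" by (rule h)
  then have c1: "u 1 * cnj (u 1) + u 2 * cnj (u 2) + u 3 * cnj (u 3) + u 4 * cnj (u 4) = 1"
    unfolding hip_def sum_4 mult_vec_axis u_def by (simp add: axis_def)
  define P where "P = u 1 * cnj (u 1) + u 2 * cnj (u 2)"
  define P' where "P' = u 3 * cnj (u 3) + u 4 * cnj (u 4)"
  have Q: "v 1 * cnj (v 1) + v 2 * cnj (v 2) = P'"
    using r11 c1 unfolding P'_def by algebra
  have quad_coeff: "v 3 * cnj (v 3) + v 4 * cnj (v 4) = P"
    using r33 c1 unfolding P_def by algebra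
  define m n where "m = u 1 * cnj (u 4) - cnj (u 2) * u 3" and "n = u 1 * cnj (u 3) + cnj (u 2) * u 4"
  have vm: "v 1 * cnj (v 4) - cnj (v 2) * v 3 = - m" "v 1 * cnj (v 3) + cnj (v 2) * v 4 = - n"
    using r13 r14 by (simp_all add: m_def n_def)
  have cm: "cnj (v 1) * v 4 - v 2 * cnj (v 3) = - cnj m" "cnj (v 1) * v 3 + v 2 * cnj (v 4) = - cnj n"
    using vm[THEN arg_cong, of cnj] by simp_all
  \<comment> \<open>Multiplicativity of the quaternion norm, that is, Euler's four-square
    identity.\<close>
  have L: "m * cnj m + n * cnj n = P * P'"
    by (simp add: m_def n_def P_def P'_def algebra_simps)
  have "det A = (u 1 * cnj (u 1) + u 2 * cnj (u 2)) * (v 3 * cnj (v 3) + v 4 * cnj (v 4))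
     - m * (cnj (v 1) * v 4 - v 2 * cnj (v 3)) - n * (cnj (v 1) * v 3 + v 2 * cnj (v 4))
     - cnj n * (v 1 * cnj (v 3) + cnj (v 2) * v 4) - cnj m * (v 1 * cnj (v 4) - cnj (v 2) * v 3)
     + (u 3 * cnj (u 3) + u 4 * cnj (u 4)) * (v 1 * cnj (v 1) + v 2 * cnj (v 2))"
    unfolding det_4 e m_def n_def by (simp add: algebra_simps)
  also have "\<dots> = P * P + P' * P' + 2 * (m * cnj m + n * cnj n)"
    unfolding vm cm Q quad_coeff P_def[symmetric] P'_def[symmetric] by (simp add: algebra_simps)
  also have "\<dots> = (P + P') * (P + P')" unfolding L by (simp add: algebra_simps)
  also have "P + P' = 1" using c1 by (simp add: P_def P'_def algebra_simps)
  finally show ?thesis by simp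
qed

text \<open>The determinant condition is automatic by \<open>det_quaternionic_unitary\<close>; the
  closure properties below then reduce to two equations that compose.\<close>

lemma Sp2_iff: "A \<in> Sp2 \<longleftrightarrow> (\<forall>x y. hip (A *v x) (A *v y) = hip x y) \<and> (\<forall>x. A *v jq x = jq (A *v x))"
proof
  assume "A \<in> Sp2"
  then show "(\<forall>x y. hip (A *v x) (A *v y) = hip x y) \<and> (\<forall>x. A *v jq x = jq (A *v x))"
    by (simp add: Sp2_def SU4_hip)
next
  assume *: "(\<forall>x y. hip (A *v x) (A *v y) = hip x y) \<and> (\<forall>x. A *v jq x = jq (A *v x))"
  then have "adj A ** A = mat 1" using unitary_iff_hip by blast
  then have "A ** adj A = mat 1" using matrix_left_right_inverse by blast
  moreover have "det A = 1" by (rule det_quaternionic_unitary) (use * in blast)+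
  ultimately show "A \<in> Sp2" using * by (simp add: Sp2_def SU4_def adj_def)
qed

lemma Sp2_hip: "A \<in> Sp2 \<Longrightarrow> hip (A *v x) (A *v y) = hip x y"
  and Sp2_jq: "A \<in> Sp2 \<Longrightarrow> A *v jq x = jq (A *v x)"
  using Sp2_iff by blast+

lemma Sp2_norm: "A \<in> Sp2 \<Longrightarrow> norm (A *v x) = norm x"
  using Sp2_hip[of A x x] by (simp add: norm_eq_sqrt_inner inner_eq_Re_hip)

lemma Sp2_nonzero: "A \<in> Sp2 \<Longrightarrow> x \<noteq> 0 \<Longrightarrow> A *v x \<noteq> 0"
  using Sp2_norm by (metis norm_eq_zero)

lemma Sp2_adj_mult: "A \<in> Sp2 \<Longrightarrow> adj A *v (A *v x) = x" "A \<in> Sp2 \<Longrightarrow> A *v (adj A *v x) = x"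
proof -
  assume "A \<in> Sp2"
  then have 1: "adj A ** A = mat 1" using unitary_iff_hip Sp2_iff by blast
  then have 2: "A ** adj A = mat 1" using matrix_left_right_inverse by blast
  show "adj A *v (A *v x) = x" "A *v (adj A *v x) = x" using 1 2 by (simp_all add: matrix_vector_mul_assoc)
qed

lemma Sp2_adj: "A \<in> Sp2 \<Longrightarrow> adj A \<in> Sp2"
  unfolding Sp2_iff[of "adj A"] using Sp2_hip[of A] Sp2_jq[of A] Sp2_adj_mult[of A] by metis

lemma Sp2_mult: "A \<in> Sp2 \<Longrightarrow> B \<in> Sp2 \<Longrightarrow> A ** B \<in> Sp2"
  unfolding Sp2_iff[of "A ** B"] by (simp add: matrix_vector_mul_assoc[symmetric] Sp2_hip Sp2_jq)

lemma Sp2_one: "mat 1 \<in> Sp2"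
  by (simp add: Sp2_iff)

lemma conj_vec_nth [simp]: "conj_vec x $ m = cnj (x$m)"
  by (simp add: conj_vec_def)

lemma conj_vec_simps [simp]: "conj_vec (conj_vec x) = x" "hip (conj_vec x) (conj_vec y) = cnj (hip x y)"
  "jq (conj_vec x) = conj_vec (jq x)" "conj_vec x = 0 \<longleftrightarrow> x = 0" "conj_vec (c *s x) = cnj c *s conj_vec x"
  "conj_vec (x + y) = conj_vec x + conj_vec y"
  by (simp_all add: vec4_eq_iff hip_def sum_4)

lemma norm_conj_vec [simp]: "norm (conj_vec x) = norm x"
proof -
  have "(norm (conj_vec x))\<^sup>2 = (norm x)\<^sup>2" by (simp add: norm_vec4)
  then show ?thesis by simp
qed

lemma bounded_linear_conj_vec: "bounded_linear conj_vec"
  by (auto simp: linear_conv_bounded_linear[symmetric] vec_eq_iff intro!: linearI)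

definition cnj_mat :: "complex^4^4 \<Rightarrow> complex^4^4" where
  "cnj_mat A = (\<chi> m n. cnj (A$m$n))"

lemma cnj_mat_mult: "cnj_mat A *v x = conj_vec (A *v conj_vec x)"
  by (simp add: vec_eq_iff cnj_mat_def mult_vec_nth)

lemma Sp2_cnj_mat: "A \<in> Sp2 \<Longrightarrow> cnj_mat A \<in> Sp2"
  unfolding Sp2_iff[of "cnj_mat A"] cnj_mat_mult
  by (simp add: Sp2_hip Sp2_jq del: conj_vec_simps(3) flip: conj_vec_simps(3))

lemma G_Sp2: "A \<in> Sp2 \<Longrightarrow> G a (A *v z) (A *v x) (A *v y) = G a z x y"
  unfolding G_def inner_eq_Re_hip by (simp add: Sp2_hip Sp2_jq[symmetric] Sp2_norm)

lemma G_conj_vec: "G a (conj_vec z) (conj_vec x) (conj_vec y) = G a z x y"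
  unfolding G_def inner_eq_Re_hip by simp

text \<open>The vectors q, jq, r, jr are Hermitian orthonormal, and taking them as columns in this
  order is what commuting with j demands.\<close>

lemma Sp2_of_frame:
  assumes q: "hip q q = 1" "hip r r = 1" "hip r q = 0" "hip r (jq q) = 0"
  shows "\<exists>A\<in>Sp2. \<forall>x. A *v x = x$1 *s q + x$2 *s jq q + x$3 *s r + x$4 *s jq r"
proof -
  define A :: "complex^4^4" where
    "A = (\<chi> m n. if n = 1 then q$m else if n = 2 then jq q $ m else if n = 3 then r$m else jq r $ m)"
  have A: "A *v x = x$1 *s q + x$2 *s jq q + x$3 *s r + x$4 *s jq r" for x
    by (simp add: vec_eq_iff A_def mult_vec_nth sum_4 mult.commute)
  have c: "hip q r = 0" "hip (jq q) r = 0" "hip q (jq r) = 0" "hip (jq r) q = 0"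
  proof -
    show "hip q r = 0" "hip (jq q) r = 0" using q hip_commute by (metis complex_cnj_zero)+
    then show "hip (jq r) q = 0" using hip_jq(1)[of r "jq q"] by simp
    then show "hip q (jq r) = 0" using hip_commute by (metis complex_cnj_zero)
  qed
  have "hip (A *v x) (A *v y) = hip x y" for x y
    unfolding A by (simp add: q c) (simp add: hip_def sum_4)
  moreover have "A *v jq x = jq (A *v x)" for x
    unfolding A by (simp add: vec_eq_iff)
  ultimately show ?thesis using A Sp2_iff by blast
qed

lemma Sp2_transitive:
  assumes "hip q q = 1"
  obtains A where "A \<in> Sp2" "A *v e1 = q"
proof -
  \<comment> \<open>A vector outside the quaternionic line of q, for a Gram-Schmidt step:
    \<open>e1\<close> is orthogonal to that line when the first two coordinates of q vanish;
    otherwise the projection of the third basis vector has length below 1.\<close>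
  define e :: "complex^4" where "e = (if (cmod (q$1))\<^sup>2 + (cmod (q$2))\<^sup>2 = 0 then e1 else axis 3 1)"
  define s where "s = e - hip e q *s q - hip e (jq q) *s jq q"
  have n: "(cmod (q$1))\<^sup>2 + (cmod (q$2))\<^sup>2 + (cmod (q$3))\<^sup>2 + (cmod (q$4))\<^sup>2 = 1"
    using assms unfolding hip_self norm_vec4[symmetric] by (metis of_real_eq_1_iff)
  have s0: "hip s q = 0" "hip s (jq q) = 0" by (simp_all add: s_def assms)
  have "s \<noteq> 0"
  proof
    assume "s = 0"
    then have "e = hip e q *s q + hip e (jq q) *s jq q" by (simp add: s_def algebra_simps)
    then have "hip e e = hip (hip e q *s q + hip e (jq q) *s jq q) e" by simp
    also have "\<dots> = hip e q * cnj (hip e q) + hip e (jq q) * cnj (hip e (jq q))"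
      by (simp add: hip_commute[of e q] hip_commute[of e "jq q"])
    finally have "hip e e = of_real ((cmod (hip e q))\<^sup>2 + (cmod (hip e (jq q)))\<^sup>2)"
      unfolding of_real_add complex_norm_square .
    moreover have "hip e e = 1" by (simp add: e_def hip_def sum_4 axis_def)
    ultimately have *: "(cmod (hip e q))\<^sup>2 + (cmod (hip e (jq q)))\<^sup>2 = 1" by (metis of_real_eq_1_iff)
    show False
    proof (cases "(cmod (q$1))\<^sup>2 + (cmod (q$2))\<^sup>2 = 0")
      case True
      then have "q$1 = 0" "q$2 = 0" by (auto simp: add_nonneg_eq_0_iff)
      then show False using * True by (simp add: e_def hip_def sum_4 axis_def)
    next
      case False
      then have e: "e = axis 3 1" by (simp only: e_def if_False)
      have "hip e q = cnj (q$3)" "hip e (jq q) = - q$4" by (simp_all add: e hip_def sum_4 axis_def)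
      then have "(cmod (q$3))\<^sup>2 + (cmod (q$4))\<^sup>2 = 1" using * by simp
      then show False using False n by linarith
    qed
  qed
  define r where "r = of_real (1 / norm s) *s s"
  have "norm r = 1" unfolding r_def norm_smult4 norm_of_real using \<open>s \<noteq> 0\<close> by simp
  then have "hip r r = 1" by (simp add: hip_self)
  moreover have "hip r q = 0" "hip r (jq q) = 0" using s0 by (simp_all add: r_def)
  ultimately obtain A where A: "A \<in> Sp2" "\<And>x. A *v x = x$1 *s q + x$2 *s jq q + x$3 *s r + x$4 *s jq r"
    using Sp2_of_frame[OF assms] by blast
  have "A *v e1 = q" unfolding A(2) by (simp add: axis_def vec_eq_iff)
  with A(1) show ?thesis by (rule that)
qed

text \<open>The entries of \<open>transpose A ** symp_J ** A\<close> are the products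
  \<open>hip\<close> of A e_m with j A e_n. Being symplectic thus means preserving them on the
  basis, and for a unitary matrix this is commuting with j.\<close>

lemma Sp2_eq: "Sp2 = SU4 \<inter> Sp4C"
proof -
  have J: "(transpose A ** symp_J ** A) $ m $ n = hip (A *v axis m 1) (jq (A *v axis n 1))" for A :: "complex^4^4" and m n
    by (simp add: matrix_matrix_mult_def transpose_def symp_J_def hip_def sum_4 algebra_simps)
  have J1: "symp_J $ m $ n = hip (axis m 1) (jq (axis n 1))" for m n
    using J[of "mat 1" m n] by simp
  have "A \<in> Sp4C \<longleftrightarrow> (\<forall>x. A *v jq x = jq (A *v x))" if A: "A \<in> SU4" for A
  proof
    assume "A \<in> Sp4C"
    then have *: "hip (A *v axis m 1) (jq (A *v axis n 1)) = hip (axis m 1) (jq (axis n 1))" for m n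
      unfolding J[symmetric] J1[symmetric] by (simp add: Sp4C_def)
    have b: "A *v jq (axis n 1) = jq (A *v axis n 1)" for n
    proof -
      define w where "w = jq (A *v axis n 1) - A *v jq (axis n 1)"
      have "hip (A *v axis m 1) w = 0" for m
        using * SU4_hip[OF A] by (simp add: w_def)
      then have "hip (axis m 1) (adj A *v w) = 0" for m by (simp add: hip_adj)
      then have "hip x (adj A *v w) = 0" for x
        by (subst basis_decomp[of x]) simp
      then have "adj A *v w = 0" by (rule hip_zero_imp)
      moreover have "A ** adj A = mat 1" using A by (simp add: SU4_def adj_def)
      ultimately have "w = 0" by (metis matrix_vector_mul_assoc matrix_vector_mul_lid matrix_vector_mult_0_right)
      then show ?thesis by (simp add: w_def)
    qed
    show "\<forall>x. A *v jq x = jq (A *v x)"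
    proof
      fix x
      show "A *v jq x = jq (A *v x)"
        by (subst (1 2) basis_decomp[of x]) (simp add: matrix_vector_right_distrib b)
    qed
  next
    assume *: "\<forall>x. A *v jq x = jq (A *v x)"
    then have "hip (A *v axis m 1) (jq (A *v axis n 1)) = hip (axis m 1) (jq (axis n 1))" for m n
      using SU4_hip[OF A] by metis
    then show "A \<in> Sp4C"
      unfolding J[symmetric] J1[symmetric] by (simp add: Sp4C_def vec_eq_iff)
  qed
  then show ?thesis unfolding Sp2_def by blast
qed

section \<open>Isometries preserve all the metrics\<close>

lemma isometry_cp3_lift_iso:
  assumes "isometry_cp3 a \<phi>" "q \<noteq> 0"
  obtains U F where "q \<in> U" "lift_iso a U F" "\<And>z. z \<in> U \<Longrightarrow> hopf (F z) = \<phi> (hopf z)"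
proof -
  have "smooth_cp3 \<phi>" using assms(1) by (simp add: isometry_cp3_def)
  then obtain U F where UF: "open U" "q \<in> U" "0 \<notin> U" "\<And>k. C_k_on k U F"
    "\<And>z. z \<in> U \<Longrightarrow> F z \<noteq> 0 \<and> hopf (F z) = \<phi> (hopf z)"
    using smooth_cp3_lift[OF _ assms(2)] by metis
  have "G a (F z) (fd F z x) (fd F z x) = G a z x x" if "z \<in> U" for z x
    using isometry_cp3_lift[OF assms(1) UF(1) that UF(3) UF(5) C_k_on_has_derivative[OF UF(4) that]] .
  then have "lift_iso a U F" using UF unfolding lift_iso_def by blast
  then show ?thesis using that UF by blast
qed

lemma lift_iso_has_derivative: "lift_iso a U F \<Longrightarrow> z \<in> U \<Longrightarrow> (F has_derivative fd F z) (at z)"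
  unfolding lift_iso_def using C_k_on_has_derivative by blast

lemma bounded_linear_smult: "bounded_linear (\<lambda>z. c *s (z :: complex^4))"
  by (auto simp: linear_conv_bounded_linear[symmetric] vec_eq_iff algebra_simps intro!: linearI)

section \<open>Moving a point and its image to \<open>e1\<close>\<close>

text \<open>S and r carry \<open>e1\<close> to the chosen point, T and c carry its image back. The
  scalars account for representatives that are not unit vectors; \<open>G\<close> is invariant under
  all four.\<close>

locale transported_lift =
  fixes a :: real and U F S T and r c :: complex
  assumes F: "lift_iso a U F" and S: "S \<in> Sp2" and T: "T \<in> Sp2" and r: "r \<noteq> 0" and c: "c \<noteq> 0"
begin

definition "tF z = c *s (T *v F (r *s (S *v z)))"
definition "tU = {z. r *s (S *v z) \<in> U}"

lemma pre: "bounded_linear (\<lambda>z. r *s (S *v z))"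
  using bounded_linear_compose[OF bounded_linear_smult bounded_linear_mult_vec] .

lemma post: "bounded_linear (\<lambda>z. c *s (T *v z))"
  using bounded_linear_compose[OF bounded_linear_smult bounded_linear_mult_vec] .

lemma tF_has_derivative:
  assumes "z \<in> tU"
  shows "(tF has_derivative (\<lambda>x. c *s (T *v fd F (r *s (S *v z)) (r *s (S *v x))))) (at z)"
proof -
  have "((\<lambda>z. F (r *s (S *v z))) has_derivative (\<lambda>x. fd F (r *s (S *v z)) (r *s (S *v x)))) (at z)"
    by (rule has_derivative_compose[OF bounded_linear_imp_has_derivative[OF pre] lift_iso_has_derivative[OF F]])
      (use assms in \<open>simp add: tU_def\<close>)
  from bounded_linear.has_derivative[OF post this] show ?thesis unfolding tF_def .
qed

lemma fd_tF: "z \<in> tU \<Longrightarrow> fd tF z x = c *s (T *v fd F (r *s (S *v z)) (r *s (S *v x)))"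
  using frechet_derivative_at[OF tF_has_derivative] by metis

lemma lift_iso: "lift_iso a tU tF"
  unfolding lift_iso_def
proof (intro conjI allI ballI)
  have U: "open U" "0 \<notin> U" "\<And>k. C_k_on k U F" using F by (auto simp: lift_iso_def)
  have "continuous_on UNIV (\<lambda>z. r *s (S *v z))" using linear_continuous_on[OF pre] .
  from open_vimage[OF U(1) this] show tU: "open tU" by (simp add: tU_def vimage_def)
  show "0 \<notin> tU" using U(2) by (simp add: tU_def)
  show "C_k_on k tU tF" for k
    unfolding tF_def
    by (rule C_k_on_bounded_linear[OF post tU C_k_on_compose[OF tU U(1) C_k_on_linear[OF pre] U(3)]])
      (auto simp: tU_def)
  fix z assume z: "z \<in> tU"
  let ?z = "r *s (S *v z)"
  have Fz: "F ?z \<noteq> 0" "\<And>x. G a (F ?z) (fd F ?z x) (fd F ?z x) = G a ?z x x"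
    using F z unfolding lift_iso_def tU_def by blast+
  show "tF z \<noteq> 0" using Fz(1) c Sp2_nonzero[OF T] by (simp add: tF_def)
  show "G a (tF z) (fd tF z x) (fd tF z x) = G a z x x" for x
    unfolding fd_tF[OF z] unfolding tF_def G_scale[OF c] G_Sp2[OF T] Fz(2) G_scale[OF r] G_Sp2[OF S] ..
qed

end

lemma unit_scale:
  assumes "(q::complex^4) \<noteq> 0"
  shows "hip (of_real (1 / norm q) *s q) (of_real (1 / norm q) *s q) = 1"
proof -
  have "norm (of_real (1 / norm q) *s q) = 1" unfolding norm_smult4 norm_of_real using assms by simp
  then show ?thesis by (simp only: hip_self) simp
qed

lemma normalize_lift:
  assumes "lift_iso a U F" "q \<in> U" "S \<in> Sp2" "r \<noteq> 0" "r *s (S *v e1) = q"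
  obtains T c where "transported_lift a U F S T r c" "e1 \<in> transported_lift.tU U S r"
    "transported_lift.tF F S T r c e1 = e1" "c *s (T *v F q) = e1"
proof -
  have Fq: "F q \<noteq> 0" using assms(1,2) by (auto simp: lift_iso_def)
  obtain T where T: "T \<in> Sp2" "T *v e1 = of_real (1 / norm (F q)) *s F q"
    by (rule Sp2_transitive[OF unit_scale[OF Fq]])
  then have "adj T *v (of_real (1 / norm (F q)) *s F q) = e1" using Sp2_adj_mult(1) by metis
  then have n: "of_real (1 / norm (F q)) *s (adj T *v F q) = e1" by simp
  have t: "transported_lift a U F S (adj T) r (of_real (1 / norm (F q)))"
    using assms Sp2_adj[OF T(1)] Fq by unfold_locales auto
  show ?thesis
  proof (rule that[OF t _ _ n])
    show "e1 \<in> transported_lift.tU U S r"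
      unfolding transported_lift.tU_def[OF t] using assms by simp
    show "transported_lift.tF F S (adj T) r (of_real (1 / norm (F q))) e1 = e1"
      unfolding transported_lift.tF_def[OF t] assms(5) by (rule n)
  qed
qed

lemma normal_chartI:
  assumes "lift_iso a U F" "e1 \<in> U" "F e1 = e1" "a > 0"
  shows "normal_chart a ((1 - a) / a) U F"
  using assms by unfold_locales auto

text \<open>The result at \<open>e1\<close> is applied at every q separately, each time with freshly
  chosen S and T. No sign condition on b is imposed, because b = 0 will be taken.\<close>

lemma lift_iso_all:
  assumes a: "a > 0" "a \<noteq> 1" and F: "lift_iso a U F"
  shows "lift_iso b U F"
proof -
  have "G b (F q) (fd F q x) (fd F q x) = G b q x x" if q: "q \<in> U" for q x
  proof -
    have q0: "q \<noteq> 0" using F q by (auto simp: lift_iso_def)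
    obtain S where S: "S \<in> Sp2" "S *v e1 = of_real (1 / norm q) *s q"
      by (rule Sp2_transitive[OF unit_scale[OF q0]])
    let ?r = "complex_of_real (norm q)"
    have r: "?r \<noteq> 0" "?r *s (S *v e1) = q" using q0 S(2) by simp_all
    obtain T c where t: "transported_lift a U F S T ?r c" "e1 \<in> transported_lift.tU U S ?r"
      "transported_lift.tF F S T ?r c e1 = e1" "c *s (T *v F q) = e1"
      by (rule normalize_lift[OF F q S(1) r])
    interpret t: transported_lift a U F S T ?r c by (rule t)
    interpret n: normal_chart a "(1 - a) / a" t.tU t.tF
      by (rule normal_chartI[OF t.lift_iso t(2,3) a(1)])
    define y where "y = (1 / ?r) *s (adj S *v x)"
    have y: "?r *s (S *v y) = x" using r Sp2_adj_mult(2)[OF S(1)] by (simp add: y_def)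
    have "G b (F q) (fd F q x) (fd F q x) = G b (c *s (T *v F q)) (c *s (T *v fd F q x)) (c *s (T *v fd F q x))"
      unfolding G_scale[OF t.c] G_Sp2[OF t.T] ..
    also have "\<dots> = G b e1 (fd t.tF e1 y) (fd t.tF e1 y)"
      unfolding t(4) t.fd_tF[OF t(2)] r(2) y ..
    also have "\<dots> = G b e1 y y" by (rule n.all_metrics_preserved[OF a(2)])
    also have "\<dots> = G b (?r *s (S *v e1)) (?r *s (S *v y)) (?r *s (S *v y))"
      unfolding G_scale[OF r(1)] G_Sp2[OF S(1)] ..
    finally show ?thesis unfolding r(2) y .
  qed
  then show ?thesis using F unfolding lift_iso_def by blast
qed


section \<open>The differential of an isometry\<close>

abbreviation axis3 :: "3 \<Rightarrow> complex \<Rightarrow> complex^3" where "axis3 k c \<equiv> axis k c"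

section \<open>The contact distribution and its bracket\<close>

text \<open>For a = 0 only the \<open>D1\<close> part survives: up to a positive factor, the squared
  modulus of the holomorphic contact form dy1 + y2 dy3 - y3 dy2.\<close>

lemma chart_form_contact: "chart_form 0 0 y u = (cmod (u$1 + (u$3 * y$2 - u$2 * y$3)))\<^sup>2 / norm (ncoord 0 y) ^ 4"
proof -
  have "hip (dncoord 0 y u) (jq (ncoord 0 y)) = u$1 + (u$3 * y$2 - u$2 * y$3)"
    by (simp add: hip_def sum_4)
  then show ?thesis by (simp add: chart_form_def G_self)
qed

text \<open>For a = 1 the condition a \<kappa> = 1 - a gives \<kappa> = 0, so the affine chart is
  itself normal for the Fubini-Study metric.\<close>

locale full_chart = normal_chart 1 0 U F for U F +
  assumes all: "lift_iso b U F"
begin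

lemma contact_preserved:
  assumes "y \<in> V" "u$1 + (u$3 * y$2 - u$2 * y$3) = 0"
  shows "fd f y u $ 1 + (fd f y u $ 3 * f y $ 2 - fd f y u $ 2 * f y $ 3) = 0"
proof -
  interpret c: fixed_chart 0 0 U F using all e1 by unfold_locales
  \<comment> \<open>The chart map depends on \<kappa> and F alone, so the forms for 0 and for 1 are
    compared in the same coordinates.\<close>
  have "c.f = f" "c.V = V" unfolding c.f_def f_def c.V_def V_def by simp_all
  with c.chart_form_f[of y u] assms have "chart_form 0 0 (f y) (fd f y u) = 0"
    by (simp add: chart_form_contact)
  then show ?thesis using norm_ncoord_nonzero by (simp add: chart_form_contact)
qed

lemma first_preserved: "cmod (fd f 0 u $ 1) = cmod (u$1)"
proof -
  interpret c: fixed_chart 0 0 U F using all e1 by unfold_locales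
  have "c.f = f" "c.V = V" unfolding c.f_def f_def c.V_def V_def by simp_all
  with c.chart_form_f[of 0 u] V(2) f_0 have "chart_form 0 0 0 (fd f 0 u) = chart_form 0 0 0 u" by simp
  then have "(cmod (fd f 0 u $ 1))\<^sup>2 = (cmod (u$1))\<^sup>2" using norm_ncoord_nonzero by (simp add: chart_form_contact)
  then show ?thesis by simp
qed

lemma ray_derivatives:
  shows "((\<lambda>t. f (t *\<^sub>R w)) has_vector_derivative fd f 0 w) (at 0)"
    and "((\<lambda>t. fd f (t *\<^sub>R w) u) has_vector_derivative 0) (at 0)"
proof -
  have ray: "((\<lambda>t. t *\<^sub>R w) has_derivative (\<lambda>s. s *\<^sub>R w)) (at 0)"
    by (auto intro!: derivative_eq_intros)
  have f': "(f has_derivative fd f 0) (at (0 *\<^sub>R w))"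
    using C_k_on_has_derivative[OF C_k_f V(2)] by simp
  show "((\<lambda>t. f (t *\<^sub>R w)) has_vector_derivative fd f 0 w) (at 0)"
    using has_derivative_compose[OF ray f'] linear_scale[OF linear] by (simp add: has_vector_derivative_def)
  have "C_k_on (Suc (Suc 0)) V f" by (rule C_k_f)
  then have "C_k_on (Suc 0) V (\<lambda>y. fd f y u)" unfolding C_k_on.simps(2)[of "Suc 0"] by blast
  from C_k_on_has_derivative[OF this V(2)]
  have "((\<lambda>y. fd f y u) has_derivative frechet_derivative (\<lambda>y. fd f y u) (at 0)) (at (0 *\<^sub>R w))"
    by simp
  moreover have "frechet_derivative (\<lambda>y. fd f y u) (at 0) = (\<lambda>v. 0)"
    by (rule ext) (rule second_zero)
  ultimately have "((\<lambda>y. fd f y u) has_derivative (\<lambda>v. 0)) (at (0 *\<^sub>R w))"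
    by simp
  from has_derivative_compose[OF ray this]
  show "((\<lambda>t. fd f (t *\<^sub>R w) u) has_vector_derivative 0) (at 0)"
    by (simp add: has_vector_derivative_def)
qed

text \<open>The bracket \<open>\<sigma>\<close> of the horizontal distribution ties the two components of the differential together.\<close>

lemma bracket_preserved:
  assumes "w$1 = 0" "u$1 = 0"
  shows "fd f 0 (axis3 1 (u$3 * w$2 - u$2 * w$3)) $ 1 = fd f 0 u $ 3 * fd f 0 w $ 2 - fd f 0 u $ 2 * fd f 0 w $ 3"
proof -
  define \<sigma> where "\<sigma> = u$3 * w$2 - u$2 * w$3"
  \<comment> \<open>At t w the contact form annihilates u minus t \<sigma> times the first axis
    vector, so X stays in the image distribution. Since the second derivatives of f vanish at 0,
    differentiating its contact equation at t = 0 leaves only the bracket.\<close>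
  define X where "X t = fd f (t *\<^sub>R w) u - t *\<^sub>R fd f (t *\<^sub>R w) (axis3 1 \<sigma>)" for t
  note r = ray_derivatives(1)[of w] ray_derivatives(2)[of w u] ray_derivatives(2)[of w "axis3 1 \<sigma>"]
  have X: "(X has_vector_derivative - fd f 0 (axis3 1 \<sigma>)) (at 0)"
    unfolding X_def
    by (rule has_vector_derivative_eq_rhs[OF has_vector_derivative_diff[OF r(2) has_vector_derivative_scaleR[OF DERIV_ident r(3)]]]) simp
  have n: "((\<lambda>t. g t $ i) has_vector_derivative g' $ i) (at 0)" if "(g has_vector_derivative g') (at 0)" for g :: "real \<Rightarrow> complex^3" and g' i
    using bounded_linear.has_vector_derivative[OF bounded_linear_vec_nth that] .
  have X0: "X 0 = fd f 0 u" by (simp add: X_def)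
  have "((\<lambda>t. X t $ 1 + (X t $ 3 * f (t *\<^sub>R w) $ 2 - X t $ 2 * f (t *\<^sub>R w) $ 3)) has_vector_derivative
     (- fd f 0 (axis3 1 \<sigma>) $ 1 + (fd f 0 u $ 3 * fd f 0 w $ 2 - fd f 0 u $ 2 * fd f 0 w $ 3))) (at 0)"
    by (rule has_vector_derivative_eq_rhs[OF has_vector_derivative_add[OF n[OF X] has_vector_derivative_diff[OF
        has_vector_derivative_mult[OF n[OF X] n[OF r(1)]] has_vector_derivative_mult[OF n[OF X] n[OF r(1)]]]]])
      (simp add: X0 f_0)
  moreover have "((\<lambda>t. X t $ 1 + (X t $ 3 * f (t *\<^sub>R w) $ 2 - X t $ 2 * f (t *\<^sub>R w) $ 3)) has_vector_derivative 0) (at 0)"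
  proof (rule has_vector_derivative_transform_within_open)
    have "((\<lambda>t. t *\<^sub>R w) has_derivative (\<lambda>s. s *\<^sub>R w)) (at t)" for t
      by (auto intro!: derivative_eq_intros)
    then have "continuous_on UNIV (\<lambda>t. t *\<^sub>R w)"
      by (meson continuous_at_imp_continuous_on has_derivative_continuous)
    from open_vimage[OF V(1) this] show "open ((\<lambda>t. t *\<^sub>R w) -` V)" .
    show "0 \<in> (\<lambda>t. t *\<^sub>R w) -` V" using V(2) by simp
    show "((\<lambda>t. 0) has_vector_derivative 0) (at 0)" by simp
    fix t assume "t \<in> (\<lambda>t. t *\<^sub>R w) -` V"
    then have t: "t *\<^sub>R w \<in> V" by simp
    have lin: "Real_Vector_Spaces.linear (fd f (t *\<^sub>R w))"
      using C_k_on_has_derivative[OF C_k_f t] has_derivative_linear by blast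
    have X: "X t = fd f (t *\<^sub>R w) (u - t *\<^sub>R axis3 1 \<sigma>)"
      by (simp add: X_def linear_diff[OF lin] linear_scale[OF lin])
    have "(u - t *\<^sub>R axis3 1 \<sigma>) $ 1 + ((u - t *\<^sub>R axis3 1 \<sigma>) $ 3 * (t *\<^sub>R w) $ 2 - (u - t *\<^sub>R axis3 1 \<sigma>) $ 2 * (t *\<^sub>R w) $ 3) = 0"
      using assms by (simp add: axis_def \<sigma>_def scaleR_conv_of_real[where 'a=complex] algebra_simps)
    from contact_preserved[OF t this]
    show "0 = X t $ 1 + (X t $ 3 * f (t *\<^sub>R w) $ 2 - X t $ 2 * f (t *\<^sub>R w) $ 3)" unfolding X by simp
  qed
  ultimately have "- fd f 0 (axis3 1 \<sigma>) $ 1 + (fd f 0 u $ 3 * fd f 0 w $ 2 - fd f 0 u $ 2 * fd f 0 w $ 3) = 0"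
    using vector_derivative_unique_at by blast
  then show ?thesis by (simp add: \<sigma>_def)
qed

end

lemma axis_component: "axis k z $ i = (if i = k then z else 0)"
  by (simp add: axis_def)

section \<open>Normal form of the differential\<close>

text \<open>Equality case of Hadamard's inequality in two complex dimensions: two unit vectors with
  a determinant of modulus 1 determine each other up to that determinant. The proof sums the squared
  moduli of both defects.\<close>

lemma unit_area:
  fixes x y p q \<delta> :: complex
  assumes "(cmod x)\<^sup>2 + (cmod y)\<^sup>2 = 1" "(cmod p)\<^sup>2 + (cmod q)\<^sup>2 = 1" "\<delta> = y * p - x * q" "cmod \<delta> = 1"
  shows "x = - \<delta> * cnj q \<and> y = \<delta> * cnj p"
proof -
  have "of_real ((cmod (x + \<delta> * cnj q))\<^sup>2 + (cmod (y - \<delta> * cnj p))\<^sup>2) =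
      x * cnj x + y * cnj y + \<delta> * cnj \<delta> * (p * cnj p + q * cnj q) - cnj \<delta> * (y * p - x * q) - \<delta> * cnj (y * p - x * q)"
    unfolding of_real_add complex_norm_square by (simp add: algebra_simps)
  also have "\<dots> = 0"
  proof -
    have "x * cnj x + y * cnj y = 1" "p * cnj p + q * cnj q = 1" "\<delta> * cnj \<delta> = 1"
      using assms(1,2,4) unfolding complex_norm_square[symmetric] by (metis of_real_1 of_real_add, metis of_real_1 of_real_add, simp)
    then show ?thesis unfolding assms(3)[symmetric] by (simp add: mult.commute)
  qed
  finally have "(cmod (x + \<delta> * cnj q))\<^sup>2 + (cmod (y - \<delta> * cnj p))\<^sup>2 = 0" by (metis of_real_eq_0_iff)
  then have "x + \<delta> * cnj q = 0" "y - \<delta> * cnj p = 0" by (simp_all add: add_nonneg_eq_0_iff)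
  then show ?thesis by (simp add: eq_neg_iff_add_eq_0)
qed

text \<open>A vanishing determinant makes the vectors complex multiples of each other, and real
  orthogonality makes the unit factor purely imaginary.\<close>

lemma unit_parallel:
  fixes x y p q :: complex
  assumes "(cmod x)\<^sup>2 + (cmod y)\<^sup>2 = 1" "(cmod p)\<^sup>2 + (cmod q)\<^sup>2 = 1" "y * p - x * q = 0" "p \<bullet> x + q \<bullet> y = 0"
  obtains c where "c = \<i> \<or> c = - \<i>" "x = c * p" "y = c * q"
proof -
  define c where "c = x * cnj p + y * cnj q"
  have n: "p * cnj p + q * cnj q = 1" "x * cnj x + y * cnj y = 1"
    using assms(1,2) unfolding complex_norm_square[symmetric] by (metis of_real_1 of_real_add)+
  have x: "x = c * p"
  proof -
    have "c * p = x * (p * cnj p) + (y * p) * cnj q" by (simp add: c_def algebra_simps)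
    also have "y * p = x * q" using assms(3) by simp
    also have "x * (p * cnj p) + (x * q) * cnj q = x * (p * cnj p + q * cnj q)" by (simp add: algebra_simps)
    finally show ?thesis using n by simp
  qed
  have y: "y = c * q"
  proof -
    have "c * q = (x * q) * cnj p + y * (q * cnj q)" by (simp add: c_def algebra_simps)
    also have "x * q = y * p" using assms(3) by simp
    also have "(y * p) * cnj p + y * (q * cnj q) = y * (p * cnj p + q * cnj q)" by (simp add: algebra_simps)
    finally show ?thesis using n by simp
  qed
  have "Re c = 0" using assms(4) by (simp add: c_def inner_complex_def algebra_simps)
  moreover have "c * cnj c = 1"
  proof -
    have "x * cnj x + y * cnj y = c * cnj c * (p * cnj p + q * cnj q)" unfolding x y by (simp add: algebra_simps)
    then show ?thesis using n by simp
  qed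
  ultimately have "Im c * Im c = 1" by (simp add: complex_eq_iff)
  then have "Im c = 1 \<or> Im c = - 1" by (simp add: square_eq_1_iff)
  with \<open>Re c = 0\<close> have "c = \<i> \<or> c = - \<i>" by (simp add: complex_eq_iff)
  then show ?thesis using that x y by blast
qed

context full_chart
begin

lemma isometric': "fd f 0 u \<bullet> fd f 0 v = u \<bullet> v"
  using isometric[of u v] by (simp add: origin_form_def inner3)

text \<open>On the second axis the bracket of 1 and i vanishes, so the image of i is plus or minus i
  times that of 1. This one sign then spreads to the other axes through the bracket: the
  differential is complex linear or antilinear.\<close>

lemma differential_form:
  obtains \<delta> p q c where "cmod \<delta> = 1" "(cmod p)\<^sup>2 + (cmod q)\<^sup>2 = 1" "c = \<i> \<or> c = - \<i>"
    "\<And>u. fd f 0 u = (let v = (\<chi> k. of_real (Re (u$k)) + c * of_real (Im (u$k))) in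
      vector [\<delta> * v$1, v$2 * p - \<delta> * v$3 * cnj q, v$2 * q + \<delta> * v$3 * cnj p])"
proof -
  let ?A = "fd f 0"
  have h: "?A u $ 1 = 0" if "u$1 = 0" for u using first_preserved[of u] that by simp
  have v: "?A (axis3 1 z) $ 2 = 0" "?A (axis3 1 z) $ 3 = 0" for z
  proof -
    have "(norm (?A (axis3 1 z)))\<^sup>2 = (norm (axis3 1 z))\<^sup>2"
      unfolding power2_norm_eq_inner by (rule isometric')
    then have "(cmod (?A (axis3 1 z) $ 2))\<^sup>2 + (cmod (?A (axis3 1 z) $ 3))\<^sup>2 = 0"
      unfolding norm_vec3 first_preserved by (simp add: axis_component)
    then show "?A (axis3 1 z) $ 2 = 0" "?A (axis3 1 z) $ 3 = 0" by (simp_all add: add_nonneg_eq_0_iff)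
  qed
  have unit: "(cmod (?A u $ 2))\<^sup>2 + (cmod (?A u $ 3))\<^sup>2 = 1" if "u$1 = 0" "norm u = 1" for u
  proof -
    have "(norm (?A u))\<^sup>2 = (norm u)\<^sup>2" unfolding power2_norm_eq_inner by (rule isometric')
    then show ?thesis unfolding norm_vec3[of "?A u"] using h[OF that(1)] that(2) by simp
  qed
  have nE: "norm (axis3 k z) = cmod z" for k z
  proof -
    have "(norm (axis3 k z))\<^sup>2 = (cmod z)\<^sup>2" unfolding norm_vec3 using exhaust_3[of k] by (auto simp: axis_component)
    then show ?thesis by simp
  qed
  define \<delta> \<eta> where "\<delta> = ?A (axis3 1 1) $ 1" and "\<eta> = ?A (axis3 1 \<i>) $ 1"
  define p q where "p = ?A (axis3 2 1) $ 2" and "q = ?A (axis3 2 1) $ 3"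
  define p' q' where "p' = ?A (axis3 2 \<i>) $ 2" and "q' = ?A (axis3 2 \<i>) $ 3"
  have d: "cmod \<delta> = 1" "cmod \<eta> = 1" unfolding \<delta>_def \<eta>_def first_preserved by (simp_all add: axis_component)
  have pq: "(cmod p)\<^sup>2 + (cmod q)\<^sup>2 = 1" "(cmod p')\<^sup>2 + (cmod q')\<^sup>2 = 1"
    unfolding p_def q_def p'_def q'_def by (rule unit; simp add: axis_component nE)+
  have br: "?A (axis3 1 (u$3 * w$2 - u$2 * w$3)) $ 1 = ?A u $ 3 * ?A w $ 2 - ?A u $ 2 * ?A w $ 3" if "w$1 = 0" "u$1 = 0" for u w
    by (rule bracket_preserved[OF that])
  have "?A 0 = 0" using linear linear_0 by blast
  then have A0: "?A (axis3 1 0) = 0" by (simp add: axis_eq_0_iff[THEN iffD2])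
  have "q' * p - p' * q = 0"
    using br[of "axis3 2 1" "axis3 2 \<i>"] by (simp add: axis_component p_def q_def p'_def q'_def A0)
  moreover have "p \<bullet> p' + q \<bullet> q' = 0"
    using isometric'[of "axis3 2 1" "axis3 2 \<i>"] h[of "axis3 2 1"] by (simp add: inner3 p_def q_def p'_def q'_def) (simp add: axis_component)
  ultimately obtain c where c: "c = \<i> \<or> c = - \<i>" "p' = c * p" "q' = c * q"
    using unit_parallel[OF pq(2,1)] by metis
  have r: "?A (axis3 3 1) $ 2 = - \<delta> * cnj q \<and> ?A (axis3 3 1) $ 3 = \<delta> * cnj p"
  proof (rule unit_area[OF unit pq(1) _ d(1)])
    show "\<delta> = ?A (axis3 3 1) $ 3 * p - ?A (axis3 3 1) $ 2 * q"
      using br[of "axis3 2 1" "axis3 3 1"] by (simp add: p_def q_def \<delta>_def) (simp add: axis_component)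
  qed (simp_all add: nE, simp add: axis_component)
  have r': "?A (axis3 3 \<i>) $ 2 = - \<eta> * cnj q \<and> ?A (axis3 3 \<i>) $ 3 = \<eta> * cnj p"
  proof (rule unit_area[OF unit pq(1) _ d(2)])
    show "\<eta> = ?A (axis3 3 \<i>) $ 3 * p - ?A (axis3 3 \<i>) $ 2 * q"
      using br[of "axis3 2 1" "axis3 3 \<i>"] by (simp add: p_def q_def \<eta>_def) (simp add: axis_component)
  qed (simp_all add: nE, simp add: axis_component)
  \<comment> \<open>The bracket value i arises both from (e2, i e3) and from (i e2, e3); comparing
    the two transfers the sign of c to the \<open>D1\<close> direction.\<close>
  have \<eta>: "\<eta> = c * \<delta>"
  proof -
    have "\<eta> = ?A (axis3 3 1) $ 3 * p' - ?A (axis3 3 1) $ 2 * q'"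
      using br[of "axis3 2 \<i>" "axis3 3 1"] by (simp add: p'_def q'_def \<eta>_def) (simp add: axis_component)
    also have "\<dots> = c * (\<delta> * (p * cnj p + q * cnj q))" using r c by (simp add: algebra_simps)
    also have "p * cnj p + q * cnj q = 1"
      using pq(1) unfolding complex_norm_square[symmetric] by (metis of_real_1 of_real_add)
    finally show ?thesis by simp
  qed
  have "?A u = (let v = (\<chi> k. of_real (Re (u$k)) + c * of_real (Im (u$k))) in
      vector [\<delta> * v$1, v$2 * p - \<delta> * v$3 * cnj q, v$2 * q + \<delta> * v$3 * cnj p])" for u
  proof -
    have dec: "u = (Re (u$1) *\<^sub>R axis3 1 1 + Im (u$1) *\<^sub>R axis3 1 \<i>) + (Re (u$2) *\<^sub>R axis3 2 1 + Im (u$2) *\<^sub>R axis3 2 \<i>)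
        + (Re (u$3) *\<^sub>R axis3 3 1 + Im (u$3) *\<^sub>R axis3 3 \<i>)"
      by (simp add: vec3_eq_iff axis_component complex_eq_iff)
    have hE: "?A (axis3 2 z) $ 1 = 0" "?A (axis3 3 z) $ 1 = 0" for z by (rule h; simp add: axis_component)+
    have Au: "?A u = (Re (u$1) *\<^sub>R ?A (axis3 1 1) + Im (u$1) *\<^sub>R ?A (axis3 1 \<i>)) + (Re (u$2) *\<^sub>R ?A (axis3 2 1) + Im (u$2) *\<^sub>R ?A (axis3 2 \<i>))
        + (Re (u$3) *\<^sub>R ?A (axis3 3 1) + Im (u$3) *\<^sub>R ?A (axis3 3 \<i>))"
      by (subst dec) (simp only: A_linear)
    have ev: "?A (axis3 1 1) $ 1 = \<delta>" "?A (axis3 1 \<i>) $ 1 = c * \<delta>" "?A (axis3 2 1) $ 2 = p" "?A (axis3 2 1) $ 3 = q"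
      "?A (axis3 2 \<i>) $ 2 = c * p" "?A (axis3 2 \<i>) $ 3 = c * q"
      using \<eta> c by (simp_all add: \<delta>_def \<eta>_def p_def q_def p'_def q'_def)
    show ?thesis
      unfolding Au Let_def vec3_eq_iff vector_3 vector_add_component vector_scaleR_component hE v ev r[THEN conjunct1] r[THEN conjunct2]
        r'[THEN conjunct1] r'[THEN conjunct2] \<eta>
      by (simp add: scaleR_conv_of_real algebra_simps)
  qed
  with d(1) pq(1) c(1) show ?thesis by (rule that)
qed

text \<open>Multiplication by \<open>\<zeta>\<close>, a square root of \<open>1 / \<delta>\<close>, makes the matrix of the differential symplectic.\<close>

lemma differential_Sp2:
  obtains B \<zeta> where "B \<in> Sp2" "\<zeta> \<noteq> 0" "B *v e1 = \<zeta> *s e1"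
    "(\<forall>u. B *v embed_coord 1 u = \<zeta> *s embed_coord 1 (fd f 0 u)) \<or> (\<forall>u. B *v conj_vec (embed_coord 1 u) = \<zeta> *s embed_coord 1 (fd f 0 u))"
proof -
  obtain \<delta> p q c where d: "cmod \<delta> = 1" "(cmod p)\<^sup>2 + (cmod q)\<^sup>2 = 1" "c = \<i> \<or> c = - \<i>"
    and A: "\<And>u. fd f 0 u = (let v = (\<chi> k. of_real (Re (u$k)) + c * of_real (Im (u$k))) in
      vector [\<delta> * v$1, v$2 * p - \<delta> * v$3 * cnj q, v$2 * q + \<delta> * v$3 * cnj p])"
    by (rule differential_form) (rule that, assumption+)
  define \<zeta> where "\<zeta> = cnj (csqrt \<delta>)"
  have l: "cmod \<zeta> = 1" using d(1) by (simp add: \<zeta>_def norm_csqrt)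
  then have l1: "\<zeta> * cnj \<zeta> = 1" by (simp add: complex_norm_square[symmetric])
  have "cnj \<zeta> * cnj \<zeta> = \<delta>" using power2_csqrt[of \<delta>] by (simp add: \<zeta>_def power2_eq_square)
  \<comment> \<open>Since B commutes with j, it scales the second basis vector by
    \<open>cnj \<zeta>\<close>, whereas the differential requires \<open>\<zeta> * \<delta>\<close>
    there.\<close>
  then have ld: "cnj \<zeta> = \<zeta> * \<delta>" using l1 by (metis mult.assoc mult_1_left)
  define R :: "complex^4" where "R = \<zeta> *s vector [0, 0, p, q]"
  have pq: "p * cnj p + q * cnj q = 1"
    using d(2) unfolding complex_norm_square[symmetric] by (metis of_real_1 of_real_add)
  have "hip R R = (\<zeta> * cnj \<zeta>) * (p * cnj p + q * cnj q)" by (simp add: R_def hip_def sum_4 algebra_simps)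
  then have 1: "hip R R = 1" using l1 pq by simp
  have 2: "hip (\<zeta> *s e1) (\<zeta> *s e1) = 1" "hip R (\<zeta> *s e1) = 0" "hip R (jq (\<zeta> *s e1)) = 0"
    using l1 by (simp_all add: R_def hip_def sum_4 axis_component mult.commute)
  obtain B where B: "B \<in> Sp2" "\<And>x. B *v x = x$1 *s (\<zeta> *s e1) + x$2 *s jq (\<zeta> *s e1) + x$3 *s R + x$4 *s jq R"
    using Sp2_of_frame[OF 2(1) 1 2(2,3)] by blast
  have emb: "embed_coord 1 u $ 1 = 0" "embed_coord 1 u $ 2 = u$1" "embed_coord 1 u $ 3 = u$2" "embed_coord 1 u $ 4 = u$3" for u
    by (simp_all add: embed_coord_def)
  have Bv: "B *v vector [0, x, y, z] = \<zeta> *s embed_coord 1 (vector [\<delta> * x, y * p - \<delta> * z * cnj q, y * q + \<delta> * z * cnj p])" for x y z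
    unfolding B(2) vec4_eq_iff using ld by (simp add: emb R_def axis_component algebra_simps)
  have e: "embed_coord 1 u = vector [0, u$1, u$2, u$3]" "conj_vec (embed_coord 1 u) = vector [0, cnj (u$1), cnj (u$2), cnj (u$3)]" for u
    by (simp_all add: vec4_eq_iff emb)
  have "\<zeta> \<noteq> 0" using l by auto
  moreover have "B *v e1 = \<zeta> *s e1" unfolding B(2) by (simp add: vec_eq_iff axis_component)
  moreover have "(\<forall>u. B *v embed_coord 1 u = \<zeta> *s embed_coord 1 (fd f 0 u)) \<or> (\<forall>u. B *v conj_vec (embed_coord 1 u) = \<zeta> *s embed_coord 1 (fd f 0 u))"
    using d(3)
  proof
    assume c: "c = \<i>"
    have "of_real (Re z) + c * of_real (Im z) = z" for z by (simp add: c complex_eq_iff)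
    then show ?thesis unfolding A e(1)[of "_ :: complex^3"] by (simp add: Bv[unfolded e(1)])
  next
    assume c: "c = - \<i>"
    have "of_real (Re z) + c * of_real (Im z) = cnj z" for z by (simp add: c complex_eq_iff)
    then show ?thesis unfolding A e(2) by (simp add: Bv)
  qed
  ultimately show ?thesis using that B(1) by blast
qed

end

section \<open>Rigidity\<close>

lemma norm_axis_complex: "norm (axis k z :: complex^'n) = cmod z"
  by (simp add: norm_eq_sqrt_inner inner_axis_axis)

text \<open>Entries of the orthogonal projector onto the line of z. They are independent of the
  representative, so a curve in the quotient can be differentiated globally without choosing a
  lift.\<close>

definition projector :: "complex^4 \<Rightarrow> 4 \<Rightarrow> 4 \<Rightarrow> complex" where
  "projector z m n = (z$m * cnj (z$n)) * of_real (inverse ((norm z)\<^sup>2))"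

lemma projector_scale: "c \<noteq> 0 \<Longrightarrow> projector (c *s z) m n = projector z m n"
proof -
  assume "c \<noteq> 0"
  have "(c * z$m) * cnj (c * z$n) = of_real ((cmod c)\<^sup>2) * (z$m * cnj (z$n))"
    unfolding complex_norm_square by simp
  moreover have "of_real ((cmod c)\<^sup>2) * complex_of_real (inverse ((cmod c * norm z)\<^sup>2)) = of_real (inverse ((norm z)\<^sup>2))"
    using \<open>c \<noteq> 0\<close> by (simp add: power_mult_distrib)
  ultimately show ?thesis
    unfolding projector_def norm_smult4 vector_smult_component by (simp only: mult_ac)
qed

lemma projector_hopf: "x \<noteq> 0 \<Longrightarrow> y \<noteq> 0 \<Longrightarrow> hopf x = hopf y \<Longrightarrow> projector x m n = projector y m n"
  using hopf_eq_iff[of x y] projector_scale by metis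

lemma hopf_eq_of_projector:
  assumes "x \<noteq> 0" "y \<noteq> 0" "\<And>m n. projector x m n = projector y m n"
  shows "hopf x = hopf y"
proof -
  obtain n where n: "x$n \<noteq> 0" using nonzero_nth assms(1) by blast
  define N where "N = complex_of_real (inverse ((norm y)\<^sup>2)) * cnj (y$n)"
  define D where "D = cnj (x$n) * complex_of_real (inverse ((norm x)\<^sup>2))"
  have D: "D \<noteq> 0" using n assms(1) by (simp add: D_def)
  define k where "k = N / D"
  have "x = k *s y"
  proof (subst vec_eq_iff, rule allI)
    fix m
    have "x$m * D = N * y$m"
      using assms(3)[of m n] by (simp add: projector_def D_def N_def mult_ac)
    then show "x$m = (k *s y) $ m"
      using D by (simp add: k_def field_simps)
  qed
  moreover from this have "k \<noteq> 0" using assms(1) by auto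
  ultimately show ?thesis using hopf_scale assms(2) by metis
qed

definition projector_of :: "cp3 \<Rightarrow> 4 \<Rightarrow> 4 \<Rightarrow> complex" where
  "projector_of p = projector (fibre_point p)"

lemma projector_of_hopf: "q \<noteq> 0 \<Longrightarrow> projector_of (hopf q) m n = projector q m n"
  unfolding projector_of_def using fibre_point[of "hopf q"] by (intro projector_hopf) auto

text \<open>In the chart of \<open>full_chart\<close> the geodesics through the origin are the rays \<open>s \<mapsto> tan s b\<close>.\<close>

context full_chart
begin

lemma tan_ray: "\<exists>e>0. \<forall>s. \<bar>s\<bar> < e \<longrightarrow> tan s *\<^sub>R b \<in> V \<and> cos s \<noteq> 0"
proof -
  have "isCont (\<lambda>s. tan s *\<^sub>R b) 0"
    by (intro continuous_intros) auto
  then have "((\<lambda>s. tan s *\<^sub>R b) \<longlongrightarrow> 0) (at 0)" by (simp add: isCont_def)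
  from topological_tendstoD[OF this V] obtain e0 where e0: "e0 > 0" "\<And>s. s \<noteq> 0 \<Longrightarrow> \<bar>s\<bar> < e0 \<Longrightarrow> tan s *\<^sub>R b \<in> V"
    unfolding eventually_at by (auto simp: dist_real_def)
  have "tan s *\<^sub>R b \<in> V" if "\<bar>s\<bar> < min e0 1" for s
    using e0(2)[of s] that V(2) by (cases "s = 0") auto
  moreover have "cos s \<noteq> 0" if "\<bar>s\<bar> < min e0 1" for s
  proof -
    have "cos s > 0" by (rule cos_gt_zero_pi) (use that pi_gt3 in auto)
    then show ?thesis by simp
  qed
  ultimately show ?thesis using e0(1) by (intro exI[of _ "min e0 1"]) auto
qed

text \<open>The jet is that of the projector onto cos s c + sin s d. The orthonormality of c and d
  is supplied separately by \<open>osculates_of_chart\<close>.\<close>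

lemma geodesic_jet:
  fixes T :: "complex^4^4"
  assumes T: "T \<in> Sp2" and b: "norm b = 1"
  defines "c \<equiv> T *v e1" and "d \<equiv> T *v embed_coord 1 (fd f 0 b)"
  shows "\<exists>e>0. \<exists>z'. (\<forall>s. \<bar>s\<bar> < e \<longrightarrow> ((\<lambda>s. projector (T *v ncoord 0 (f (tan s *\<^sub>R b))) m n) has_vector_derivative z' s) (at s)) \<and>
    z' 0 = c$m * cnj (d$n) + d$m * cnj (c$n) \<and>
    (z' has_vector_derivative 2 * (d$m * cnj (d$n)) - 2 * (c$m * cnj (c$n))) (at 0)"
proof -
  obtain e where e: "e > 0" and inV: "\<And>s. \<bar>s\<bar> < e \<Longrightarrow> tan s *\<^sub>R b \<in> V" and cs: "\<And>s. \<bar>s\<bar> < e \<Longrightarrow> cos s \<noteq> 0"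
    using tan_ray by metis
  define k where "k = fd f 0 b"
  define w where "w s = f (tan s *\<^sub>R b)" for s
  define w1 where "w1 s = inverse ((cos s)\<^sup>2) *\<^sub>R fd f (tan s *\<^sub>R b) b" for s
  have k: "k \<bullet> k = 1"
    unfolding k_def isometric' using b by (simp add: power2_norm_eq_inner[symmetric])
  have tan': "(tan has_vector_derivative inverse ((cos s)\<^sup>2)) (at s)" if "cos s \<noteq> 0" for s :: real
    using DERIV_tan[OF that] by (simp add: has_real_derivative_iff_has_vector_derivative)
  have ray: "((\<lambda>s. tan s *\<^sub>R b) has_vector_derivative inverse ((cos s)\<^sup>2) *\<^sub>R b) (at s)" if "cos s \<noteq> 0" for s :: real
    using bounded_linear.has_vector_derivative[OF bounded_linear_scaleR_left tan'[OF that]] .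
  have w: "(w has_vector_derivative w1 s) (at s)" if s: "\<bar>s\<bar> < e" for s
  proof -
    have f': "(f has_derivative fd f (tan s *\<^sub>R b)) (at (tan s *\<^sub>R b))"
      using C_k_on_has_derivative[OF C_k_f inV[OF s]] .
    from has_derivative_compose[OF ray[OF cs[OF s], unfolded has_vector_derivative_def] f']
    show ?thesis
      unfolding has_vector_derivative_def w_def w1_def
      by (simp add: linear_scale[OF has_derivative_linear[OF f']] mult.commute)
  qed
  \<comment> \<open>Both tan and f have vanishing second derivative at 0, so the image curve has no
    acceleration in the chart; the second derivative of the projector depends on this.\<close>
  have w1: "(w1 has_vector_derivative 0) (at 0)"
  proof -
    have "((\<lambda>t. fd f (t *\<^sub>R b) b) has_derivative (\<lambda>s. 0)) (at (tan 0))"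
      using ray_derivatives(2)[of b b] by (simp add: has_vector_derivative_def)
    from has_derivative_compose[OF tan'[of 0, unfolded has_vector_derivative_def] this]
    have 1: "((\<lambda>s. fd f (tan s *\<^sub>R b) b) has_vector_derivative 0) (at 0)"
      by (simp add: has_vector_derivative_def)
    have 2: "((\<lambda>s::real. inverse ((cos s)\<^sup>2)) has_real_derivative 0) (at 0)"
      by (auto intro!: derivative_eq_intros)
    show ?thesis
      unfolding w1_def by (rule has_vector_derivative_eq_rhs[OF has_vector_derivative_scaleR[OF 2 1]]) simp
  qed
  have w0: "w 0 = 0" "w1 0 = k" by (simp_all add: w_def w1_def f_0 k_def)
  define L where "L i u = (T *v embed_coord 1 u) $ i" for i u
  have L: "bounded_linear (L i)" for i
    unfolding L_def
    by (rule bounded_linear_compose[OF bounded_linear_vec_nth bounded_linear_compose[OF bounded_linear_mult_vec bounded_linear_embed]])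
  define y where "y i s = c$i + L i (w s)" for i s
  have ncoord: "ncoord 0 u = e1 + embed_coord 1 u" for u by (simp add: vec4_eq_iff embed_coord_def axis_component)
  have Ty: "(T *v ncoord 0 (w s)) $ i = y i s" for i s
    unfolding ncoord y_def L_def c_def by (simp add: matrix_vector_right_distrib)
  have y: "(y i has_vector_derivative L i (w1 s)) (at s)" if "\<bar>s\<bar> < e" for i s
    unfolding y_def
    using has_vector_derivative_add[OF has_vector_derivative_const bounded_linear.has_vector_derivative[OF L w[OF that]], of "c$i" i] by simp
  have cj: "((\<lambda>s. cnj (g s)) has_vector_derivative cnj g') F" if "(g has_vector_derivative g') F" for g :: "real \<Rightarrow> complex" and g' F
    by (rule bounded_linear.has_vector_derivative[OF bounded_linear_cnj that])
  have L1: "((\<lambda>s. L i (w1 s)) has_vector_derivative 0) (at 0)" for i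
    using bounded_linear.has_vector_derivative[OF L w1] by (simp add: L_def)
  define M where "M s = inverse (1 + w s \<bullet> w s)" for s
  define M1 where "M1 s = - (2 * (w s \<bullet> w1 s)) * (M s)\<^sup>2" for s
  have pos: "1 + w s \<bullet> w s \<noteq> 0" for s
    using inner_ge_zero[of "w s"] by linarith
  have W: "((\<lambda>s. w s \<bullet> w s) has_vector_derivative 2 * (w s \<bullet> w1 s)) (at s)" if "\<bar>s\<bar> < e" for s
    by (rule has_vector_derivative_eq_rhs[OF bounded_bilinear.has_vector_derivative[OF bounded_bilinear_inner w[OF that] w[OF that]]])
      (simp add: inner_commute)
  have M: "(M has_real_derivative M1 s) (at s)" if "\<bar>s\<bar> < e" for s
    unfolding M_def M1_def using W[OF that] pos[of s]
    by (auto intro!: derivative_eq_intros simp: has_real_derivative_iff_has_vector_derivative[symmetric] power2_eq_square)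
  have e00: "\<bar>0\<bar> < e" using e by simp
  have M1: "(M1 has_real_derivative - 2) (at 0)"
  proof -
    have "((\<lambda>s. w s \<bullet> w1 s) has_vector_derivative 1) (at 0)"
      by (rule has_vector_derivative_eq_rhs[OF bounded_bilinear.has_vector_derivative[OF bounded_bilinear_inner w[OF e00] w1]])
        (simp add: w0 k)
    then have 1: "((\<lambda>s. w s \<bullet> w1 s) has_real_derivative 1) (at 0)"
      by (simp add: has_real_derivative_iff_has_vector_derivative)
    show ?thesis unfolding M1_def
      by (rule DERIV_cong[OF DERIV_mult[OF DERIV_minus[OF DERIV_cmult[OF 1]] DERIV_power[OF M[OF e00]]]])
        (simp add: w0 M_def)
  qed
  have M0: "M 0 = 1" "M1 0 = 0" by (simp_all add: M_def M1_def w0)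
  define Y where "Y s = y m s * cnj (y n s)" for s
  define Y1 where "Y1 s = y m s * cnj (L n (w1 s)) + L m (w1 s) * cnj (y n s)" for s
  have Y: "(Y has_vector_derivative Y1 s) (at s)" if "\<bar>s\<bar> < e" for s
    unfolding Y_def Y1_def by (rule has_vector_derivative_mult[OF y[OF that] cj[OF y[OF that]]])
  have Y1: "(Y1 has_vector_derivative 2 * (L m k * cnj (L n k))) (at 0)"
    unfolding Y1_def
    by (rule has_vector_derivative_eq_rhs[OF has_vector_derivative_add[OF has_vector_derivative_mult[OF y[OF e00] cj[OF L1]]
        has_vector_derivative_mult[OF L1 cj[OF y[OF e00]]]]]) (simp add: w0)
  have d: "L i k = d$i" for i by (simp add: L_def d_def k_def)
  have y0: "y i 0 = c$i" for i by (simp add: y_def w0 L_def)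
  have z: "projector (T *v ncoord 0 (f (tan s *\<^sub>R b))) m n = Y s * of_real (M s)" for s
  proof -
    have "(norm (T *v ncoord 0 (w s)))\<^sup>2 = 1 + w s \<bullet> w s"
      unfolding Sp2_norm[OF T] power2_norm_eq_inner[of "w s", symmetric] norm_vec4 norm_vec3 by simp
    then show ?thesis unfolding projector_def w_def[symmetric] Ty Y_def M_def by simp
  qed
  define z' where "z' s = Y s * of_real (M1 s) + Y1 s * of_real (M s)" for s
  have "((\<lambda>s. Y s * of_real (M s)) has_vector_derivative z' s) (at s)" if "\<bar>s\<bar> < e" for s
    unfolding z'_def
    by (rule has_vector_derivative_mult[OF Y[OF that] has_vector_derivative_of_real[OF M[OF that]]])
  moreover have "z' 0 = c$m * cnj (d$n) + d$m * cnj (c$n)"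
    by (simp add: z'_def M0 Y1_def w0 d y0)
  moreover have "(z' has_vector_derivative 2 * (d$m * cnj (d$n)) - 2 * (c$m * cnj (c$n))) (at 0)"
    unfolding z'_def
    by (rule has_vector_derivative_eq_rhs[OF has_vector_derivative_add[OF
          has_vector_derivative_mult[OF Y[OF e00] has_vector_derivative_of_real[OF M1]]
          has_vector_derivative_mult[OF Y1 has_vector_derivative_of_real[OF M[OF e00]]]]])
      (simp add: M0 d Y_def y0 Y1_def w0)
  ultimately show ?thesis unfolding z using e by blast
qed

end

section \<open>From osculation to great circles\<close>

text \<open>With r the second derivative of z, r + 4 z is constant and the pair (r, 2 p) rotates
  with angular speed 2. Three first integrals thus determine z without a uniqueness theorem.\<close>

lemma third_order_ode:
  fixes z p r :: "real \<Rightarrow> complex"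
  assumes z: "\<And>t. (z has_vector_derivative p t) (at t)" and p: "\<And>t. (p has_vector_derivative r t) (at t)"
    and r: "\<And>t. (r has_vector_derivative - 4 * p t) (at t)"
  shows "z t = z 0 + (sin t * cos t) *\<^sub>R p 0 + ((sin t)\<^sup>2 / 2) *\<^sub>R r 0"
proof -
  have const: "g t = g 0" if "\<And>t. (g has_vector_derivative 0) (at t)" for g :: "real \<Rightarrow> complex" and t
    using has_derivative_zero_unique[of UNIV g 0 t] that by (auto simp: has_vector_derivative_def)
  have D: "((\<lambda>t. cos (2 * t)) has_real_derivative - 2 * sin (2 * t)) (at t)"
    "((\<lambda>t. sin (2 * t)) has_real_derivative 2 * cos (2 * t)) (at t)" for t :: real
    by (auto intro!: derivative_eq_intros)
  define K where "K = r 0 + 4 * z 0"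
  have K: "r t + 4 * z t = K" for t
  proof -
    have "((\<lambda>t. r t + 4 * z t) has_vector_derivative 0) (at t)" for t
      by (rule has_vector_derivative_eq_rhs[OF has_vector_derivative_add[OF r bounded_linear.has_vector_derivative[OF bounded_linear_mult_right z]]]) simp
    from const[OF this] show ?thesis by (simp add: K_def)
  qed
  have A: "cos (2 * t) *\<^sub>R r t + (2 * sin (2 * t)) *\<^sub>R p t = r 0" for t
  proof -
    have "((\<lambda>t. cos (2 * t) *\<^sub>R r t + (2 * sin (2 * t)) *\<^sub>R p t) has_vector_derivative 0) (at t)" for t
      by (rule has_vector_derivative_eq_rhs[OF has_vector_derivative_add[OF has_vector_derivative_scaleR[OF D(1) r]
            has_vector_derivative_scaleR[OF DERIV_cmult[OF D(2)] p]]]) (simp add: scaleR_conv_of_real algebra_simps)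
    from const[OF this] show ?thesis by simp
  qed
  have B: "sin (2 * t) *\<^sub>R r t - (2 * cos (2 * t)) *\<^sub>R p t = - 2 * p 0" for t
  proof -
    have "((\<lambda>t. sin (2 * t) *\<^sub>R r t - (2 * cos (2 * t)) *\<^sub>R p t) has_vector_derivative 0) (at t)" for t
      by (rule has_vector_derivative_eq_rhs[OF has_vector_derivative_diff[OF has_vector_derivative_scaleR[OF D(2) r]
            has_vector_derivative_scaleR[OF DERIV_cmult[OF D(1)] p]]]) (simp add: scaleR_conv_of_real algebra_simps)
    from const[OF this] show ?thesis by (simp add: scaleR_conv_of_real)
  qed
  define C S where "C = complex_of_real (cos (2 * t))" and "S = complex_of_real (sin (2 * t))"
  have CS: "C * C + S * S = 1"
    using sin_cos_squared_add[of "2 * t"] unfolding C_def S_def of_real_mult[symmetric] of_real_add[symmetric]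
    by (simp add: power2_eq_square add.commute)
  have "r t = (C * C + S * S) * r t" by (simp add: CS)
  also have "\<dots> = C * (C * r t + 2 * S * p t) + S * (S * r t - 2 * C * p t)" by (simp add: algebra_simps)
  also have "\<dots> = C * r 0 - 2 * S * p 0"
    using A[of t] B[of t] by (simp add: C_def S_def scaleR_conv_of_real)
  finally have "r t = C * r 0 - 2 * S * p 0" .
  moreover have "4 * z t = r 0 + 4 * z 0 - r t"
    using K[of t] by (simp add: K_def algebra_simps)
  ultimately have "4 * z t = r 0 + 4 * z 0 - (C * r 0 - 2 * S * p 0)"
    by simp
  moreover have "C = 1 - 2 * (of_real (sin t))\<^sup>2" "S = 2 * of_real (sin t) * of_real (cos t)"
    unfolding C_def S_def cos_double_sin sin_double by simp_all
  ultimately have "4 * z t = 4 * (z 0 + (sin t * cos t) *\<^sub>R p 0 + ((sin t)\<^sup>2 / 2) *\<^sub>R r 0)"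
    by (simp add: scaleR_conv_of_real algebra_simps)
  then show ?thesis by (subst (asm) mult_left_cancel) auto
qed

text \<open>The image of the great circle through q with velocity v agrees at s = 0, to second
  order, with the great circle of c and d. The pair (c, d) is only determined up to a common phase,
  and e may depend on the matrix entry.\<close>

definition osculates :: "(cp3 \<Rightarrow> cp3) \<Rightarrow> complex^4 \<Rightarrow> complex^4 \<Rightarrow> complex^4 \<Rightarrow> complex^4 \<Rightarrow> bool" where
  "osculates \<phi> q v c d \<longleftrightarrow> hip c c = 1 \<and> hip d d = 1 \<and> hip d c = 0 \<and>
    (\<forall>m n. projector_of (\<phi> (hopf q)) m n = c$m * cnj (c$n)) \<and>
    (\<forall>m n. \<exists>e>0. \<exists>z'.
      (\<forall>s. \<bar>s\<bar> < e \<longrightarrow> ((\<lambda>s. projector_of (\<phi> (hopf (cos s *\<^sub>R q + sin s *\<^sub>R v))) m n) has_vector_derivative z' s) (at s)) \<and>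
      z' 0 = c$m * cnj (d$n) + d$m * cnj (c$n) \<and>
      (z' has_vector_derivative 2 * (d$m * cnj (d$n)) - 2 * (c$m * cnj (c$n))) (at 0))"

text \<open>Dividing by cos s turns the great circle into the ray tan s b of the affine chart,
  pulled back by S; \<open>adj T\<close> undoes the normalization of the image.\<close>

lemma osculates_of_chart:
  assumes t: "transported_lift a U F S T 1 c0" and \<phi>: "\<And>z. z \<in> U \<Longrightarrow> hopf (F z) = \<phi> (hopf z)"
    and fc: "full_chart (transported_lift.tU U S 1) (transported_lift.tF F S T 1 c0)"
    and v: "hip v (S *v e1) = 0" "hip v v = 1"
  shows "osculates \<phi> (S *v e1) v (adj T *v e1)
    (adj T *v embed_coord 1 (fd (fixed_chart.f 0 (transported_lift.tF F S T 1 c0)) 0 (drop_coord 1 (adj S *v v))))"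
proof -
  interpret t: transported_lift a U F S T 1 c0 by (rule t)
  interpret n: full_chart t.tU t.tF by (rule fc)
  define b where "b = drop_coord 1 (adj S *v v)"
  define T' where "T' = adj T"
  have T': "T' \<in> Sp2" unfolding T'_def by (rule Sp2_adj[OF t.T])
  have "hip (adj S *v v) e1 = 0" using v(1) hip_adj[of "adj S" v e1] by simp
  then have "(adj S *v v) $ 1 = 0" by (simp add: hip_def sum_4 axis_component)
  then have eb: "embed_coord 1 b = adj S *v v" by (simp add: b_def embed_coord_drop vec_eq_iff axis_component)
  then have Sb: "S *v embed_coord 1 b = v" using Sp2_adj_mult(2)[OF t.S] by simp
  have ne: "norm (embed_coord 1 u) = norm u" for u
  proof -
    have "(norm (embed_coord 1 u))\<^sup>2 = (norm u)\<^sup>2" unfolding norm_vec4 norm_vec3 by (simp add: embed_coord_def)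
    then show ?thesis by simp
  qed
  have "norm v = 1" using v(2) unfolding hip_self by (metis norm_ge_zero of_real_eq_1_iff power2_eq_1_iff neg_0_le_iff_le not_one_le_zero)
  then have nb: "norm b = 1" using eb ne Sp2_norm[OF Sp2_adj[OF t.S]] by metis
  define k where "k = fd n.f 0 b"
  have nk: "norm k = 1" using n.isometric'[of b b] nb by (simp add: k_def norm_eq_sqrt_inner)
  have c: "hip (T' *v e1) (T' *v e1) = 1"
    unfolding Sp2_hip[OF T'] by (simp add: hip_def sum_4 axis_component)
  have d: "hip (T' *v embed_coord 1 k) (T' *v embed_coord 1 k) = 1"
    unfolding Sp2_hip[OF T'] unfolding hip_self ne nk by simp
  have dc: "hip (T' *v embed_coord 1 k) (T' *v e1) = 0"
    unfolding Sp2_hip[OF T'] by (simp add: hip_def sum_4 axis_component embed_coord_def)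
  have ncoord: "ncoord 0 u = e1 + embed_coord 1 u" for u by (simp add: vec4_eq_iff embed_coord_def axis_component)
  have en0: "ncoord 0 u \<noteq> 0" for u using norm_ncoord_nonzero by (metis norm_zero)
  have curve: "\<phi> (hopf (cos s *\<^sub>R (S *v e1) + sin s *\<^sub>R v)) = hopf (T' *v ncoord 0 (n.f (tan s *\<^sub>R b)))"
    if s: "tan s *\<^sub>R b \<in> n.V" "cos s \<noteq> 0" for s
  proof -
    let ?z = "ncoord 0 (tan s *\<^sub>R b)"
    have z: "?z \<in> t.tU" "t.tF ?z $ 1 \<noteq> 0" using s(1) by (auto simp: n.V_def)
    have U: "S *v ?z \<in> U" using z(1) by (simp add: t.tU_def)
    have "cos s *\<^sub>R (S *v e1) + sin s *\<^sub>R v = cos s *\<^sub>R (S *v ?z)"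
      unfolding ncoord using s(2) by (simp add: matrix_vector_right_distrib Sb scaleR_add_right tan_def)
    also have "\<dots> = of_real (cos s) *s (S *v ?z)" by (simp add: vec_eq_iff scaleR_conv_of_real[where 'a = complex])
    finally have "hopf (cos s *\<^sub>R (S *v e1) + sin s *\<^sub>R v) = hopf (S *v ?z)"
      using s(2) Sp2_nonzero[OF t.S en0] hopf_scale by simp
    then have 1: "\<phi> (hopf (cos s *\<^sub>R (S *v e1) + sin s *\<^sub>R v)) = hopf (F (S *v ?z))" using \<phi>[OF U] by simp
    have "t.tF ?z = c0 *s (T *v F (S *v ?z))" by (simp add: t.tF_def)
    then have "ncoord 0 (n.f (tan s *\<^sub>R b)) = (1 / t.tF ?z $ 1) *s (c0 *s (T *v F (S *v ?z)))"
      unfolding n.f_def ncoord_ncoord_inv[OF z(2)] by simp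
    then have "T' *v ncoord 0 (n.f (tan s *\<^sub>R b)) = (1 / t.tF ?z $ 1 * c0) *s F (S *v ?z)"
      unfolding T'_def by (simp add: Sp2_adj_mult(1)[OF t.T])
    moreover have "F (S *v ?z) \<noteq> 0" using t.F U by (auto simp: lift_iso_def)
    ultimately show ?thesis using 1 z(2) t.c hopf_scale by simp
  qed
  obtain e0 where e0: "e0 > 0" "\<And>s. \<bar>s\<bar> < e0 \<Longrightarrow> tan s *\<^sub>R b \<in> n.V" "\<And>s. \<bar>s\<bar> < e0 \<Longrightarrow> cos s \<noteq> 0"
    using n.tan_ray by metis
  have prp_curve: "projector_of (\<phi> (hopf (cos s *\<^sub>R (S *v e1) + sin s *\<^sub>R v))) m n = projector (T' *v ncoord 0 (n.f (tan s *\<^sub>R b))) m n"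
    if "\<bar>s\<bar> < e0" for s m n
    unfolding curve[OF e0(2,3)[OF that]] by (rule projector_of_hopf[OF Sp2_nonzero[OF T' en0]])
  have "projector_of (\<phi> (hopf (S *v e1))) m n = (T' *v e1) $ m * cnj ((T' *v e1) $ n)" for m n
  proof -
    have "norm (T' *v e1) = 1" unfolding Sp2_norm[OF T'] by (simp add: norm_axis_complex)
    then show ?thesis using prp_curve[of 0 m n] e0(1) by (simp add: projector_def n.f_0)
  qed
  moreover have "\<exists>e>0. \<exists>z'.
      (\<forall>s. \<bar>s\<bar> < e \<longrightarrow> ((\<lambda>s. projector_of (\<phi> (hopf (cos s *\<^sub>R (S *v e1) + sin s *\<^sub>R v))) m n) has_vector_derivative z' s) (at s)) \<and>
      z' 0 = (T' *v e1)$m * cnj ((T' *v embed_coord 1 k)$n) + (T' *v embed_coord 1 k)$m * cnj ((T' *v e1)$n) \<and>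
      (z' has_vector_derivative 2 * ((T' *v embed_coord 1 k)$m * cnj ((T' *v embed_coord 1 k)$n)) - 2 * ((T' *v e1)$m * cnj ((T' *v e1)$n))) (at 0)" for m n
  proof -
    obtain e z' where e: "e > 0" and z': "\<And>s. \<bar>s\<bar> < e \<Longrightarrow> ((\<lambda>s. projector (T' *v ncoord 0 (n.f (tan s *\<^sub>R b))) m n) has_vector_derivative z' s) (at s)"
      and z0: "z' 0 = (T' *v e1)$m * cnj ((T' *v embed_coord 1 k)$n) + (T' *v embed_coord 1 k)$m * cnj ((T' *v e1)$n)"
      "(z' has_vector_derivative 2 * ((T' *v embed_coord 1 k)$m * cnj ((T' *v embed_coord 1 k)$n)) - 2 * ((T' *v e1)$m * cnj ((T' *v e1)$n))) (at 0)"
      using n.geodesic_jet[OF T' nb, folded k_def] by blast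
    have "((\<lambda>s. projector_of (\<phi> (hopf (cos s *\<^sub>R (S *v e1) + sin s *\<^sub>R v))) m n) has_vector_derivative z' s) (at s)"
      if "\<bar>s\<bar> < min e e0" for s
      by (rule has_vector_derivative_transform_within_open[OF z', of s "{- e0<..<e0}"])
        (use that prp_curve in \<open>auto simp: abs_less_iff\<close>)
    then show ?thesis using e e0(1) z0 by (intro exI[of _ "min e e0"] conjI exI[of _ z']) auto
  qed
  ultimately show ?thesis
    unfolding osculates_def b_def[symmetric] T'_def[symmetric] k_def[symmetric] using c d dc by blast
qed

lemma full_chartI:
  assumes "a > 0" "a \<noteq> 1" "lift_iso a U F" "e1 \<in> U" "F e1 = e1"
  shows "full_chart U F"
  using lift_iso_all[OF assms(1-3)] assms(4,5) by unfold_locales auto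

lemma osculates_exists:
  assumes a: "a > 0" "a \<noteq> 1" and \<phi>: "isometry_cp3 a \<phi>" and q: "hip q q = 1" and v: "hip v q = 0" "hip v v = 1"
  obtains c d where "osculates \<phi> q v c d"
proof -
  have q0: "q \<noteq> 0" using q by auto
  obtain U F where F: "q \<in> U" "lift_iso a U F" "\<And>z. z \<in> U \<Longrightarrow> hopf (F z) = \<phi> (hopf z)"
    by (rule isometry_cp3_lift_iso[OF \<phi> q0]) (rule that)
  obtain S where S: "S \<in> Sp2" "S *v e1 = q" by (rule Sp2_transitive[OF q])
  obtain T c where t: "transported_lift a U F S T 1 c" "e1 \<in> transported_lift.tU U S 1"
    "transported_lift.tF F S T 1 c e1 = e1"
    by (rule normalize_lift[OF F(2,1) S(1), of 1]) (use S(2) in auto)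
  have "full_chart (transported_lift.tU U S 1) (transported_lift.tF F S T 1 c)"
    by (rule full_chartI[OF a transported_lift.lift_iso[OF t(1)] t(2,3)])
  from osculates_of_chart[OF t(1) F(3) this, of v] v S(2) show ?thesis using that by simp
qed

lemma has_vector_derivative_shift:
  "((\<lambda>s. g (t + s)) has_vector_derivative g') (at s) \<longleftrightarrow> (g has_vector_derivative g') (at (t + s))" for g :: "real \<Rightarrow> complex"
proof
  assume "((\<lambda>s. g (t + s)) has_vector_derivative g') (at s)"
  then have h: "((\<lambda>s. g (t + s)) has_vector_derivative g') (at ((t + s) - t))" by simp
  have "((\<lambda>u. u - t) has_vector_derivative 1) (at (t + s))" by (auto intro!: derivative_eq_intros)
  from vector_diff_chain_at[OF this h] show "(g has_vector_derivative g') (at (t + s))" by (simp add: o_def)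
next
  assume h: "(g has_vector_derivative g') (at (t + s))"
  have "((\<lambda>u. t + u) has_vector_derivative 1) (at s)" by (auto intro!: derivative_eq_intros)
  from vector_diff_chain_at[OF this h] show "((\<lambda>s. g (t + s)) has_vector_derivative g') (at s)" by (simp add: o_def)
qed

text \<open>The projector \<open>P\<close> onto the image of a geodesic satisfies \<open>P'' = 2 P' P' - 4 P\<close>, hence \<open>P''' = - 4 P'\<close>.\<close>

lemma osculates_global:
  assumes ex: "\<And>q v. hip q q = 1 \<Longrightarrow> hip v q = 0 \<Longrightarrow> hip v v = 1 \<Longrightarrow> \<exists>c d. osculates \<phi> q v c d"
    and q: "hip q q = 1" "hip v q = 0" "hip v v = 1" and geo0: "osculates \<phi> q v c d"
  shows "\<phi> (hopf (cos t *\<^sub>R q + sin t *\<^sub>R v)) = hopf (cos t *\<^sub>R c + sin t *\<^sub>R d)"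
proof -
  define \<gamma> where "\<gamma> t = cos t *\<^sub>R q + sin t *\<^sub>R v" for t
  define \<gamma>' where "\<gamma>' t = cos t *\<^sub>R v - sin t *\<^sub>R q" for t
  have qv: "hip q v = 0" using q(2) hip_commute by (metis complex_cnj_zero)
  have sc: "complex_of_real (sin t) * of_real (sin t) + of_real (cos t) * of_real (cos t) = 1" for t
    using sin_cos_squared_add[of t] unfolding of_real_mult[symmetric] of_real_add[symmetric] power2_eq_square by simp
  have unit: "hip (\<gamma> t) (\<gamma> t) = 1" "hip (\<gamma>' t) (\<gamma> t) = 0" "hip (\<gamma>' t) (\<gamma>' t) = 1" for t
    using sc[of t] by (simp_all add: \<gamma>_def \<gamma>'_def q qv scaleR_conv_of_real[where 'a = complex] add.commute)
  have shift: "cos s *\<^sub>R \<gamma> t + sin s *\<^sub>R \<gamma>' t = \<gamma> (t + s)" for s t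
    unfolding \<gamma>_def \<gamma>'_def cos_add sin_add by (simp add: algebra_simps)
  have "\<exists>c d. osculates \<phi> (\<gamma> t) (\<gamma>' t) c d" for t using ex unit by blast
  \<comment> \<open>An arbitrary choice at each t: no continuity is required, as c and d will be
    eliminated.\<close>
  then obtain C D where CD: "\<And>t. osculates \<phi> (\<gamma> t) (\<gamma>' t) (C t) (D t)" by metis
  define Z where "Z m n t = projector_of (\<phi> (hopf (\<gamma> t))) m n" for m n t
  define p where "p m n t = vector_derivative (Z m n) (at t)" for m n t
  have loc: "(Z m n has_vector_derivative p m n t) (at t) \<and> p m n t = c$m * cnj (d$n) + d$m * cnj (c$n) \<and>
      (p m n has_vector_derivative 2 * (d$m * cnj (d$n)) - 2 * (c$m * cnj (c$n))) (at t)"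
    if g: "osculates \<phi> (\<gamma> t) (\<gamma>' t) c d" for m n t c d
  proof -
    obtain e z' where e: "e > 0" and z: "\<And>s. \<bar>s\<bar> < e \<Longrightarrow> ((\<lambda>s. Z m n (t + s)) has_vector_derivative z' s) (at s)"
      and z0: "z' 0 = c$m * cnj (d$n) + d$m * cnj (c$n)"
      "(z' has_vector_derivative 2 * (d$m * cnj (d$n)) - 2 * (c$m * cnj (c$n))) (at 0)"
      using g unfolding osculates_def shift Z_def by blast
    have Z: "(Z m n has_vector_derivative z' s) (at (t + s))" if "\<bar>s\<bar> < e" for s
      using z[OF that] unfolding has_vector_derivative_shift .
    have pz: "p m n (t + s) = z' s" if "\<bar>s\<bar> < e" for s
      unfolding p_def by (rule vector_derivative_at[OF Z[OF that]])
    have "((\<lambda>s. p m n (t + s)) has_vector_derivative 2 * (d$m * cnj (d$n)) - 2 * (c$m * cnj (c$n))) (at 0)"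
      by (rule has_vector_derivative_transform_within_open[OF z0(2), of "{- e<..<e}"]) (use e pz in auto)
    then have "(p m n has_vector_derivative 2 * (d$m * cnj (d$n)) - 2 * (c$m * cnj (c$n))) (at (t + 0))"
      unfolding has_vector_derivative_shift .
    then show ?thesis using Z[of 0] pz[of 0] e z0(1) by simp
  qed
  \<comment> \<open>The second derivative in terms of Z and p alone: in this form it can be
    differentiated again, although c and d vary with t in an uncontrolled way.\<close>
  define r where "r m n t = 2 * (\<Sum>k\<in>UNIV. p m k t * p k n t) - 4 * Z m n t" for m n t
  have alg: "r m n t = 2 * (d$m * cnj (d$n)) - 2 * (c$m * cnj (c$n))"
    and alg': "2 * (\<Sum>k\<in>UNIV. p m k t * r k n t + r m k t * p k n t) - 4 * p m n t = - 4 * p m n t"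
    if g: "osculates \<phi> (\<gamma> t) (\<gamma>' t) c d" for m n t c d
  proof -
    have P: "p m n t = c$m * cnj (d$n) + d$m * cnj (c$n)" for m n using loc[OF g] by blast
    have Z: "Z m n t = c$m * cnj (c$n)" for m n using g unfolding osculates_def Z_def by blast
    have h: "hip c c = 1" "hip d d = 1" "hip d c = 0" using g by (auto simp: osculates_def)
    then have h': "hip c d = 0" using hip_commute by (metis complex_cnj_zero)
    have hs: "(\<Sum>k\<in>UNIV. (x * cnj (u$k) + y * cnj (w$k)) * (u'$k * x' + w'$k * y')) =
      x * x' * hip u' u + x * y' * hip w' u + y * x' * hip u' w + y * y' * hip w' w" for x y x' y' u w u' w'
      by (simp add: hip_def sum_4 algebra_simps)
    have R: "r m n t = 2 * (d$m * cnj (d$n)) - 2 * (c$m * cnj (c$n))" for m n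
    proof -
      have "(\<Sum>k\<in>UNIV. p m k t * p k n t) = c$m * cnj (c$n) + d$m * cnj (d$n)"
        using hs[of "c$m" d "d$m" c c "cnj (d$n)" d "cnj (c$n)"] unfolding P by (simp add: h h')
      then show ?thesis unfolding r_def Z by simp
    qed
    then show "r m n t = 2 * (d$m * cnj (d$n)) - 2 * (c$m * cnj (c$n))" .
    have 1: "(\<Sum>k\<in>UNIV. p m k t * r k n t) = 2 * (c$m * cnj (d$n)) - 2 * (d$m * cnj (c$n))"
    proof -
      have "(\<Sum>k\<in>UNIV. p m k t * r k n t) = (\<Sum>k\<in>UNIV. (c$m * cnj (d$k) + d$m * cnj (c$k)) * (d$k * (2 * cnj (d$n)) + c$k * (- 2 * cnj (c$n))))"
        unfolding P R by (simp add: algebra_simps)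
      then show ?thesis unfolding hs by (simp add: h h')
    qed
    have 2: "(\<Sum>k\<in>UNIV. r m k t * p k n t) = 2 * (d$m * cnj (c$n)) - 2 * (c$m * cnj (d$n))"
    proof -
      have "(\<Sum>k\<in>UNIV. r m k t * p k n t) = (\<Sum>k\<in>UNIV. ((2 * d$m) * cnj (d$k) + (- 2 * c$m) * cnj (c$k)) * (d$k * cnj (c$n) + c$k * cnj (d$n)))"
        unfolding P R by (simp add: algebra_simps)
      then show ?thesis unfolding hs by (simp add: h h')
    qed
    show "2 * (\<Sum>k\<in>UNIV. p m k t * r k n t + r m k t * p k n t) - 4 * p m n t = - 4 * p m n t"
      unfolding sum.distrib 1 2 by simp
  qed
  have Zp: "(Z m n has_vector_derivative p m n t) (at t)" for m n t using loc[OF CD] by blast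
  have projector: "(p m n has_vector_derivative r m n t) (at t)" for m n t unfolding alg[OF CD] using loc[OF CD] by blast
  have rp: "(r m n has_vector_derivative - 4 * p m n t) (at t)" for m n t
  proof -
    have "((\<lambda>t. \<Sum>k\<in>UNIV. p m k t * p k n t) has_vector_derivative (\<Sum>k\<in>UNIV. p m k t * r k n t + r m k t * p k n t)) (at t)"
      by (rule has_vector_derivative_sum) (rule has_vector_derivative_mult[OF projector projector])
    from has_vector_derivative_diff[OF bounded_linear.has_vector_derivative[OF bounded_linear_mult_right this]
        bounded_linear.has_vector_derivative[OF bounded_linear_mult_right Zp], of 2 4 m n]
    have "((\<lambda>t. 2 * (\<Sum>k\<in>UNIV. p m k t * p k n t) - 4 * Z m n t) has_vector_derivative - 4 * p m n t) (at t)"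
      unfolding alg'[OF CD] .
    moreover have "r m n = (\<lambda>t. 2 * (\<Sum>k\<in>UNIV. p m k t * p k n t) - 4 * Z m n t)"
      by (rule ext) (rule r_def)
    ultimately show ?thesis by (simp only:)
  qed
  have g0: "osculates \<phi> (\<gamma> 0) (\<gamma>' 0) c d" using geo0 by (simp add: \<gamma>_def \<gamma>'_def)
  have h: "hip c c = 1" "hip d d = 1" "hip d c = 0" using geo0 by (auto simp: osculates_def)
  then have h': "hip c d = 0" using hip_commute by (metis complex_cnj_zero)
  define y where "y = cos t *\<^sub>R c + sin t *\<^sub>R d"
  have yy: "hip y y = 1" using sc[of t] by (simp add: y_def h h' scaleR_conv_of_real[where 'a = complex] add.commute)
  then have "(norm y)\<^sup>2 = 1" unfolding hip_self by (metis of_real_eq_1_iff)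
  then have n1: "norm y = 1" using norm_ge_zero[of y] by (simp add: power2_eq_1_iff)
  then have ny: "norm y = 1" "y \<noteq> 0" by auto
  obtain x where x: "x \<noteq> 0" "hopf x = \<phi> (hopf (\<gamma> t))" by (rule hopf_surj)
  have "projector x m n = projector y m n" for m n
  proof -
    have "Z m n 0 = c$m * cnj (c$n)" using g0 unfolding osculates_def Z_def by blast
    moreover have "p m n 0 = c$m * cnj (d$n) + d$m * cnj (c$n)" using loc[OF g0] by blast
    ultimately have "Z m n t = c$m * cnj (c$n) + (sin t * cos t) *\<^sub>R (c$m * cnj (d$n) + d$m * cnj (c$n)) +
        ((sin t)\<^sup>2 / 2) *\<^sub>R (2 * (d$m * cnj (d$n)) - 2 * (c$m * cnj (c$n)))"
      using third_order_ode[OF Zp projector rp, of m n t] alg[OF g0, of m n] by simp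
    also have "\<dots> = (complex_of_real (sin t) * of_real (sin t) + of_real (cos t) * of_real (cos t)) * (c$m * cnj (c$n))
      + (sin t * cos t) *\<^sub>R (c$m * cnj (d$n) + d$m * cnj (c$n)) + (sin t)\<^sup>2 *\<^sub>R (d$m * cnj (d$n)) - (sin t)\<^sup>2 *\<^sub>R (c$m * cnj (c$n))"
      unfolding sc by (simp add: scaleR_conv_of_real algebra_simps)
    also have "\<dots> = y$m * cnj (y$n)"
      unfolding y_def by (simp add: scaleR_conv_of_real[where 'a = complex] algebra_simps power2_eq_square)
    finally have "Z m n t = projector y m n" by (simp add: projector_def ny)
    then show ?thesis unfolding Z_def x(2)[symmetric] projector_of_hopf[OF x(1)] .
  qed
  from hopf_eq_of_projector[OF x(1) ny(2) this] show ?thesis using x(2) by (simp add: \<gamma>_def y_def)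
qed

section \<open>Global form of an isometry\<close>

lemma great_circle:
  assumes "x \<noteq> 0"
  obtains t b k where "norm b = 1" "k \<noteq> 0" "x = k *s (cos t *\<^sub>R e1 + sin t *\<^sub>R embed_coord 1 b)"
proof -
  \<comment> \<open>A phase that makes the first coordinate real and nonnegative, hence the cosine
    of an angle after normalization.\<close>
  obtain \<mu> where \<mu>: "\<mu> \<noteq> 0" "x$1 * \<mu> = of_real (cmod (x$1))" "cmod \<mu> = 1"
  proof (cases "x$1 = 0")
    case True
    then show ?thesis using that[of 1] by simp
  next
    case False
    then show ?thesis
      using that[of "cnj (x$1) / of_real (cmod (x$1))"] complex_norm_square[of "x$1"]
      by (simp add: norm_divide field_simps power2_eq_square)
  qed
  define y where "y = (\<mu> / of_real (norm x)) *s x"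
  have y1: "y$1 = of_real (cmod (x$1) / norm x)" using \<mu>(2) by (simp add: y_def mult.commute)
  have ny: "norm y = 1"
    unfolding y_def norm_smult4 norm_divide \<mu>(3) using assms by simp
  define h where "h = drop_coord 1 y"
  have yh: "y = y$1 *s e1 + embed_coord 1 h" by (simp add: h_def embed_coord_drop vec_eq_iff axis_component)
  have "(norm h)\<^sup>2 + (cmod (y$1))\<^sup>2 = 1"
    using ny norm_vec4[of y] unfolding norm_vec3 by (simp add: h_def drop_coord_def)
  then have "(cmod (x$1) / norm x)\<^sup>2 + (norm h)\<^sup>2 = 1" unfolding y1 norm_of_real by simp
  then obtain t where t: "cmod (x$1) / norm x = cos t" "norm h = sin t" using sincos_total_2pi by metis
  obtain b where b: "norm b = 1" "h = sin t *\<^sub>R b"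
  proof (cases "h = 0")
    case True
    then show ?thesis using that[of "axis 1 1"] t(2) by (simp add: norm_axis_complex)
  next
    case False
    then have "norm ((1 / norm h) *\<^sub>R h) = 1" "h = norm h *\<^sub>R ((1 / norm h) *\<^sub>R h)" by simp_all
    then show ?thesis using that t(2) by metis
  qed
  have "y = cos t *\<^sub>R e1 + sin t *\<^sub>R embed_coord 1 b"
    by (subst yh) (simp add: y1 t(1) b(2), simp add: vec_eq_iff scaleR_conv_of_real[where 'a = complex] axis_component)
  moreover have "x = (of_real (norm x) / \<mu>) *s y" using \<mu>(1) assms by (simp add: y_def vec_eq_iff)
  moreover have "of_real (norm x) / \<mu> \<noteq> 0" using \<mu>(1) assms by simp
  ultimately show ?thesis using that b(1) by metis
qed

text \<open>Every point lies on a great circle through \<open>e1\<close>, so the differential at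
  \<open>e1\<close> determines \<phi>. That differential is the one of an element of
  \<open>Sp2\<close>, possibly after conjugation, up to the scalar \<zeta>.\<close>

lemma isometry_cp3_form:
  assumes a: "a > 0" "a \<noteq> 1" and \<phi>: "isometry_cp3 a \<phi>"
  shows "\<exists>A\<in>Sp2. (\<forall>x. x \<noteq> 0 \<longrightarrow> \<phi> (hopf x) = hopf (A *v x)) \<or> (\<forall>x. x \<noteq> 0 \<longrightarrow> \<phi> (hopf x) = hopf (A *v conj_vec x))"
proof -
  have e10: "e1 \<noteq> 0" by (simp add: axis_eq_0_iff)
  have he: "hip e1 e1 = 1" by (simp add: hip_def sum_4 axis_component)
  obtain U F where F: "e1 \<in> U" "lift_iso a U F" "\<And>z. z \<in> U \<Longrightarrow> hopf (F z) = \<phi> (hopf z)"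
    by (rule isometry_cp3_lift_iso[OF \<phi> e10]) (rule that)
  obtain T c where t: "transported_lift a U F (mat 1) T 1 c" "e1 \<in> transported_lift.tU U (mat 1) 1"
    "transported_lift.tF F (mat 1) T 1 c e1 = e1"
    by (rule normalize_lift[OF F(2,1) Sp2_one, of 1]) auto
  interpret t: transported_lift a U F "mat 1" T 1 c by (rule t)
  have fc: "full_chart t.tU t.tF" by (rule full_chartI[OF a t.lift_iso t(2,3)])
  interpret n: full_chart t.tU t.tF by (rule fc)
  have T': "adj T \<in> Sp2" by (rule Sp2_adj[OF t.T])
  have hb: "hip (embed_coord 1 b) e1 = 0" for b by (simp add: hip_def sum_4 axis_component embed_coord_def)
  have hbb: "hip (embed_coord 1 b) (embed_coord 1 b) = 1" if "norm b = 1" for b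
    unfolding hip_self norm_vec4 using that norm_vec3[of b] by (simp add: embed_coord_def flip: of_real_power of_real_add)
  have ex: "\<exists>c d. osculates \<phi> q v c d" if "hip q q = 1" "hip v q = 0" "hip v v = 1" for q v
    by (rule osculates_exists[OF a \<phi> that]) blast
  have main: "\<phi> (hopf (cos t *\<^sub>R e1 + sin t *\<^sub>R embed_coord 1 b)) = hopf (adj T *v (cos t *\<^sub>R e1 + sin t *\<^sub>R embed_coord 1 (fd n.f 0 b)))"
    if b: "norm b = 1" for t b
  proof -
    have am: "adj (mat 1) *v x = x" for x using Sp2_adj_mult(1)[OF Sp2_one, of x] by simp
    have "osculates \<phi> (mat 1 *v e1) (embed_coord 1 b) (adj T *v e1) (adj T *v embed_coord 1 (fd n.f 0 (drop_coord 1 (adj (mat 1) *v embed_coord 1 b))))"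
      by (rule osculates_of_chart[OF t(1) F(3) fc]) (use hb hbb[OF b] in auto)
    then have g: "osculates \<phi> e1 (embed_coord 1 b) (adj T *v e1) (adj T *v embed_coord 1 (fd n.f 0 b))"
      by (simp add: am)
    have "\<phi> (hopf (cos t *\<^sub>R e1 + sin t *\<^sub>R embed_coord 1 b)) = hopf (cos t *\<^sub>R (adj T *v e1) + sin t *\<^sub>R (adj T *v embed_coord 1 (fd n.f 0 b)))"
      by (rule osculates_global[OF _ he hb hbb[OF b] g]) (rule ex)
    then show ?thesis
      unfolding matrix_vector_right_distrib mult_vec_linear .
  qed
  obtain B \<zeta> where B: "B \<in> Sp2" "\<zeta> \<noteq> 0" "B *v e1 = \<zeta> *s e1"
    "(\<forall>u. B *v embed_coord 1 u = \<zeta> *s embed_coord 1 (fd n.f 0 u)) \<or> (\<forall>u. B *v conj_vec (embed_coord 1 u) = \<zeta> *s embed_coord 1 (fd n.f 0 u))"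
    by (rule n.differential_Sp2) (rule that; assumption)
  \<comment> \<open>B realizes the differential of the normalized lift and \<open>adj T\<close>
    moves the image point back from \<open>e1\<close>.\<close>
  define A where "A = adj T ** B"
  have A: "A \<in> Sp2" unfolding A_def by (rule Sp2_mult[OF T' B(1)])
  have cs: "conj_vec (r *\<^sub>R x) = r *\<^sub>R conj_vec x" for r x by (simp add: vec_eq_iff)
  have ce: "conj_vec e1 = e1" by (simp add: vec_eq_iff axis_component)
  have nz: "cos t *\<^sub>R e1 + sin t *\<^sub>R embed_coord 1 b \<noteq> 0" if "norm b = 1" for t b
  proof
    assume "cos t *\<^sub>R e1 + sin t *\<^sub>R embed_coord 1 b = 0"
    then have "drop_coord 1 (cos t *\<^sub>R e1 + sin t *\<^sub>R embed_coord 1 b) = 0" "(cos t *\<^sub>R e1 + sin t *\<^sub>R embed_coord 1 b) $ 1 = 0" by simp_all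
    then have "sin t *\<^sub>R b = 0" "cos t = 0" by (simp_all add: axis_component)
    then show False using that sin_cos_squared_add[of t] by auto
  qed
  from B(4) show ?thesis
  proof
    assume *: "\<forall>u. B *v embed_coord 1 u = \<zeta> *s embed_coord 1 (fd n.f 0 u)"
    have "\<phi> (hopf x) = hopf (A *v x)" if x0: "x \<noteq> 0" for x
    proof -
      obtain t b k where x: "norm b = 1" "k \<noteq> 0" "x = k *s (cos t *\<^sub>R e1 + sin t *\<^sub>R embed_coord 1 b)"
        by (rule great_circle[OF x0])
      let ?y = "cos t *\<^sub>R e1 + sin t *\<^sub>R embed_coord 1 b"
      have "A *v x = (k * \<zeta>) *s (adj T *v (cos t *\<^sub>R e1 + sin t *\<^sub>R embed_coord 1 (fd n.f 0 b)))"
        unfolding A_def x(3) matrix_vector_mul_assoc[symmetric]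
        by (simp add: matrix_vector_right_distrib B(3) *) (simp add: vec_eq_iff scaleR_conv_of_real[where 'a = complex] algebra_simps)
      moreover have "A *v x \<noteq> 0" by (rule Sp2_nonzero[OF A x0])
      ultimately have "hopf (A *v x) = hopf (adj T *v (cos t *\<^sub>R e1 + sin t *\<^sub>R embed_coord 1 (fd n.f 0 b)))"
        using hopf_scale x(2) B(2) by (metis mult_eq_0_iff vector_mul_eq_0)
      moreover have "hopf x = hopf ?y" unfolding x(3) by (rule hopf_scale[OF x(2) nz[OF x(1)]])
      ultimately show ?thesis using main[OF x(1)] by simp
    qed
    then show ?thesis using A by blast
  next
    assume *: "\<forall>u. B *v conj_vec (embed_coord 1 u) = \<zeta> *s embed_coord 1 (fd n.f 0 u)"
    have "\<phi> (hopf x) = hopf (A *v conj_vec x)" if x0: "x \<noteq> 0" for x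
    proof -
      obtain t b k where x: "norm b = 1" "k \<noteq> 0" "x = k *s (cos t *\<^sub>R e1 + sin t *\<^sub>R embed_coord 1 b)"
        by (rule great_circle[OF x0])
      let ?y = "cos t *\<^sub>R e1 + sin t *\<^sub>R embed_coord 1 b"
      have "A *v conj_vec x = (cnj k * \<zeta>) *s (adj T *v (cos t *\<^sub>R e1 + sin t *\<^sub>R embed_coord 1 (fd n.f 0 b)))"
        unfolding A_def x(3) matrix_vector_mul_assoc[symmetric]
        by (simp add: matrix_vector_right_distrib B(3) * cs ce) (simp add: vec_eq_iff scaleR_conv_of_real[where 'a = complex] algebra_simps)
      moreover have "A *v conj_vec x \<noteq> 0" using Sp2_nonzero[OF A] x0 by simp
      ultimately have "hopf (A *v conj_vec x) = hopf (adj T *v (cos t *\<^sub>R e1 + sin t *\<^sub>R embed_coord 1 (fd n.f 0 b)))"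
        using hopf_scale x(2) B(2) by (metis complex_cnj_zero_iff mult_eq_0_iff vector_mul_eq_0)
      moreover have "hopf x = hopf ?y" unfolding x(3) by (rule hopf_scale[OF x(2) nz[OF x(1)]])
      ultimately show ?thesis using main[OF x(1)] by simp
    qed
    then show ?thesis using A by blast
  qed
qed

section \<open>The isometry group\<close>

lemma conj_cp3_hopf: "q \<noteq> 0 \<Longrightarrow> conj_cp3 (hopf q) = hopf (conj_vec q)"
  unfolding hopf_def by (rule conj_cp3.abs_eq) (auto intro: exI[of _ 1])

lemma conj_cp3_conj_cp3 [simp]: "conj_cp3 (conj_cp3 p) = p"
proof -
  obtain q where "q \<noteq> 0" "hopf q = p" by (rule hopf_surj)
  then show ?thesis using conj_cp3_hopf[of q] conj_cp3_hopf[of "conj_vec q"] by simp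
qed

definition act :: "complex^4^4 \<Rightarrow> cp3 \<Rightarrow> cp3" where
  "act A p = hopf (A *v fibre_point p)"

lemma act_hopf:
  assumes "A \<in> Sp2" "q \<noteq> 0"
  shows "act A (hopf q) = hopf (A *v q)"
proof -
  have "fibre_point (hopf q) \<noteq> 0" using fibre_point[of "hopf q"] by auto
  then obtain c where "c \<noteq> 0" "fibre_point (hopf q) = c *s q"
    using hopf_eq_iff[OF assms(2)] fibre_point(2)[of "hopf q"] by metis
  then show ?thesis
    unfolding act_def using hopf_scale Sp2_nonzero[OF assms] by simp
qed

lemma cp3_ext:
  assumes "\<And>q. q \<noteq> 0 \<Longrightarrow> f (hopf q) = g (hopf q)"
  shows "f = g"
proof
  fix p
  obtain q where "q \<noteq> 0" "hopf q = p" by (rule hopf_surj)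
  then show "f p = g p" using assms by metis
qed

lemma act_mult: "A \<in> Sp2 \<Longrightarrow> B \<in> Sp2 \<Longrightarrow> act A \<circ> act B = act (A ** B)"
  by (rule cp3_ext) (simp add: act_hopf Sp2_nonzero Sp2_mult matrix_vector_mul_assoc)

lemma act_one: "act (mat 1) = id"
  by (rule cp3_ext) (simp add: act_hopf Sp2_one)

lemma act_adj: "A \<in> Sp2 \<Longrightarrow> act (adj A) \<circ> act A = id" "A \<in> Sp2 \<Longrightarrow> act A \<circ> act (adj A) = id"
  by (rule cp3_ext; simp add: act_hopf Sp2_nonzero Sp2_adj Sp2_adj_mult)+

lemma conj_act: "A \<in> Sp2 \<Longrightarrow> conj_cp3 \<circ> act A = act (cnj_mat A) \<circ> conj_cp3"
  by (rule cp3_ext) (simp add: act_hopf Sp2_nonzero Sp2_cnj_mat conj_cp3_hopf cnj_mat_mult)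

lemma conj_conj: "conj_cp3 \<circ> conj_cp3 = id"
  by (rule ext) simp

lemma Sp2_maps_eq: "Sp2_maps = act ` Sp2"
proof (intro equalityI subsetI)
  fix \<phi> assume "\<phi> \<in> Sp2_maps"
  then obtain A where A: "A \<in> Sp2" "\<And>q. q \<in> sphere 0 1 \<Longrightarrow> hopf (A *v q) = \<phi> (hopf q)"
    unfolding Sp2_maps_def by blast
  have "\<phi> = act A"
    by (rule ext) (metis A(2) act_def fibre_point)
  then show "\<phi> \<in> act ` Sp2" using A(1) by blast
next
  fix \<phi> assume "\<phi> \<in> act ` Sp2"
  then obtain A where A: "A \<in> Sp2" "\<phi> = act A" by blast
  have "hopf (A *v q) = \<phi> (hopf q)" if "q \<in> sphere 0 1" for q
  proof -
    have "q \<noteq> 0" using that by auto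
    then show ?thesis using act_hopf A by simp
  qed
  then show "\<phi> \<in> Sp2_maps" unfolding Sp2_maps_def using A(1) by blast
qed

lemma isometry_act: "A \<in> Sp2 \<Longrightarrow> isometry_cp3 a (act A)"
proof (rule isometry_cp3_of_linear[OF bounded_linear_mult_vec[of A]])
  assume A: "A \<in> Sp2"
  show "A *v z \<noteq> 0" "hopf (A *v z) = act A (hopf z)" if "z \<noteq> 0" for z
    using Sp2_nonzero[OF A that] act_hopf[OF A that] by simp_all
  show "G a (A *v z) (A *v x) (A *v y) = G a z x y" for z x y
    by (rule G_Sp2[OF A])
qed

lemma isometry_act_conj: "A \<in> Sp2 \<Longrightarrow> isometry_cp3 a (act A \<circ> conj_cp3)"
proof (rule isometry_cp3_of_linear[OF bounded_linear_compose[OF bounded_linear_mult_vec[of A] bounded_linear_conj_vec]])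
  assume A: "A \<in> Sp2"
  show "A *v conj_vec z \<noteq> 0" "hopf (A *v conj_vec z) = (act A \<circ> conj_cp3) (hopf z)" if "z \<noteq> 0" for z
    using Sp2_nonzero[OF A] act_hopf[OF A] that by (simp_all add: conj_cp3_hopf)
  show "G a (A *v conj_vec z) (A *v conj_vec x) (A *v conj_vec y) = G a z x y" for z x y
    unfolding G_Sp2[OF A] by (rule G_conj_vec)
qed

lemma isometry_iff:
  assumes "a > 0" "a \<noteq> 1"
  shows "isometry_cp3 a \<phi> \<longleftrightarrow> (\<exists>A\<in>Sp2. \<phi> = act A \<or> \<phi> = act A \<circ> conj_cp3)"
proof
  assume "isometry_cp3 a \<phi>"
  then obtain A where A: "A \<in> Sp2"
    "(\<forall>x. x \<noteq> 0 \<longrightarrow> \<phi> (hopf x) = hopf (A *v x)) \<or> (\<forall>x. x \<noteq> 0 \<longrightarrow> \<phi> (hopf x) = hopf (A *v conj_vec x))"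
    using isometry_cp3_form[OF assms] by blast
  have "\<phi> = act A \<or> \<phi> = act A \<circ> conj_cp3"
    using A(2)
  proof
    assume "\<forall>x. x \<noteq> 0 \<longrightarrow> \<phi> (hopf x) = hopf (A *v x)"
    then have "\<phi> = act A" by (intro cp3_ext) (simp add: act_hopf[OF A(1)])
    then show ?thesis ..
  next
    assume "\<forall>x. x \<noteq> 0 \<longrightarrow> \<phi> (hopf x) = hopf (A *v conj_vec x)"
    then have "\<phi> = act A \<circ> conj_cp3" by (intro cp3_ext) (simp add: act_hopf[OF A(1)] conj_cp3_hopf)
    then show ?thesis ..
  qed
  then show "\<exists>A\<in>Sp2. \<phi> = act A \<or> \<phi> = act A \<circ> conj_cp3" using A(1) by blast
qed (use isometry_act isometry_act_conj in blast)

text \<open>A linear map inducing conjugation would scale the first two basis vectors by equal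
  factors, because of their sum, and by opposite ones, because of e1 + i e2.\<close>

lemma conj_not_act: "A \<in> Sp2 \<Longrightarrow> conj_cp3 \<noteq> act A"
proof
  assume A: "A \<in> Sp2" and c: "conj_cp3 = act A"
  have ex: "\<exists>k. k \<noteq> 0 \<and> A *v x = k *s conj_vec x" if "x \<noteq> 0" for x
  proof -
    have "hopf (conj_vec x) = hopf (A *v x)"
      using fun_cong[OF c, of "hopf x"] conj_cp3_hopf[OF that] act_hopf[OF A that] by simp
    then show ?thesis using hopf_eq_iff[of "conj_vec x" "A *v x"] that Sp2_nonzero[OF A that] by simp
  qed
  have add: "A *v (x + y) = A *v x + A *v y" for x y by (rule matrix_vector_right_distrib)
  have nz: "e1 \<noteq> 0" "axis 2 1 \<noteq> (0::complex^4)" by (simp_all add: axis_eq_0_iff)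
  have nz': "e1 + axis 2 1 \<noteq> 0" "e1 + \<i> *s axis 2 1 \<noteq> 0" by (simp_all add: vec4_eq_iff axis_component)
  obtain k where k: "k \<noteq> 0" "A *v e1 = k *s conj_vec e1" using ex[OF nz(1)] by blast
  obtain l where l: "A *v axis 2 1 = l *s conj_vec (axis 2 1)" using ex[OF nz(2)] by blast
  obtain m where m: "A *v (e1 + axis 2 1) = m *s conj_vec (e1 + axis 2 1)" using ex[OF nz'(1)] by blast
  obtain n where n: "A *v (e1 + \<i> *s axis 2 1) = n *s conj_vec (e1 + \<i> *s axis 2 1)" using ex[OF nz'(2)] by blast
  have "k = l" using m unfolding add k(2) l by (simp add: vec4_eq_iff axis_component)
  moreover have "\<i> * l = - (n * \<i>)" "k = n"
    using n unfolding add mult_vec_linear k(2) l by (simp_all add: vec4_eq_iff axis_component)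
  ultimately show False using k(1) by simp
qed

theorem theorem5p5:
  fixes a :: real
  assumes "a > 0" and "a \<noteq> 1"
  shows "Sp2 = SU4 \<inter> Sp4C \<and>
    internal_semidirect_product (Iso_CP3 a) Sp2_maps (generate (Iso_CP3 a) {conj_cp3}) \<and>
    (Iso_CP3 a)\<lparr>carrier := generate (Iso_CP3 a) {conj_cp3}\<rparr> \<cong> integer_mod_group 2"
proof (intro conjI)
  let ?G = "Iso_CP3 a"
  have G: "carrier ?G = {\<phi>. isometry_cp3 a \<phi>}" "\<And>x y. x \<otimes>\<^bsub>?G\<^esub> y = x \<circ> y" "\<one>\<^bsub>?G\<^esub> = id"
    by (simp_all add: Iso_CP3_def)
  note iso = isometry_iff[OF assms]
  \<comment> \<open>Normal form of all isometries; products and inverses are brought back to it by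
    moving s across \<open>act B\<close> with \<open>commute\<close>, which conjugates the
    matrix.\<close>
  have carrier: "\<phi> \<in> carrier ?G \<longleftrightarrow> (\<exists>A\<in>Sp2. \<exists>s\<in>{id, conj_cp3}. \<phi> = act A \<circ> s)" for \<phi>
    unfolding G iso by auto
  have commute: "\<exists>B'\<in>Sp2. s \<circ> act B = act B' \<circ> s" if "s \<in> {id, conj_cp3}" "B \<in> Sp2" for s B
    using that conj_act[OF that(2)] Sp2_cnj_mat[OF that(2)] by auto
  have ss: "s \<circ> s = id" if "s \<in> {id, conj_cp3}" for s using that conj_conj by auto
  interpret G: group ?G
  proof (rule groupI; unfold G(2,3))
    fix x y assume "x \<in> carrier ?G" "y \<in> carrier ?G"
    then obtain A B s t where x: "A \<in> Sp2" "s \<in> {id, conj_cp3}" "x = act A \<circ> s"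
      and y: "B \<in> Sp2" "t \<in> {id, conj_cp3}" "y = act B \<circ> t" unfolding carrier by blast
    obtain B' where B': "B' \<in> Sp2" "s \<circ> act B = act B' \<circ> s" using commute[OF x(2) y(1)] by blast
    have "x \<circ> y = act A \<circ> (s \<circ> act B) \<circ> t" unfolding x y by (simp add: comp_assoc)
    also have "\<dots> = act (A ** B') \<circ> (s \<circ> t)" unfolding B'(2) act_mult[OF x(1) B'(1), symmetric] by (simp add: comp_assoc)
    finally have "x \<circ> y = act (A ** B') \<circ> (s \<circ> t)" .
    moreover have "s \<circ> t \<in> {id, conj_cp3}" using x(2) y(2) conj_conj by auto
    ultimately show "x \<circ> y \<in> carrier ?G" unfolding carrier using Sp2_mult[OF x(1) B'(1)] by blast
  next
    show "id \<in> carrier ?G" unfolding carrier using Sp2_one act_one by force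
  next
    fix x assume "x \<in> carrier ?G"
    then obtain A s where x: "A \<in> Sp2" "s \<in> {id, conj_cp3}" "x = act A \<circ> s" unfolding carrier by blast
    obtain B where B: "B \<in> Sp2" "s \<circ> act (adj A) = act B \<circ> s" using commute[OF x(2) Sp2_adj[OF x(1)]] by blast
    have "(act B \<circ> s) \<circ> x = s \<circ> (act (adj A) \<circ> act A) \<circ> s" unfolding B(2)[symmetric] x(3) by (simp add: comp_assoc)
    also have "\<dots> = id" unfolding act_adj(1)[OF x(1)] using ss[OF x(2)] by simp
    finally have "(act B \<circ> s) \<circ> x = id" .
    moreover have "act B \<circ> s \<in> carrier ?G" unfolding carrier using B(1) x(2) by blast
    ultimately show "\<exists>y\<in>carrier ?G. y \<circ> x = id" by (rule bexI)
  qed (simp_all add: comp_assoc)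
  have act_carrier: "act A \<in> carrier ?G" if "A \<in> Sp2" for A
    unfolding G using isometry_act[OF that] by simp
  have conj_carrier: "conj_cp3 \<in> carrier ?G"
    unfolding carrier using Sp2_one act_one by (intro bexI[of _ "mat 1"] bexI[of _ conj_cp3]) auto
  have inv_act: "inv\<^bsub>?G\<^esub> (act A) = act (adj A)" if "A \<in> Sp2" for A
    by (rule G.inv_equality) (use act_adj(1)[OF that] act_carrier that Sp2_adj G in auto)
  have inv_conj: "inv\<^bsub>?G\<^esub> conj_cp3 = conj_cp3"
    by (rule G.inv_equality) (use conj_conj conj_carrier G in auto)
  have gen: "generate ?G {conj_cp3} = {id, conj_cp3}"
  proof (intro equalityI subsetI)
    fix x assume "x \<in> generate ?G {conj_cp3}"
    then show "x \<in> {id, conj_cp3}"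
    proof induction
      case (eng h1 h2)
      then show ?case using conj_conj by (auto simp: G)
    qed (use inv_conj G in auto)
  next
    fix x assume "x \<in> {id, conj_cp3}"
    then show "x \<in> generate ?G {conj_cp3}"
      using generate.one[of ?G "{conj_cp3}"] generate.incl[of conj_cp3 "{conj_cp3}" ?G] G by auto
  qed
  have sub: "subgroup Sp2_maps ?G"
    unfolding Sp2_maps_eq
  proof
    show "act ` Sp2 \<subseteq> carrier ?G" using act_carrier by blast
    show "x \<otimes>\<^bsub>?G\<^esub> y \<in> act ` Sp2" if "x \<in> act ` Sp2" "y \<in> act ` Sp2" for x y
      using that act_mult Sp2_mult unfolding G by force
    show "\<one>\<^bsub>?G\<^esub> \<in> act ` Sp2" unfolding G using act_one Sp2_one by force
    show "inv\<^bsub>?G\<^esub> x \<in> act ` Sp2" if "x \<in> act ` Sp2" for x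
      using that inv_act Sp2_adj by force
  qed
  have "x \<otimes>\<^bsub>?G\<^esub> h \<otimes>\<^bsub>?G\<^esub> inv\<^bsub>?G\<^esub> x \<in> Sp2_maps" if xG: "x \<in> carrier ?G" and h: "h \<in> Sp2_maps" for x h
  proof -
    obtain A s where x: "A \<in> Sp2" "s \<in> {id, conj_cp3}" "x = act A \<circ> s" using xG unfolding carrier by blast
    obtain B where B: "B \<in> Sp2" "h = act B" using h unfolding Sp2_maps_eq by blast
    obtain B' where B': "B' \<in> Sp2" "s \<circ> act B = act B' \<circ> s" using commute[OF x(2) B(1)] by blast
    have A': "adj A \<in> Sp2" by (rule Sp2_adj[OF x(1)])
    have xi: "x \<circ> inv\<^bsub>?G\<^esub> x = id" using G.r_inv[OF xG] unfolding G .
    have "x \<circ> h = act A \<circ> act B' \<circ> s" unfolding x(3) B(2) using B'(2) by (metis comp_assoc)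
    \<comment> \<open>An identity is inserted so that x reappears on the right, which also handles
      the inverse of x without computing it.\<close>
    also have "\<dots> = act A \<circ> act B' \<circ> (act (adj A) \<circ> act A) \<circ> s" unfolding act_adj(1)[OF x(1)] by simp
    also have "\<dots> = act (A ** B' ** adj A) \<circ> x"
      unfolding x(3) act_mult[OF Sp2_mult[OF x(1) B'(1)] A', symmetric] act_mult[OF x(1) B'(1), symmetric]
      by (simp add: comp_assoc)
    finally have "x \<circ> h \<circ> inv\<^bsub>?G\<^esub> x = act (A ** B' ** adj A)" using xi by (metis comp_assoc comp_id)
    then show ?thesis unfolding G Sp2_maps_eq using Sp2_mult[OF Sp2_mult[OF x(1) B'(1)] A'] by blast
  qed
  then have normal: "Sp2_maps \<lhd> ?G" using sub G.normal_inv_iff by blast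
  have subH: "subgroup {id, conj_cp3} ?G"
    using G.generate_is_subgroup[of "{conj_cp3}"] conj_carrier unfolding gen by simp
  have int: "Sp2_maps \<inter> {id, conj_cp3} = {\<one>\<^bsub>?G\<^esub>}"
    using conj_not_act act_one Sp2_one unfolding G Sp2_maps_eq by force
  have prod: "carrier ?G = Sp2_maps <#>\<^bsub>?G\<^esub> {id, conj_cp3}"
    unfolding set_mult_def Sp2_maps_eq G(2) set_eq_iff carrier by auto
  show "internal_semidirect_product ?G Sp2_maps (generate ?G {conj_cp3})"
    unfolding internal_semidirect_product_def gen using G.group_axioms normal subH int prod by blast
  show "Sp2 = SU4 \<inter> Sp4C" by (rule Sp2_eq)
  have ne: "id \<noteq> conj_cp3" using conj_not_act[OF Sp2_one] act_one by metis
  let ?h = "\<lambda>x. if x = id then 0 else 1 :: int"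
  have "?h \<in> iso (?G\<lparr>carrier := {id, conj_cp3}\<rparr>) (integer_mod_group 2)"
  proof (rule isoI)
    show "?h \<in> hom (?G\<lparr>carrier := {id, conj_cp3}\<rparr>) (integer_mod_group 2)"
      by (rule homI) (use ne conj_conj in \<open>auto simp: G integer_mod_group_def\<close>)
    have "{0..<2::int} = {0, 1}" by auto
    then show "bij_betw ?h (carrier (?G\<lparr>carrier := {id, conj_cp3}\<rparr>)) (carrier (integer_mod_group 2))"
      using ne by (auto simp: bij_betw_def inj_on_def integer_mod_group_def)
  qed
  then show "?G\<lparr>carrier := generate ?G {conj_cp3}\<rparr> \<cong> integer_mod_group 2"
    unfolding gen is_iso_def by blast
qed

end
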